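(* Let $T$ be a set of sentences of dependence logic and let $\phi$ be a first-order sentence (a sentence of dependence logic containing no dependence atoms). Then $T\models\phi$ if and only if $T\vdash_{\mathcal{D}}\phi$.
   Context: Dependence logic $\mathcal{D}$: formulas are built from first-order atomic formulas, negated first-order formulas (negation $\neg$ is only applied to first-order formulas, i.e. formulas without dependence atoms), dependence atoms $=\!(t_1,\ldots,t_n)$ ($t_i$ terms), using $\wedge,\vee,\exists,\forall$. A team $X$ over a model $\mathfrak A$ (domain $A$) is a set of assignments with a common finite domain of variables. For $F:X\to A$, $X(F/x)=\{s(F(s)/x):s\in X\}$; $X(A/x)=\{s(a/x):s\in X,a\in A\}$. Satisfaction: for first-order $\phi$, $\mathfrak A\models_X\phi$ iff $\mathfrak A\models_s\phi$ (usual Tarskian satisfaction) for all $s\in X$; $\mathfrak A\models_X=\!(t_1,\ldots,t_n)$ iff for all $s,s'\in X$ agreeing on the values of $t_1,\ldots,t_{n-1}$, the values of $t_n$ agree; $\wedge$ is componentwise; $\mathfrak A\models_X\psi\vee\theta$ iff $X=Y\cup Z$ with $\mathfrak A\models_Y\psi$, $\mathfrak A\models_Z\theta$; $\mathfrak A\models_X\exists x\psi$ iff $\mathfrak A\models_{X(F/x)}\psi$ for some $F:X\to A$; $\mathfrak A\models_X\forall x\psi$ iff $\mathfrak A\models_{X(A/x)}\psi$. A sentence is true in $\mathfrak A$ if it is satisfied by the team $\{\emptyset\}$. $T\models\psi$ means: for all $\mathfrak A$ and teams $X$ whose domain contains the free variables of $\psi$ and of the formulas of $T$, if $\mathfrak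 A\models_X\theta$ for all $\theta\in T$ then $\mathfrak A\models_X\psi$. $T\vdash_{\mathcal{D}}\psi$ means $\psi$ is derivable from assumptions in $T$ in the following natural deduction system (substitutions $A(t/x)$ never capture variables of $t$): (1) $\wedge$-introduction and $\wedge$-elimination as usual; (2) $\vee$-introduction: from $A$ infer $A\vee B$ and $B\vee A$; (3) $\vee$-elimination: from $A\vee B$, a derivation of $C$ from $[A]$ and a derivation of $C$ from $[B]$, infer $C$, provided $C$ is first-order; (4) $\neg$-introduction: from a derivation of $B\wedge\neg B$ from $[A]$ infer $\neg A$, and $\neg$-elimination: from $\neg\neg A$ infer $A$, all formulas involved being first-order; (5) $\forall$-introduction: from $A$ infer $\forall x A$ provided $x$ is not free in any undischarged assumption used; $\forall$-elimination: from $\forall xA$ infer $A(t/x)$; (6) $\exists$-introduction: from $A(t/x)$ infer $\exists xA$; $\exists$-elimination: from $\exists xA$ and a derivation of $B$ from $[A]$ infer $B$, provided $x$ is not free in $B$ nor in any undischarged assumption of that derivation other than $A$; (7) disjunction substitution: from $A\vee B$ and a derivation of $C$ from $[B]$ infer $A\vee C$; (8) from $B\vee A$ infer $A\vee B$; from $(A\vee B)\vee C$ infer $A\vee(B\vee C)$; (9) from $\forall xA\vee B$ infer $\forall x(A\vee B)$, and from $\exists xA\vee B$ infer $\exists x(A\vee B)$, if $x$ is not free in $B$; (10) unnesting: from $=\!(t_1,\ldots,t_n)$ infer $\exists z(=\!(t_1,\ldots,t_{i-1},z,t_{i+1},\ldots,t_n)\wedge z=t_i)$, $z$ a new variable; (11)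 dependence distribution: from $\exists y_1\ldots\exists y_n(\bigwedge_{1\le j\le n}=\!(\vec z^j,y_j)\wedge C)\vee\exists y_{n+1}\ldots\exists y_{n+m}(\bigwedge_{n+1\le j\le n+m}=\!(\vec z^j,y_j)\wedge D)$, with $C,D$ quantifier-free without dependence atoms, $y_1,\ldots,y_n$ not occurring in the right disjunct and $y_{n+1},\ldots,y_{n+m}$ not in the left one, infer $\exists y_1\ldots\exists y_{n+m}(\bigwedge_{1\le j\le n+m}=\!(\vec z^j,y_j)\wedge(C\vee D))$; (12) dependence introduction: from $\exists x\forall yA$ infer $\forall y\exists x(=\!(\vec z,x)\wedge A)$, where $\vec z$ lists the free variables of $A$ other than $x,y$; (13) dependence elimination: from $\forall\vec x_0\exists\vec y_0(\bigwedge_{1\le j\le k}=\!(\vec w^{i_j},y_{0,i_j})\wedge B(\vec x_0,\vec y_0))$, where $\vec x_0=(x_{0,1},\ldots,x_{0,m})$, $\vec y_0=(y_{0,1},\ldots,y_{0,n})$ and the variables of $\vec w^{i_j}$ are among $x_{0,1},\ldots,x_{0,m},y_{0,1},\ldots,y_{0,i_j-1}$, infer $\forall\vec x_0\exists\vec y_0(B(\vec x_0,\vec y_0)\wedge\forall\vec x_1\exists\vec y_1(B(\vec x_1,\vec y_1)\wedge\bigwedge_{=(\vec w^p,y_{0,p})\in S}(\vec w^p_0=\vec w^p_1\to y_{0,p}=y_{1,p})))$; here $S$ consists of the atoms $=\!(\vec w^{i_j},y_{0,i_j})$, $1\le j\le k$, together with $=\!(x_{0,1},\ldots,x_{0,m},y_{0,p})$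 for each $p\notin\{i_1,\ldots,i_k\}$ (with $\vec w^p$ denoting its argument tuple), $\vec w^p_0=\vec w^p$, and $\vec x_1,\vec y_1,\vec w^p_1$ are obtained by replacing each $x_{0,s}$ by $x_{1,s}$ and $y_{0,s}$ by $y_{1,s}$; $\vec u=\vec v$ abbreviates the conjunction of coordinatewise equalities; (14) the usual identity axioms.
   Formalization: Rule (11) additionally requires y_1,…,y_n distinct and z^j free of y_j,…,y_n (likewise on the right), as it is unsound for circular dependencies; models range over subsets of an arbitrary infinite set at least as large as the vocabulary, which loses nothing up to isomorphism. *)

theory Defs
  imports Main "HOL-Library.Equipollence"
begin

section \<open>Syntax\<close>

text \<open>A vocabulary assigns arities to the function and relation symbols it contains;
  constants are function symbols of arity 0. Variables are natural numbers.\<close>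

record ('f, 'r) voc =
  funs :: "'f \<Rightarrow> nat option"
  rels :: "'r \<Rightarrow> nat option"

datatype 'f tm = Var nat | Fun 'f "'f tm list"

text \<open>\<^term>\<open>Dep [t\<^sub>1, t\<^sub>2, t\<^sub>3]\<close> is the dependence atom \<open>=(t\<^sub>1, t\<^sub>2, t\<^sub>3)\<close>. That negation
  is applied to first-order formulas only is part of \<open>form\<close> below.\<close>

datatype ('f, 'r) fm =
    Eq "'f tm" "'f tm"
  | Rel 'r "'f tm list"
  | Dep "'f tm list"
  | Neg "('f, 'r) fm"
  | And "('f, 'r) fm" "('f, 'r) fm"
  | Or "('f, 'r) fm" "('f, 'r) fm"
  | Exists nat "('f, 'r) fm"
  | Forall nat "('f, 'r) fm"

primrec tm_ok :: "('f, 'r) voc \<Rightarrow> 'f tm \<Rightarrow> bool" where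
  "tm_ok L (Var x) \<longleftrightarrow> True"
| "tm_ok L (Fun f ts) \<longleftrightarrow> funs L f = Some (length ts) \<and> list_all (tm_ok L) ts"

primrec fo :: "('f, 'r) fm \<Rightarrow> bool" where
  "fo (Eq t u) \<longleftrightarrow> True"
| "fo (Rel r ts) \<longleftrightarrow> True"
| "fo (Dep ts) \<longleftrightarrow> False"
| "fo (Neg A) \<longleftrightarrow> fo A"
| "fo (And A B) \<longleftrightarrow> fo A \<and> fo B"
| "fo (Or A B) \<longleftrightarrow> fo A \<and> fo B"
| "fo (Exists x A) \<longleftrightarrow> fo A"
| "fo (Forall x A) \<longleftrightarrow> fo A"

primrec qfree :: "('f, 'r) fm \<Rightarrow> bool" where
  "qfree (Eq t u) \<longleftrightarrow> True"
| "qfree (Rel r ts) \<longleftrightarrow> True"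
| "qfree (Dep ts) \<longleftrightarrow> True"
| "qfree (Neg A) \<longleftrightarrow> qfree A"
| "qfree (And A B) \<longleftrightarrow> qfree A \<and> qfree B"
| "qfree (Or A B) \<longleftrightarrow> qfree A \<and> qfree B"
| "qfree (Exists x A) \<longleftrightarrow> False"
| "qfree (Forall x A) \<longleftrightarrow> False"

text \<open>The formulas of dependence logic over the vocabulary \<open>L\<close>.\<close>

primrec form :: "('f, 'r) voc \<Rightarrow> ('f, 'r) fm \<Rightarrow> bool" where
  "form L (Eq t u) \<longleftrightarrow> tm_ok L t \<and> tm_ok L u"
| "form L (Rel r ts) \<longleftrightarrow> rels L r = Some (length ts) \<and> list_all (tm_ok L) ts"
| "form L (Dep ts) \<longleftrightarrow> ts \<noteq> [] \<and> list_all (tm_ok L) ts"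
| "form L (Neg A) \<longleftrightarrow> form L A \<and> fo A"
| "form L (And A B) \<longleftrightarrow> form L A \<and> form L B"
| "form L (Or A B) \<longleftrightarrow> form L A \<and> form L B"
| "form L (Exists x A) \<longleftrightarrow> form L A"
| "form L (Forall x A) \<longleftrightarrow> form L A"

primrec tvars :: "'f tm \<Rightarrow> nat set" where
  "tvars (Var x) = {x}"
| "tvars (Fun f ts) = \<Union> (set (map tvars ts))"

primrec fv :: "('f, 'r) fm \<Rightarrow> nat set" where
  "fv (Eq t u) = tvars t \<union> tvars u"
| "fv (Rel r ts) = \<Union> (set (map tvars ts))"
| "fv (Dep ts) = \<Union> (set (map tvars ts))"
| "fv (Neg A) = fv A"
| "fv (And A B) = fv A \<union> fv B"
| "fv (Or A B) = fv A \<union> fv B"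
| "fv (Exists x A) = fv A - {x}"
| "fv (Forall x A) = fv A - {x}"

text \<open>Forall variables occurring in a formula, including quantified ones.\<close>

primrec vars :: "('f, 'r) fm \<Rightarrow> nat set" where
  "vars (Eq t u) = tvars t \<union> tvars u"
| "vars (Rel r ts) = \<Union> (set (map tvars ts))"
| "vars (Dep ts) = \<Union> (set (map tvars ts))"
| "vars (Neg A) = vars A"
| "vars (And A B) = vars A \<union> vars B"
| "vars (Or A B) = vars A \<union> vars B"
| "vars (Exists x A) = insert x (vars A)"
| "vars (Forall x A) = insert x (vars A)"

definition sentence :: "('f, 'r) voc \<Rightarrow> ('f, 'r) fm \<Rightarrow> bool" where
  "sentence L A \<longleftrightarrow> form L A \<and> fv A = {}"

text \<open>Simultaneous substitution for the free variables. It does not rename bound variables;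
  \<open>free_for\<close> says that no variable of a substituted term is captured.\<close>

primrec tsubst :: "(nat \<Rightarrow> 'f tm) \<Rightarrow> 'f tm \<Rightarrow> 'f tm" where
  "tsubst \<sigma> (Var x) = \<sigma> x"
| "tsubst \<sigma> (Fun f ts) = Fun f (map (tsubst \<sigma>) ts)"

primrec subst :: "(nat \<Rightarrow> 'f tm) \<Rightarrow> ('f, 'r) fm \<Rightarrow> ('f, 'r) fm" where
  "subst \<sigma> (Eq t u) = Eq (tsubst \<sigma> t) (tsubst \<sigma> u)"
| "subst \<sigma> (Rel r ts) = Rel r (map (tsubst \<sigma>) ts)"
| "subst \<sigma> (Dep ts) = Dep (map (tsubst \<sigma>) ts)"
| "subst \<sigma> (Neg A) = Neg (subst \<sigma> A)"
| "subst \<sigma> (And A B) = And (subst \<sigma> A) (subst \<sigma> B)"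
| "subst \<sigma> (Or A B) = Or (subst \<sigma> A) (subst \<sigma> B)"
| "subst \<sigma> (Exists x A) = Exists x (subst (\<sigma>(x := Var x)) A)"
| "subst \<sigma> (Forall x A) = Forall x (subst (\<sigma>(x := Var x)) A)"

primrec free_for :: "(nat \<Rightarrow> 'f tm) \<Rightarrow> ('f, 'r) fm \<Rightarrow> bool" where
  "free_for \<sigma> (Eq t u) \<longleftrightarrow> True"
| "free_for \<sigma> (Rel r ts) \<longleftrightarrow> True"
| "free_for \<sigma> (Dep ts) \<longleftrightarrow> True"
| "free_for \<sigma> (Neg A) \<longleftrightarrow> free_for \<sigma> A"
| "free_for \<sigma> (And A B) \<longleftrightarrow> free_for \<sigma> A \<and> free_for \<sigma> B"
| "free_for \<sigma> (Or A B) \<longleftrightarrow> free_for \<sigma> A \<and> free_for \<sigma> B"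
| "free_for \<sigma> (Exists x A) \<longleftrightarrow>
     (\<forall>v \<in> fv A - {x}. x \<notin> tvars (\<sigma> v)) \<and> free_for (\<sigma>(x := Var x)) A"
| "free_for \<sigma> (Forall x A) \<longleftrightarrow>
     (\<forall>v \<in> fv A - {x}. x \<notin> tvars (\<sigma> v)) \<and> free_for (\<sigma>(x := Var x)) A"

abbreviation subst1 :: "('f, 'r) fm \<Rightarrow> 'f tm \<Rightarrow> nat \<Rightarrow> ('f, 'r) fm" where
  "subst1 A t x \<equiv> subst (Var(x := t)) A"

abbreviation free_for1 :: "'f tm \<Rightarrow> nat \<Rightarrow> ('f, 'r) fm \<Rightarrow> bool" where
  "free_for1 t x A \<equiv> free_for (Var(x := t)) A"


section \<open>Team semantics\<close>

record ('f, 'r, 'u) struct =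
  universe :: "'u set"
  fint :: "'f \<Rightarrow> 'u list \<Rightarrow> 'u"
  rint :: "'r \<Rightarrow> 'u list \<Rightarrow> bool"

definition structure_of :: "('f, 'r) voc \<Rightarrow> ('f, 'r, 'u) struct \<Rightarrow> bool" where
  "structure_of L M \<longleftrightarrow> universe M \<noteq> {} \<and>
     (\<forall>f n as. funs L f = Some n \<longrightarrow> length as = n \<longrightarrow> set as \<subseteq> universe M \<longrightarrow> fint M f as \<in> universe M)"

type_synonym 'u asg = "nat \<rightharpoonup> 'u"

primrec val :: "('f, 'r, 'u) struct \<Rightarrow> 'u asg \<Rightarrow> 'f tm \<Rightarrow> 'u" where
  "val M s (Var x) = the (s x)"
| "val M s (Fun f ts) = fint M f (map (val M s) ts)"

text \<open>Tarskian satisfaction, meaningful for first-order formulas only; the clause for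
  \<^const>\<open>Dep\<close> is a dummy that is never used.\<close>

primrec sat :: "('f, 'r, 'u) struct \<Rightarrow> 'u asg \<Rightarrow> ('f, 'r) fm \<Rightarrow> bool" where
  "sat M s (Eq t u) \<longleftrightarrow> val M s t = val M s u"
| "sat M s (Rel r ts) \<longleftrightarrow> rint M r (map (val M s) ts)"
| "sat M s (Dep ts) \<longleftrightarrow> True"
| "sat M s (Neg A) \<longleftrightarrow> \<not> sat M s A"
| "sat M s (And A B) \<longleftrightarrow> sat M s A \<and> sat M s B"
| "sat M s (Or A B) \<longleftrightarrow> sat M s A \<or> sat M s B"
| "sat M s (Exists x A) \<longleftrightarrow> (\<exists>a \<in> universe M. sat M (s(x \<mapsto> a)) A)"
| "sat M s (Forall x A) \<longleftrightarrow> (\<forall>a \<in> universe M. sat M (s(x \<mapsto> a)) A)"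

definition team :: "('f, 'r, 'u) struct \<Rightarrow> nat set \<Rightarrow> 'u asg set \<Rightarrow> bool" where
  "team M V X \<longleftrightarrow> finite V \<and> (\<forall>s \<in> X. dom s = V \<and> ran s \<subseteq> universe M)"

definition supplement :: "'u asg set \<Rightarrow> ('u asg \<Rightarrow> 'u) \<Rightarrow> nat \<Rightarrow> 'u asg set" where
  "supplement X F x = {s(x \<mapsto> F s) | s. s \<in> X}"

definition duplicate :: "'u asg set \<Rightarrow> 'u set \<Rightarrow> nat \<Rightarrow> 'u asg set" where
  "duplicate X U x = {s(x \<mapsto> a) | s a. s \<in> X \<and> a \<in> U}"

primrec tsat :: "('f, 'r, 'u) struct \<Rightarrow> 'u asg set \<Rightarrow> ('f, 'r) fm \<Rightarrow> bool" where
  "tsat M X (Eq t u) \<longleftrightarrow> (\<forall>s \<in> X. sat M s (Eq t u))"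
| "tsat M X (Rel r ts) \<longleftrightarrow> (\<forall>s \<in> X. sat M s (Rel r ts))"
| "tsat M X (Dep ts) \<longleftrightarrow>
     (\<forall>s \<in> X. \<forall>s' \<in> X. (\<forall>t \<in> set (butlast ts). val M s t = val M s' t) \<longrightarrow>
        val M s (last ts) = val M s' (last ts))"
| "tsat M X (Neg A) \<longleftrightarrow> (\<forall>s \<in> X. sat M s (Neg A))"
| "tsat M X (And A B) \<longleftrightarrow> tsat M X A \<and> tsat M X B"
| "tsat M X (Or A B) \<longleftrightarrow> (\<exists>Y Z. X = Y \<union> Z \<and> tsat M Y A \<and> tsat M Z B)"
| "tsat M X (Exists x A) \<longleftrightarrow> (\<exists>F. F ` X \<subseteq> universe M \<and> tsat M (supplement X F x) A)"
| "tsat M X (Forall x A) \<longleftrightarrow> tsat M (duplicate X (universe M) x) A"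

text \<open>For all first-order formulas, not only for atoms and negations, team satisfaction is
  pointwise Tarskian satisfaction.\<close>

lemma tsat_fo:
  "fo A \<Longrightarrow> tsat M X A \<longleftrightarrow> (\<forall>s \<in> X. sat M s A)"
proof (induction A arbitrary: X)
  case (Or A B)
  have "tsat M X (Or A B) \<longleftrightarrow>
      (\<exists>Y Z. X = Y \<union> Z \<and> (\<forall>s \<in> Y. sat M s A) \<and> (\<forall>s \<in> Z. sat M s B))"
    using Or by simp
  also have "\<dots> \<longleftrightarrow> (\<forall>s \<in> X. sat M s A \<or> sat M s B)"
  proof
    assume "\<forall>s \<in> X. sat M s A \<or> sat M s B"
    then have "X = {s \<in> X. sat M s A} \<union> {s \<in> X. sat M s B}" by blast
    then show "\<exists>Y Z. X = Y \<union> Z \<and> (\<forall>s \<in> Y. sat M s A) \<and> (\<forall>s \<in> Z. sat M s B)"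
      by blast
  qed blast
  finally show ?case by simp
next
  case (Exists x A)
  have "tsat M X (Exists x A) \<longleftrightarrow> (\<exists>F. \<forall>s \<in> X. F s \<in> universe M \<and> sat M (s(x \<mapsto> F s)) A)"
  proof -
    have "tsat M (supplement X F x) A \<longleftrightarrow> (\<forall>s \<in> X. sat M (s(x \<mapsto> F s)) A)" for F
      using Exists by (auto simp: supplement_def)
    then show ?thesis by (simp add: image_subset_iff ball_conj_distrib)
  qed
  also have "\<dots> \<longleftrightarrow> (\<forall>s \<in> X. \<exists>a. a \<in> universe M \<and> sat M (s(x \<mapsto> a)) A)"
    by (rule bchoice_iff[symmetric])
  finally show ?case by (simp add: Bex_def)
qed (auto simp: duplicate_def)

text \<open>Semantic consequence. The structures range over those whose universe is a subset of the
  type \<open>'u\<close>, which is passed as an argument because it does not occur in the other ones.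
  HOL cannot quantify over types inside a formula; a structure on any other type is isomorphic to
  one on a subset of every type that is at least as large.\<close>

definition entails ::
    "'u itself \<Rightarrow> ('f, 'r) voc \<Rightarrow> ('f, 'r) fm set \<Rightarrow> ('f, 'r) fm \<Rightarrow> bool" where
  "entails _ L T A \<longleftrightarrow>
     (\<forall>(M :: ('f, 'r, 'u) struct) V X.
        structure_of L M \<longrightarrow> team M V X \<longrightarrow> fv A \<union> \<Union> (fv ` T) \<subseteq> V \<longrightarrow>
        (\<forall>B \<in> T. tsat M X B) \<longrightarrow> tsat M X A)"


section \<open>The natural deduction system\<close>

abbreviation Imp :: "('f, 'r) fm \<Rightarrow> ('f, 'r) fm \<Rightarrow> ('f, 'r) fm" where
  "Imp A B \<equiv> Or (Neg A) B"

text \<open>Finite conjunctions. A conjunction \<open>\<And>\<^sub>j A\<^sub>j \<and> C\<close> is read as the conjunction of the list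
  \<open>A\<^sub>1, \<dots>, A\<^sub>n, C\<close>, so that it is just \<open>C\<close> if \<open>n = 0\<close>. The empty conjunction, a valid sentence, only
  arises from an equation between empty tuples.\<close>

fun conjs :: "('f, 'r) fm list \<Rightarrow> ('f, 'r) fm" where
  "conjs [] = Forall 0 (Eq (Var 0) (Var 0))"
| "conjs [A] = A"
| "conjs (A # B # As) = And A (conjs (B # As))"

definition eqs :: "'f tm list \<Rightarrow> 'f tm list \<Rightarrow> ('f, 'r) fm" where
  "eqs ts us = conjs (map2 Eq ts us)"

definition exs :: "nat list \<Rightarrow> ('f, 'r) fm \<Rightarrow> ('f, 'r) fm" where
  "exs xs A = foldr Exists xs A"

definition alls :: "nat list \<Rightarrow> ('f, 'r) fm \<Rightarrow> ('f, 'r) fm" where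
  "alls xs A = foldr Forall xs A"

definition depv :: "nat list \<Rightarrow> nat \<Rightarrow> ('f, 'r) fm" where
  "depv zs y = Dep (map Var (zs @ [y]))"

text \<open>\<open>dep_block [(z\<^sup>1, y\<^sub>1), \<dots>, (z\<^sup>n, y\<^sub>n)] C\<close> is \<open>\<exists>y\<^sub>1 \<dots> \<exists>y\<^sub>n (\<And>\<^sub>j =(z\<^sup>j, y\<^sub>j) \<and> C)\<close>.\<close>

definition dep_block :: "(nat list \<times> nat) list \<Rightarrow> ('f, 'r) fm \<Rightarrow> ('f, 'r) fm" where
  "dep_block ds C = exs (map snd ds) (conjs (map (\<lambda>(zs, y). depv zs y) ds @ [C]))"

text \<open>The variables \<open>y\<^sub>1, \<dots>, y\<^sub>n\<close> are pairwise distinct, and \<open>z\<^sup>j\<close> contains none of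
  \<open>y\<^sub>j, \<dots>, y\<^sub>n\<close>. Distribution of dependence over disjunction is unsound for repeated variables
  and for circular dependencies such as \<open>=(x\<^sub>1, y\<^sub>2, y\<^sub>1) \<and> =(x\<^sub>2, y\<^sub>1, y\<^sub>2)\<close>.\<close>

definition dep_block_ok :: "(nat list \<times> nat) list \<Rightarrow> bool" where
  "dep_block_ok ds \<longleftrightarrow> distinct (map snd ds) \<and>
     (\<forall>j < length ds. set (fst (ds ! j)) \<inter> set (map snd (drop j ds)) = {})"

text \<open>Dependence elimination. The list \<open>ds\<close> consists of the pairs \<open>(w\<^sup>p, p)\<close>, for \<open>p\<close> among
  \<open>i\<^sub>1, \<dots>, i\<^sub>k\<close>, where \<open>p\<close> is the (0-based) position in \<open>ys\<close> of the variable depending on \<open>w\<^sup>p\<close>.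
  The lists \<open>xs\<close>, \<open>ys\<close> and \<open>xs'\<close>, \<open>ys'\<close> are the variables indexed by 0 and by 1, respectively.
  Free variables of \<open>B\<close> other than \<open>xs\<close>, \<open>ys\<close> are parameters.\<close>

definition depE_premise ::
    "nat list \<Rightarrow> nat list \<Rightarrow> (nat list \<times> nat) list \<Rightarrow> ('f, 'r) fm \<Rightarrow> ('f, 'r) fm" where
  "depE_premise xs ys ds B =
     alls xs (exs ys (conjs (map (\<lambda>(ws, p). depv ws (ys ! p)) ds @ [B])))"

definition depE_atoms ::
    "nat list \<Rightarrow> nat list \<Rightarrow> (nat list \<times> nat) list \<Rightarrow> (nat list \<times> nat) list" where
  "depE_atoms xs ys ds =
     ds @ map (\<lambda>p. (xs, p)) (filter (\<lambda>p. p \<notin> snd ` set ds) [0..<length ys])"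

definition rename :: "nat list \<Rightarrow> nat list \<Rightarrow> nat \<Rightarrow> nat" where
  "rename vs vs' v = (case map_of (zip vs vs') v of None \<Rightarrow> v | Some v' \<Rightarrow> v')"

definition depE_conclusion ::
    "nat list \<Rightarrow> nat list \<Rightarrow> nat list \<Rightarrow> nat list \<Rightarrow> (nat list \<times> nat) list \<Rightarrow>
      ('f, 'r) fm \<Rightarrow> ('f, 'r) fm" where
  "depE_conclusion xs ys xs' ys' ds B =
     (let \<rho> = rename (xs @ ys) (xs' @ ys') in
      alls xs (exs ys (And B
        (alls xs' (exs ys' (conjs
          (subst (\<lambda>v. Var (\<rho> v)) B #
           map (\<lambda>(ws, p). Imp (eqs (map Var ws) (map (\<lambda>w. Var (\<rho> w)) ws))
                              (Eq (Var (ys ! p)) (Var (ys' ! p))))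
             (depE_atoms xs ys ds))))))))"

definition depE_ok ::
    "nat list \<Rightarrow> nat list \<Rightarrow> nat list \<Rightarrow> nat list \<Rightarrow> (nat list \<times> nat) list \<Rightarrow>
      ('f, 'r) fm \<Rightarrow> bool" where
  "depE_ok xs ys xs' ys' ds B \<longleftrightarrow>
     distinct (xs @ ys) \<and> distinct (map snd ds) \<and>
     (\<forall>(ws, p) \<in> set ds. p < length ys \<and> set ws \<subseteq> set xs \<union> set (take p ys)) \<and>
     length xs' = length xs \<and> length ys' = length ys \<and> distinct (xs' @ ys') \<and>
     set (xs' @ ys') \<inter> vars (depE_premise xs ys ds B) = {}"

text \<open>\<open>derives L \<Gamma> A\<close>: there is a derivation of \<open>A\<close>, consisting of formulas over \<open>L\<close>, all of whose
  undischarged assumptions belong to \<open>\<Gamma>\<close>. By the rule \<open>d_weaken\<close> the eigenvariable conditions of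
  \<open>d_allI\<close> and \<open>d_exE\<close> concern only the assumptions actually used.\<close>

inductive derives :: "('f, 'r) voc \<Rightarrow> ('f, 'r) fm set \<Rightarrow> ('f, 'r) fm \<Rightarrow> bool"
  for L :: "('f, 'r) voc" where
  d_assm: "A \<in> \<Gamma> \<Longrightarrow> form L A \<Longrightarrow> derives L \<Gamma> A"
| d_weaken: "derives L \<Gamma> A \<Longrightarrow> \<Gamma> \<subseteq> \<Delta> \<Longrightarrow> derives L \<Delta> A"
| d_conjI: "derives L \<Gamma> A \<Longrightarrow> derives L \<Gamma> B \<Longrightarrow> derives L \<Gamma> (And A B)"
| d_conjE1: "derives L \<Gamma> (And A B) \<Longrightarrow> derives L \<Gamma> A"
| d_conjE2: "derives L \<Gamma> (And A B) \<Longrightarrow> derives L \<Gamma> B"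
| d_disjI1: "derives L \<Gamma> A \<Longrightarrow> form L B \<Longrightarrow> derives L \<Gamma> (Or A B)"
| d_disjI2: "derives L \<Gamma> A \<Longrightarrow> form L B \<Longrightarrow> derives L \<Gamma> (Or B A)"
| d_disjE: "derives L \<Gamma> (Or A B) \<Longrightarrow> derives L (insert A \<Gamma>) C \<Longrightarrow> derives L (insert B \<Gamma>) C \<Longrightarrow>
    fo C \<Longrightarrow> derives L \<Gamma> C"
| d_negI: "derives L (insert A \<Gamma>) (And B (Neg B)) \<Longrightarrow> form L A \<Longrightarrow> fo A \<Longrightarrow> fo B \<Longrightarrow>
    derives L \<Gamma> (Neg A)"
| d_negE: "derives L \<Gamma> (Neg (Neg A)) \<Longrightarrow> fo A \<Longrightarrow> derives L \<Gamma> A"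
| d_allI: "derives L \<Gamma> A \<Longrightarrow> x \<notin> \<Union> (fv ` \<Gamma>) \<Longrightarrow> derives L \<Gamma> (Forall x A)"
| d_allE: "derives L \<Gamma> (Forall x A) \<Longrightarrow> tm_ok L t \<Longrightarrow> free_for1 t x A \<Longrightarrow> derives L \<Gamma> (subst1 A t x)"
| d_exI: "derives L \<Gamma> (subst1 A t x) \<Longrightarrow> tm_ok L t \<Longrightarrow> free_for1 t x A \<Longrightarrow> derives L \<Gamma> (Exists x A)"
| d_exE: "derives L \<Gamma> (Exists x A) \<Longrightarrow> derives L (insert A \<Delta>) B \<Longrightarrow> x \<notin> fv B \<Longrightarrow>
    x \<notin> \<Union> (fv ` \<Delta>) \<Longrightarrow> derives L (\<Gamma> \<union> \<Delta>) B"
| d_disj_subst: "derives L \<Gamma> (Or A B) \<Longrightarrow> derives L (insert B \<Gamma>) C \<Longrightarrow> derives L \<Gamma> (Or A C)"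
| d_disj_comm: "derives L \<Gamma> (Or B A) \<Longrightarrow> derives L \<Gamma> (Or A B)"
| d_disj_assoc: "derives L \<Gamma> (Or (Or A B) C) \<Longrightarrow> derives L \<Gamma> (Or A (Or B C))"
| d_all_scope: "derives L \<Gamma> (Or (Forall x A) B) \<Longrightarrow> x \<notin> fv B \<Longrightarrow> derives L \<Gamma> (Forall x (Or A B))"
| d_ex_scope: "derives L \<Gamma> (Or (Exists x A) B) \<Longrightarrow> x \<notin> fv B \<Longrightarrow> derives L \<Gamma> (Exists x (Or A B))"
| d_unnest: "derives L \<Gamma> (Dep ts) \<Longrightarrow> i < length ts \<Longrightarrow> z \<notin> fv (Dep ts :: ('f, 'r) fm) \<Longrightarrow>
    derives L \<Gamma> (Exists z (And (Dep (ts[i := Var z])) (Eq (Var z) (ts ! i))))"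
| d_dep_distr: "derives L \<Gamma> (Or (dep_block ds C) (dep_block es D)) \<Longrightarrow>
    fo C \<Longrightarrow> qfree C \<Longrightarrow> fo D \<Longrightarrow> qfree D \<Longrightarrow> dep_block_ok ds \<Longrightarrow> dep_block_ok es \<Longrightarrow>
    set (map snd ds) \<inter> vars (dep_block es D) = {} \<Longrightarrow>
    set (map snd es) \<inter> vars (dep_block ds C) = {} \<Longrightarrow>
    derives L \<Gamma> (dep_block (ds @ es) (Or C D))"
| d_depI: "derives L \<Gamma> (Exists x (Forall y A)) \<Longrightarrow> distinct zs \<Longrightarrow> set zs = fv A - {x, y} \<Longrightarrow>
    derives L \<Gamma> (Forall y (Exists x (And (depv zs x) A)))"
| d_depE: "derives L \<Gamma> (depE_premise xs ys ds B) \<Longrightarrow> depE_ok xs ys xs' ys' ds B \<Longrightarrow>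
    derives L \<Gamma> (depE_conclusion xs ys xs' ys' ds B)"
| d_eq_refl: "tm_ok L t \<Longrightarrow> derives L \<Gamma> (Eq t t)"
| d_eq_sym: "tm_ok L t \<Longrightarrow> tm_ok L u \<Longrightarrow> derives L \<Gamma> (Imp (Eq t u) (Eq u t))"
| d_eq_trans: "tm_ok L t \<Longrightarrow> tm_ok L u \<Longrightarrow> tm_ok L v \<Longrightarrow>
    derives L \<Gamma> (Imp (And (Eq t u) (Eq u v)) (Eq t v))"
| d_eq_fun: "tm_ok L (Fun f ts) \<Longrightarrow> tm_ok L (Fun f us) \<Longrightarrow>
    derives L \<Gamma> (Imp (eqs ts us) (Eq (Fun f ts) (Fun f us)))"
| d_eq_rel: "form L (Rel r ts) \<Longrightarrow> form L (Rel r us) \<Longrightarrow>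
    derives L \<Gamma> (Imp (eqs ts us) (Imp (Rel r ts) (Rel r us)))"

end

(* Soundness is checked on teams of total assignments, where locality, downward closure and
   the substitution lemma take care of all side conditions.

   For completeness, every formula of dependence logic derives an equivalent normal form
   "forall x exists y (dependence atoms and C)" with C quantifier-free, whose truth amounts to the
   existence of Skolem functions that respect the atoms. Let such a sentence be consistent. Dependence
   elimination, applied with the matrix still containing the dependence atoms and with the earlier
   variables as parameters, yields a game that can be continued forever: whenever the universal player
   picks a tuple of terms, fresh variables answer it, satisfy C and are coherent with all earlier
   answers, and the position remains consistent. Over a countable set of terms all tuples can be played,
   so in the term model of the resulting consistent set the answers define Skolem functions. Thus every
   finite consistent set of sentences has a model. An arbitrary theory is reduced to its finite subsets
   by adding Skolem function symbols for all normal forms: the quantifier-free instances are consistent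
   by soundness, and their term model, which is no larger than the vocabulary, is a model of the theory. *)

theory Submission
  imports Defs "HOL-Library.Countable_Set"
begin

section \<open>Locality, substitution and Skolem functions in team semantics\<close>

text \<open>Variables are natural numbers and every round of the game consumes a block of fresh
  ones, so only countably many rounds can be played. Hence the game uses only the finitely many
  function symbols of one matrix, while derivations stay over the whole of \<open>L\<close>; and
  hence arbitrary theories, which may need more rounds than there are variables, pass through finite
  subsets and Skolem symbols. The moves are fixed in advance, as an enumeration of all tuples of
  terms in all variables. The blocks are chosen afterwards, block \<open>b k\<close> outside the
  variables of all moves up to \<open>e k\<close>, so that no move mentions its own or a later
  block. Variable 0 never belongs to a block: it is bound in the empty conjunction and it fills the
  first move. In both constructions only quantifier-free consequences are read off a term model. No
  Henkin witnesses are added; fresh variables or Skolem terms take their place.\<close>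

lemma tsubst_Var [simp]: "tsubst Var t = t"
  by (induction t) (auto simp: list.map_ident_strong)

lemma subst_Var [simp]: "subst Var A = A"
  by (induction A) (auto simp: list.map_ident_strong fun_upd_idem)

lemma free_for_Var [simp]: "free_for Var A"
  by (induction A) (auto simp: fun_upd_idem)

text \<open>Agreement is asked of \<open>the (s v)\<close> only, because \<open>val\<close> reads an
  assignment through \<open>the\<close>. An undefined variable then has the fixed value
  \<open>the None\<close>, so partial and total assignments can be compared without conditions on
  domains.\<close>

lemma val_cong: "(\<And>v. v \<in> tvars t \<Longrightarrow> the (s v) = the (r v)) \<Longrightarrow> val M s t = val M r t"
  by (induction t) (fastforce intro!: arg_cong[where f = "fint M _"])+

lemma val_upd: "x \<notin> tvars t \<Longrightarrow> val M (s(x \<mapsto> a)) t = val M s t"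
  by (rule val_cong) auto

lemma val_tsubst: "val M s (tsubst \<sigma> t) = val M (\<lambda>v. Some (val M s (\<sigma> v))) t"
  by (induction t) (auto intro!: arg_cong[where f = "fint M _"])

lemma val_tsubst_cong:
  assumes "\<And>v. v \<in> tvars t \<Longrightarrow> val M s (\<sigma> v) = val M r (\<tau> v)"
  shows "val M s (tsubst \<sigma> t) = val M r (tsubst \<tau> t)"
  unfolding val_tsubst by (rule val_cong) (use assms in auto)

text \<open>The quantifier step shared by the two transfer lemmas: as no substituted term contains
  the bound variable, giving it a new value does not disturb the matched values.\<close>

lemma agree_upd:
  assumes "\<forall>v \<in> fv A - {x}. x \<notin> tvars (\<sigma> v)" and "\<forall>v \<in> fv A - {x}. x \<notin> tvars (\<tau> v)"
    and "\<forall>v \<in> fv A - {x}. val M s (\<sigma> v) = val M r (\<tau> v)"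
  shows "\<forall>v \<in> fv A. val M (s(x \<mapsto> a)) ((\<sigma>(x := Var x)) v) = val M (r(x \<mapsto> a)) ((\<tau>(x := Var x)) v)"
  using assms by (auto simp: val_upd)

text \<open>With two substitutions one induction covers both uses: \<open>\<tau> = Var\<close> gives
  the substitution lemma, and \<open>Var\<close> on both sides gives locality.\<close>

lemma sat_transfer:
  "free_for \<sigma> A \<Longrightarrow> free_for \<tau> A \<Longrightarrow> \<forall>v \<in> fv A. val M s (\<sigma> v) = val M r (\<tau> v) \<Longrightarrow>
    sat M s (subst \<sigma> A) \<longleftrightarrow> sat M r (subst \<tau> A)"
proof (induction A arbitrary: \<sigma> \<tau> s r)
  case (Eq t u)
  then have "val M s (tsubst \<sigma> t) = val M r (tsubst \<tau> t)" "val M s (tsubst \<sigma> u) = val M r (tsubst \<tau> u)"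
    by (auto intro!: val_tsubst_cong)
  then show ?case by simp
next
  case (Rel p ts)
  then have "map (val M s \<circ> tsubst \<sigma>) ts = map (val M r \<circ> tsubst \<tau>) ts"
    by (fastforce intro!: val_tsubst_cong)
  then show ?case by (metis list.map_comp sat.simps(2) subst.simps(2))
next
  case (Exists x A)
  have "sat M (s(x \<mapsto> a)) (subst (\<sigma>(x := Var x)) A) \<longleftrightarrow> sat M (r(x \<mapsto> a)) (subst (\<tau>(x := Var x)) A)" for a
  proof (rule Exists.IH)
    show "free_for (\<sigma>(x := Var x)) A" "free_for (\<tau>(x := Var x)) A" using Exists.prems by simp_all
    show "\<forall>v \<in> fv A. val M (s(x \<mapsto> a)) ((\<sigma>(x := Var x)) v) = val M (r(x \<mapsto> a)) ((\<tau>(x := Var x)) v)"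
      by (rule agree_upd) (use Exists.prems in simp_all)
  qed
  then show ?case by simp
next
  case (Forall x A)
  have "sat M (s(x \<mapsto> a)) (subst (\<sigma>(x := Var x)) A) \<longleftrightarrow> sat M (r(x \<mapsto> a)) (subst (\<tau>(x := Var x)) A)" for a
  proof (rule Forall.IH)
    show "free_for (\<sigma>(x := Var x)) A" "free_for (\<tau>(x := Var x)) A" using Forall.prems by simp_all
    show "\<forall>v \<in> fv A. val M (s(x \<mapsto> a)) ((\<sigma>(x := Var x)) v) = val M (r(x \<mapsto> a)) ((\<tau>(x := Var x)) v)"
      by (rule agree_upd) (use Forall.prems in simp_all)
  qed
  then show ?case by simp
next
  case (Neg A)
  then show ?case by auto
next
  case (And A B)
  then show ?case by (metis UnCI free_for.simps(5) fv.simps(5) sat.simps(5) subst.simps(5))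
next
  case (Or A B)
  then show ?case by (metis UnCI free_for.simps(6) fv.simps(6) sat.simps(6) subst.simps(6))
qed simp

lemma sat_cong: "(\<And>v. v \<in> fv A \<Longrightarrow> the (s v) = the (r v)) \<Longrightarrow> sat M s A \<longleftrightarrow> sat M r A"
  using sat_transfer[of Var A Var M s r] by simp

lemma sat_subst: "free_for \<sigma> A \<Longrightarrow> sat M s (subst \<sigma> A) \<longleftrightarrow> sat M (\<lambda>v. Some (val M s (\<sigma> v))) A"
  using sat_transfer[of \<sigma> A Var M s] by simp

text \<open>Locality, downward closure and the substitution lemma at once: it suffices that every
  assignment of \<open>Y\<close> is matched by one of \<open>X\<close>.\<close>

lemma tsat_transfer:
  "form L A \<Longrightarrow> free_for \<sigma> A \<Longrightarrow> free_for \<tau> A \<Longrightarrow>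
    \<forall>s \<in> Y. \<exists>r \<in> X. \<forall>v \<in> fv A. val M s (\<sigma> v) = val M r (\<tau> v) \<Longrightarrow>
    tsat M X (subst \<tau> A) \<Longrightarrow> tsat M Y (subst \<sigma> A)"
proof (induction A arbitrary: \<sigma> \<tau> X Y)
  case (Eq t u)
  have "sat M s (subst \<sigma> (Eq t u))" if "s \<in> Y" for s
    using Eq(4,5) that sat_transfer[OF Eq(2,3)] by (metis subst.simps(1) tsat.simps(1))
  then show ?case by simp
next
  case (Rel p ts)
  have "sat M s (subst \<sigma> (Rel p ts))" if "s \<in> Y" for s
    using Rel(4,5) that sat_transfer[OF Rel(2,3)] by (metis subst.simps(2) tsat.simps(2))
  then show ?case by simp
next
  case (Neg A)
  have "sat M s (subst \<sigma> (Neg A))" if "s \<in> Y" for s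
    using Neg(5,6) that sat_transfer[OF Neg(3,4)] by (metis subst.simps(4) tsat.simps(4))
  then show ?case by simp
next
  case (Dep ts)
  from Dep(4) obtain h where h: "\<And>s. s \<in> Y \<Longrightarrow> h s \<in> X \<and>
      (\<forall>v \<in> fv (Dep ts :: ('a, 'b) fm). val M s (\<sigma> v) = val M (h s) (\<tau> v))"
    by metis
  have v: "val M s (tsubst \<sigma> t) = val M (h s) (tsubst \<tau> t)" if "s \<in> Y" "t \<in> set ts" for s t
    using h[OF that(1)] that(2) by (intro val_tsubst_cong) auto
  from Dep(1) have "ts \<noteq> []" by simp
  then have "last ts \<in> set ts" "set (butlast ts) \<subseteq> set ts" by (auto dest: in_set_butlastD)
  with Dep(5) h v \<open>ts \<noteq> []\<close> show ?case
    by (simp add: map_butlast[symmetric] last_map subset_iff)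
next
  case (And A B)
  have "tsat M Y (subst \<sigma> A)" 
    by (rule And.IH(1)[of \<sigma> \<tau> Y X]) (use And.prems in simp_all, blast)
  moreover have "tsat M Y (subst \<sigma> B)" 
    by (rule And.IH(2)[of \<sigma> \<tau> Y X]) (use And.prems in simp_all, blast)
  ultimately show ?case by simp
next
  case (Or A B)
  from Or.prems obtain X1 X2 where X: "X = X1 \<union> X2" "tsat M X1 (subst \<tau> A)" "tsat M X2 (subst \<tau> B)" by auto
  \<comment> \<open>The split of \<open>X\<close> is pulled back along the matching: an assignment
    of \<open>Y\<close> goes to each side on which it has a match, possibly to both.\<close>
  define m where "m s r \<longleftrightarrow> (\<forall>v \<in> fv A \<union> fv B. val M s (\<sigma> v) = val M r (\<tau> v))" for s r
  let ?Y1 = "{s \<in> Y. \<exists>r \<in> X1. m s r}" and ?Y2 = "{s \<in> Y. \<exists>r \<in> X2. m s r}"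
  have "\<forall>s \<in> Y. \<exists>r \<in> X. m s r" using Or.prems(4) by (simp add: m_def)
  then have "Y = ?Y1 \<union> ?Y2" using X(1) by blast
  moreover have "tsat M ?Y1 (subst \<sigma> A)"
    using Or.prems X(2) by (intro Or.IH(1)[of \<sigma> \<tau> _ X1]) (auto simp: m_def)
  moreover have "tsat M ?Y2 (subst \<sigma> B)"
    using Or.prems X(3) by (intro Or.IH(2)[of \<sigma> \<tau> _ X2]) (auto simp: m_def)
  ultimately show ?case by auto
next
  case (Exists x A)
  from Exists.prems obtain F where F: "F ` X \<subseteq> universe M" "tsat M (supplement X F x) (subst (\<tau>(x := Var x)) A)"
    by auto
  \<comment> \<open>One match \<open>h s\<close> is fixed for every \<open>s\<close>, which turns
    the choice function \<open>F\<close> on \<open>X\<close> into \<open>F \<circ> h\<close> on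
    \<open>Y\<close>.\<close>
  from Exists.prems(4) obtain h where h: "\<And>s. s \<in> Y \<Longrightarrow> h s \<in> X \<and>
      (\<forall>v \<in> fv A - {x}. val M s (\<sigma> v) = val M (h s) (\<tau> v))"
    by simp metis
  have "tsat M (supplement Y (F \<circ> h) x) (subst (\<sigma>(x := Var x)) A)"
  proof (rule Exists.IH[OF _ _ _ _ F(2)])
    show "form L A" "free_for (\<sigma>(x := Var x)) A" "free_for (\<tau>(x := Var x)) A"
      using Exists.prems by simp_all
    show "\<forall>s \<in> supplement Y (F \<circ> h) x. \<exists>r \<in> supplement X F x. \<forall>v \<in> fv A.
        val M s ((\<sigma>(x := Var x)) v) = val M r ((\<tau>(x := Var x)) v)"
    proof
      fix s' assume "s' \<in> supplement Y (F \<circ> h) x"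
      then obtain s where s: "s \<in> Y" "s' = s(x \<mapsto> F (h s))" by (auto simp: supplement_def)
      with h have "(h s)(x \<mapsto> F (h s)) \<in> supplement X F x" by (auto simp: supplement_def)
      moreover have "\<forall>v \<in> fv A. val M s' ((\<sigma>(x := Var x)) v) = val M ((h s)(x \<mapsto> F (h s))) ((\<tau>(x := Var x)) v)"
        unfolding s(2) by (rule agree_upd) (use Exists.prems h s in auto)
      ultimately show "\<exists>r \<in> supplement X F x. \<forall>v \<in> fv A.
        val M s' ((\<sigma>(x := Var x)) v) = val M r ((\<tau>(x := Var x)) v)" by blast
    qed
  qed
  moreover have "(F \<circ> h) ` Y \<subseteq> universe M" using F(1) h by auto
  ultimately show ?case unfolding subst.simps tsat.simps by blast
next
  case (Forall x A)
  from Forall.prems have F: "tsat M (duplicate X (universe M) x) (subst (\<tau>(x := Var x)) A)"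
    by auto
  have "tsat M (duplicate Y (universe M) x) (subst (\<sigma>(x := Var x)) A)"
  proof (rule Forall.IH[OF _ _ _ _ F])
    show "form L A" "free_for (\<sigma>(x := Var x)) A" "free_for (\<tau>(x := Var x)) A"
      using Forall.prems by simp_all
    show "\<forall>s \<in> duplicate Y (universe M) x. \<exists>r \<in> duplicate X (universe M) x. \<forall>v \<in> fv A.
        val M s ((\<sigma>(x := Var x)) v) = val M r ((\<tau>(x := Var x)) v)"
    proof
      fix s' assume "s' \<in> duplicate Y (universe M) x"
      then obtain s a where s: "s \<in> Y" "a \<in> universe M" "s' = s(x \<mapsto> a)" by (auto simp: duplicate_def)
      from s(1) Forall.prems(4) obtain r where r: "r \<in> X" "\<forall>v \<in> fv A - {x}. val M s (\<sigma> v) = val M r (\<tau> v)"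
        by auto
      then have "r(x \<mapsto> a) \<in> duplicate X (universe M) x" using s by (auto simp: duplicate_def)
      moreover have "\<forall>v \<in> fv A. val M s' ((\<sigma>(x := Var x)) v) = val M (r(x \<mapsto> a)) ((\<tau>(x := Var x)) v)"
        unfolding s(3) by (rule agree_upd) (use Forall.prems r in auto)
      ultimately show "\<exists>r \<in> duplicate X (universe M) x. \<forall>v \<in> fv A.
        val M s' ((\<sigma>(x := Var x)) v) = val M r ((\<tau>(x := Var x)) v)" by blast
    qed
  qed
  then show ?case by simp
qed

lemma tsat_local:
  assumes "form L A" and "tsat M X A" and "\<And>s. s \<in> Y \<Longrightarrow> \<exists>r \<in> X. \<forall>v \<in> fv A. the (s v) = the (r v)"
  shows "tsat M Y A"
  using tsat_transfer[of L A Var Var Y X M] assms by simp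

lemma tsat_mono: "form L A \<Longrightarrow> tsat M X A \<Longrightarrow> Y \<subseteq> X \<Longrightarrow> tsat M Y A"
  by (erule tsat_local) auto

lemma tsat_sentence: "sentence L A \<Longrightarrow> tsat M X A \<Longrightarrow> X \<noteq> {} \<Longrightarrow> tsat M Y A"
  unfolding sentence_def by (rule tsat_local[of L A M X]) auto

lemma tsat_conjs: "tsat M X (conjs As) \<longleftrightarrow> (\<forall>A \<in> set As. tsat M X A)"
  by (induction As rule: conjs.induct) auto

lemma sat_conjs: "sat M s (conjs As) \<longleftrightarrow> (\<forall>A \<in> set As. sat M s A)"
  by (induction As rule: conjs.induct) auto

lemma sat_eqs: "length ts = length us \<Longrightarrow> sat M s (eqs ts us) \<longleftrightarrow> map (val M s) ts = map (val M s) us"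
  by (induction ts us rule: list_induct2) (auto simp: eqs_def sat_conjs)

lemma fo_conjs [simp]: "fo (conjs As) \<longleftrightarrow> (\<forall>A \<in> set As. fo A)"
  by (induction As rule: conjs.induct) auto

lemma fo_eqs [simp]: "fo (eqs ts us)"
  by (auto simp: eqs_def)

section \<open>Prefixes of quantifiers over lists of variables\<close>

lemma exs_simps [simp]: "exs [] A = A" "exs (x # xs) A = Exists x (exs xs A)"
  by (simp_all add: exs_def)

lemma alls_simps [simp]: "alls [] A = A" "alls (x # xs) A = Forall x (alls xs A)"
  by (simp_all add: alls_def)

lemma alls_append: "alls (xs @ ys) A = alls xs (alls ys A)"
  by (simp add: alls_def)

definition variants :: "('f, 'r, 'u) struct \<Rightarrow> nat list \<Rightarrow> 'u asg \<Rightarrow> 'u asg set" where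
  "variants M xs s = {t. (\<forall>v. v \<notin> set xs \<longrightarrow> t v = s v) \<and> (\<forall>v \<in> set xs. t v \<in> Some ` universe M)}"

lemma variants_Nil [simp]: "variants M [] s = {s}"
  by (auto simp: variants_def)

lemma variants_Cons: "variants M (x # xs) s = (\<Union>a \<in> universe M. variants M xs (s(x \<mapsto> a)))"
proof (intro equalityI subsetI)
  fix t assume t: "t \<in> variants M (x # xs) s"
  then obtain a where "a \<in> universe M" "t x = Some a" by (auto simp: variants_def)
  with t show "t \<in> (\<Union>a \<in> universe M. variants M xs (s(x \<mapsto> a)))"
    by (intro UN_I[of a]) (auto simp: variants_def)
qed (auto simp: variants_def split: if_splits)

lemma tsat_alls: "tsat M X (alls xs A) \<longleftrightarrow> tsat M (\<Union>s \<in> X. variants M xs s) A"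
proof (induction xs arbitrary: X)
  case (Cons x xs)
  have "(\<Union>s \<in> duplicate X (universe M) x. variants M xs s) = (\<Union>s \<in> X. variants M (x # xs) s)"
    unfolding variants_Cons by (auto simp: duplicate_def)
  then show ?case using Cons by simp
qed simp

text \<open>Monotonicity in the matrix, where the implication may use how the witnessing team
  \<open>Y\<close> arose: it consists of variants of members of \<open>X\<close> and contains at
  least one for each of them. Dependence elimination takes its second answer from \<open>Y\<close>
  again and relies on both facts.\<close>

lemma tsat_exs_mono:
  assumes "tsat M X (exs ys A)"
    and "\<And>Y. \<forall>t \<in> Y. \<exists>s \<in> X. t \<in> variants M ys s \<Longrightarrow> \<forall>s \<in> X. \<exists>t \<in> Y. t \<in> variants M ys s \<Longrightarrow>
      tsat M Y A \<Longrightarrow> tsat M Y B"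
  shows "tsat M X (exs ys B)"
  using assms
proof (induction ys arbitrary: X)
  case Nil
  from Nil(2)[of X] Nil(1) show ?case by simp
next
  case (Cons y ys)
  from Cons.prems(1) obtain F where F: "F ` X \<subseteq> universe M" "tsat M (supplement X F y) (exs ys A)"
    by auto
  have "tsat M (supplement X F y) (exs ys B)"
  proof (rule Cons.IH[OF F(2)])
    fix Y assume Y: "\<forall>t \<in> Y. \<exists>s \<in> supplement X F y. t \<in> variants M ys s"
      "\<forall>s \<in> supplement X F y. \<exists>t \<in> Y. t \<in> variants M ys s" "tsat M Y A"
    show "tsat M Y B"
    proof (rule Cons.prems(2)[OF _ _ Y(3)])
      show "\<forall>t \<in> Y. \<exists>s \<in> X. t \<in> variants M (y # ys) s"
      proof
        fix t assume "t \<in> Y"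
        then obtain s where "s \<in> X" "t \<in> variants M ys (s(y \<mapsto> F s))"
          using Y(1) by (auto simp: supplement_def)
        with F(1) show "\<exists>s \<in> X. t \<in> variants M (y # ys) s" unfolding variants_Cons by blast
      qed
      show "\<forall>s \<in> X. \<exists>t \<in> Y. t \<in> variants M (y # ys) s"
      proof
        fix s assume s: "s \<in> X"
        then obtain t where "t \<in> Y" "t \<in> variants M ys (s(y \<mapsto> F s))"
          using Y(2) by (auto simp: supplement_def)
        with F(1) s show "\<exists>t \<in> Y. t \<in> variants M (y # ys) s" unfolding variants_Cons by blast
      qed
    qed
  qed
  with F(1) show ?case by auto
qed

lemma tsat_exsD:
  assumes "tsat M X (exs ys A)"
  shows "\<exists>G. (\<forall>s \<in> X. G s \<in> variants M ys s) \<and> tsat M (G ` X) A"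
  using assms
proof (induction ys arbitrary: X)
  case Nil
  then show ?case by (intro exI[of _ id]) simp
next
  case (Cons y ys)
  then obtain F where F: "F ` X \<subseteq> universe M" "tsat M (supplement X F y) (exs ys A)"
    by auto
  from Cons.IH[OF F(2)] obtain G where
    G: "\<forall>s \<in> supplement X F y. G s \<in> variants M ys s" "tsat M (G ` supplement X F y) A" by blast
  have "G ` supplement X F y = (\<lambda>s. G (s(y \<mapsto> F s))) ` X" by (auto simp: supplement_def)
  moreover have "\<forall>s \<in> X. G (s(y \<mapsto> F s)) \<in> variants M (y # ys) s"
    using G(1) F(1) unfolding variants_Cons by (auto simp: supplement_def)
  ultimately show ?case using G(2) by (intro exI[of _ "\<lambda>s. G (s(y \<mapsto> F s))"]) simp
qed

text \<open>The values \<open>g s\<close> are chosen all at once, while the quantifiers update the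
  assignment one variable at a time. As \<open>g s\<close> ignores the values of \<open>s\<close> on
  \<open>ys\<close>, the intermediate updates do not change the choice.\<close>

lemma tsat_exsI:
  assumes "tsat M ((\<lambda>s v. if v \<in> set ys then Some (g s v) else s v) ` X) A"
    and "\<And>s r. (\<And>v. v \<notin> set ys \<Longrightarrow> s v = r v) \<Longrightarrow> g s = g r"
    and "\<And>s y. s \<in> X \<Longrightarrow> y \<in> set ys \<Longrightarrow> g s y \<in> universe M"
  shows "tsat M X (exs ys A)"
  using assms
proof (induction ys arbitrary: X)
  case Nil
  then show ?case by simp
next
  case (Cons y ys)
  define F where "F s = g s y" for s
  have g: "g (s(y \<mapsto> a)) = g s" for s a by (rule Cons.prems(2)) auto
  have "tsat M (supplement X F y) (exs ys A)"
  proof (rule Cons.IH)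
    have "(\<lambda>s v. if v \<in> set ys then Some (g s v) else s v) ` supplement X F y =
      (\<lambda>s v. if v \<in> set (y # ys) then Some (g s v) else s v) ` X"
      unfolding supplement_def Setcompr_eq_image image_image by (intro image_cong) (auto simp: g F_def)
    with Cons.prems(1) show "tsat M ((\<lambda>s v. if v \<in> set ys then Some (g s v) else s v) ` supplement X F y) A"
      by simp
    show "g s = g r" if "\<And>v. v \<notin> set ys \<Longrightarrow> s v = r v" for s r
      by (rule Cons.prems(2)) (use that in auto)
    show "g s y' \<in> universe M" if "s \<in> supplement X F y" "y' \<in> set ys" for s y'
      using that Cons.prems(3) by (auto simp: supplement_def g)
  qed
  then show ?case using Cons.prems(3) by (auto simp: F_def intro!: exI[of _ F])
qed

section \<open>Skolem functions for blocks of dependence atoms\<close>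

fun skol :: "(nat \<Rightarrow> 'u list \<Rightarrow> 'u) \<Rightarrow> (nat list \<times> nat) list \<Rightarrow> 'u asg \<Rightarrow> 'u asg" where
  "skol H [] s = s"
| "skol H ((zs, y) # ds) s = skol H ds (s(y \<mapsto> H y (map (\<lambda>z. the (s z)) zs)))"

lemma skol_append: "skol H (ds @ es) s = skol H es (skol H ds s)"
  by (induction H ds s rule: skol.induct) (simp_all del: fun_upd_apply)

lemma skol_other: "v \<notin> snd ` set ds \<Longrightarrow> skol H ds s v = s v"
  by (induction H ds s rule: skol.induct) auto

lemma skol_cong:
  assumes "\<And>v. v \<in> V \<Longrightarrow> s v = r v" and "\<And>zs y. (zs, y) \<in> set ds \<Longrightarrow> set zs \<subseteq> V \<and> H y = K y"
    and "v \<in> V \<union> snd ` set ds"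
  shows "skol H ds s v = skol K ds r v"
  using assms
proof (induction ds arbitrary: s r V)
  case (Cons d ds)
  obtain zs y where d: "d = (zs, y)" by (cases d)
  have *: "map (\<lambda>z. the (s z)) zs = map (\<lambda>z. the (r z)) zs" using Cons.prems(1,2) d by fastforce
  have "skol H ds (s(y \<mapsto> H y (map (\<lambda>z. the (s z)) zs))) v = skol K ds (r(y \<mapsto> K y (map (\<lambda>z. the (r z)) zs))) v"
  proof (rule Cons.IH[of "insert y V"])
    show "(s(y \<mapsto> H y (map (\<lambda>z. the (s z)) zs))) v = (r(y \<mapsto> K y (map (\<lambda>z. the (r z)) zs))) v"
      if "v \<in> insert y V" for v
      using that Cons.prems(1)[of v] Cons.prems(2)[of zs y] unfolding * by (auto simp: d)
    show "set ws \<subseteq> insert y V \<and> H x = K x" if "(ws, x) \<in> set ds" for ws x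
      using that Cons.prems(2)[of ws x] by auto
  qed (use Cons.prems(3) d in auto)
  then show ?case by (simp add: d)
qed simp

lemma dep_block_ok_simps [simp]:
  "dep_block_ok []"
  "dep_block_ok ((zs, y) # ds) \<longleftrightarrow>
     y \<notin> snd ` set ds \<and> set zs \<inter> insert y (snd ` set ds) = {} \<and> dep_block_ok ds"
  by (auto simp: dep_block_ok_def All_less_Suc2)

lemma dep_block_ok_append:
  assumes "dep_block_ok ds" and "dep_block_ok es" and "snd ` set ds \<inter> snd ` set es = {}"
    and "\<And>zs y. (zs, y) \<in> set ds \<Longrightarrow> set zs \<inter> snd ` set es = {}"
  shows "dep_block_ok (ds @ es)"
  using assms
proof (induction ds)
  case (Cons d ds)
  obtain zs y where d: "d = (zs, y)" by (cases d)
  have "dep_block_ok (ds @ es)"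
    using Cons.prems by (intro Cons.IH) (auto simp: d)
  then show ?case using Cons.prems(1,3) Cons.prems(4)[of zs y] by (auto simp: d image_Un)
qed simp

text \<open>By \<open>dep_block_ok\<close>, neither \<open>y\<close> nor its arguments are
  reassigned after the step for \<open>y\<close>, so the equation set up in that step survives to
  the final assignment.\<close>

lemma skol_dep:
  "dep_block_ok ds \<Longrightarrow> (zs, y) \<in> set ds \<Longrightarrow>
    skol H ds s y = Some (H y (map (\<lambda>z. the (skol H ds s z)) zs))"
proof (induction H ds s rule: skol.induct)
  case (2 H ws x ds s)
  show ?case
  proof (cases "(zs, y) = (ws, x)")
    case True
    with 2 have "skol H ds (s(x \<mapsto> H x (map (\<lambda>z. the (s z)) ws))) x = Some (H x (map (\<lambda>z. the (s z)) ws))"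
      by (subst skol_other) auto
    moreover have "map (\<lambda>z. the (s z)) ws = map (\<lambda>z. the (skol H ds (s(x \<mapsto> H x (map (\<lambda>z. the (s z)) ws))) z)) ws"
      using 2 by (auto simp: skol_other disjoint_iff)
    ultimately show ?thesis using True by (metis prod.inject skol.simps(2))
  next
    case False
    with 2 show ?thesis by (auto simp del: fun_upd_apply)
  qed
qed simp

text \<open>Converse of \<open>skol_dep\<close>: read from left to right, these equations can be
  solved for one variable after another, so they determine the assignment.\<close>

lemma skol_eqI:
  assumes "dep_block_ok ds" and "\<And>v. v \<notin> snd ` set ds \<Longrightarrow> t v = s v"
    and "\<And>zs y. (zs, y) \<in> set ds \<Longrightarrow> t y = Some (H y (map (\<lambda>z. the (t z)) zs))"
  shows "skol H ds s = t"
  using assms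
proof (induction ds arbitrary: s)
  case (Cons d ds)
  obtain zs y where d: "d = (zs, y)" by (cases d)
  have *: "map (\<lambda>z. the (s z)) zs = map (\<lambda>z. the (t z)) zs" using Cons.prems(1,2) d by (auto simp: disjoint_iff)
  have "skol H ds (s(y \<mapsto> H y (map (\<lambda>z. the (s z)) zs))) = t"
  proof (rule Cons.IH)
    show "t v = (s(y \<mapsto> H y (map (\<lambda>z. the (s z)) zs))) v" if "v \<notin> snd ` set ds" for v
      using Cons.prems(2)[of v] Cons.prems(3)[of zs y] that unfolding * by (auto simp: d)
  qed (use Cons.prems d in auto)
  then show ?case by (simp add: d)
qed auto

lemma tsat_exs_skol:
  "tsat M (skol H ds ` X) A \<Longrightarrow> (\<And>y as. H y as \<in> universe M) \<Longrightarrow> tsat M X (exs (map snd ds) A)"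
proof (induction ds arbitrary: X)
  case (Cons d ds)
  obtain zs y where d: "d = (zs, y)" by (cases d)
  let ?F = "\<lambda>s. H y (map (\<lambda>z. the (s z)) zs)"
  have "skol H ds ` supplement X ?F y = skol H (d # ds) ` X"
    by (auto simp: supplement_def d)
  then have "tsat M (supplement X ?F y) (exs (map snd ds) A)"
    using Cons by (intro Cons.IH) auto
  then show ?case using Cons.prems(2) d by (auto intro!: exI[of _ ?F])
qed simp

lemma tsat_depv: "tsat M X (depv zs y) \<longleftrightarrow>
    (\<forall>s \<in> X. \<forall>r \<in> X. (\<forall>z \<in> set zs. the (s z) = the (r z)) \<longrightarrow> the (s y) = the (r y))"
  by (simp add: depv_def butlast_append)

text \<open>In a team that satisfies the atoms, the value of each \<open>y\<close> is a function of
  the values of its arguments, and these functions give back the chosen witnesses by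
  \<open>skol_eqI\<close>. The benefit is a condition on single assignments, which is easy to check
  when teams are split or merged.\<close>

lemma tsat_dep_block:
  assumes ok: "dep_block_ok ds" and "fo C" and "universe M \<noteq> {}"
  shows "tsat M X (dep_block ds C) \<longleftrightarrow>
    (\<exists>H. (\<forall>y as. H y as \<in> universe M) \<and> (\<forall>s \<in> X. sat M (skol H ds s) C))"
proof
  assume "tsat M X (dep_block ds C)"
  then obtain G where G: "\<And>s. s \<in> X \<Longrightarrow> G s \<in> variants M (map snd ds) s"
    "\<And>zs y. (zs, y) \<in> set ds \<Longrightarrow> tsat M (G ` X) (depv zs y)" "tsat M (G ` X) C"
  proof -
    from \<open>tsat M X (dep_block ds C)\<close> obtain G where
      "\<forall>s \<in> X. G s \<in> variants M (map snd ds) s"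
      "tsat M (G ` X) (conjs (map (\<lambda>(zs, y). depv zs y) ds @ [C]))"
      unfolding dep_block_def using tsat_exsD by blast
    then show thesis by (intro that[of G]) (auto simp: tsat_conjs)
  qed
  obtain a0 where a0: "a0 \<in> universe M" using assms by auto
  \<comment> \<open>\<open>P y as t\<close> says that the member \<open>t\<close> of the witnessing
    team realises the argument tuple \<open>as\<close> of \<open>y\<close>. The function
    \<open>H y\<close> reads off \<open>y\<close> at some such member; on tuples that are not
    realised the default \<open>a0\<close> keeps it inside the universe.\<close>
  define P where "P y as t \<longleftrightarrow> t \<in> G ` X \<and> (\<exists>zs. (zs, y) \<in> set ds \<and> map (\<lambda>z. the (t z)) zs = as)" for y as t
  define H where "H y as = (if \<exists>t. P y as t then the ((SOME t. P y as t) y) else a0)" for y as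
  have U: "t y \<in> Some ` universe M" if "t \<in> G ` X" "(zs, y) \<in> set ds" for t zs y
    using G(1) that by (force simp: variants_def)
  have "H y as \<in> universe M" for y as
  proof (cases "\<exists>t. P y as t")
    case True
    then have "P y as (SOME t. P y as t)" by (rule someI_ex)
    then obtain zs where "(SOME t. P y as t) \<in> G ` X" "(zs, y) \<in> set ds" by (auto simp: P_def)
    from U[OF this] show ?thesis using True by (auto simp: H_def)
  qed (auto simp: H_def a0)
  moreover have "sat M (skol H ds s) C" if s: "s \<in> X" for s
  proof -
    have "skol H ds s = G s"
    proof (rule skol_eqI[OF ok])
      show "G s v = s v" if "v \<notin> snd ` set ds" for v
        using G(1)[OF s] that by (auto simp: variants_def)
      fix zs y assume d: "(zs, y) \<in> set ds"
      let ?as = "map (\<lambda>z. the (G s z)) zs"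
      let ?t = "SOME t. P y ?as t"
      have P: "P y ?as (G s)" using d s by (auto simp: P_def)
      then have "P y ?as ?t" by (rule someI[where P = "P y ?as"])
      then obtain ws where t: "?t \<in> G ` X" "(ws, y) \<in> set ds" "map (\<lambda>z. the (?t z)) ws = ?as"
        by (auto simp: P_def)
      \<comment> \<open>The variables of a block are distinct, so \<open>y\<close> is governed by a
        single atom and the realised tuple belongs to the same argument list.\<close>
      have "ws = zs" using t(2) d ok
        unfolding dep_block_ok_def distinct_map by (metis inj_onD prod.inject snd_conv)
      with t(3) have "\<forall>z \<in> set zs. the (?t z) = the (G s z)" by simp
      with G(2)[OF d] t(1) s have "the (?t y) = the (G s y)" unfolding tsat_depv by blast
      with P have "H y ?as = the (G s y)" by (auto simp: H_def)
      then show "G s y = Some (H y ?as)" using U[of "G s", OF _ d] s by auto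
    qed
    then show ?thesis using G(3) s by (simp add: tsat_fo[OF \<open>fo C\<close>])
  qed
  ultimately show "\<exists>H. (\<forall>y as. H y as \<in> universe M) \<and> (\<forall>s \<in> X. sat M (skol H ds s) C)" by blast
next
  assume "\<exists>H. (\<forall>y as. H y as \<in> universe M) \<and> (\<forall>s \<in> X. sat M (skol H ds s) C)"
  then obtain H where H: "\<And>y as. H y as \<in> universe M" "\<And>s. s \<in> X \<Longrightarrow> sat M (skol H ds s) C" by auto
  have "tsat M (skol H ds ` X) (depv zs y)" if "(zs, y) \<in> set ds" for zs y
  proof -
    have "the (skol H ds s y) = the (skol H ds r y)"
      if "\<forall>z \<in> set zs. the (skol H ds s z) = the (skol H ds r z)" for s r
    proof -
      have "map (\<lambda>z. the (skol H ds s z)) zs = map (\<lambda>z. the (skol H ds r z)) zs" using that by simp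
      then show ?thesis using skol_dep[OF ok \<open>(zs, y) \<in> set ds\<close>, of H] by metis
    qed
    then show ?thesis by (auto simp: tsat_depv)
  qed
  then show "tsat M X (dep_block ds C)"
    unfolding dep_block_def using H
    by (intro tsat_exs_skol[of _ H]) (auto simp: tsat_conjs tsat_fo[OF \<open>fo C\<close>])
qed

lemma tsat_alls_dep_block:
  assumes "dep_block_ok ds" and "fo C" and "universe M \<noteq> {}"
  shows "tsat M X (alls xs (dep_block ds C)) \<longleftrightarrow>
    (\<exists>H. (\<forall>y as. H y as \<in> universe M) \<and> (\<forall>s \<in> X. \<forall>t \<in> variants M xs s. sat M (skol H ds t) C))"
  unfolding tsat_alls tsat_dep_block[OF assms] by auto

lemma tsat_Dep_nth: "us \<noteq> [] \<Longrightarrow> tsat M X (Dep us) \<longleftrightarrow>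
    (\<forall>s \<in> X. \<forall>r \<in> X. (\<forall>j < length us - 1. val M s (us ! j) = val M r (us ! j)) \<longrightarrow>
      val M s (us ! (length us - 1)) = val M r (us ! (length us - 1)))"
  by (simp add: all_set_conv_all_nth nth_butlast last_conv_nth)

text \<open>Both atoms compare the same tuples of values: \<open>z\<close> holds the value of the
  replaced term, and no other term reads \<open>z\<close>.\<close>

lemma tsat_unnest:
  assumes i: "i < length ts" and z: "\<And>t. t \<in> set ts \<Longrightarrow> z \<notin> tvars t"
    and F: "\<And>s. s \<in> X \<Longrightarrow> F s = val M s (ts ! i)"
  shows "tsat M (supplement X F z) (Dep (ts[i := Var z])) \<longleftrightarrow> tsat M X (Dep ts)"
proof -
  have v: "val M (s(z \<mapsto> F s)) (ts[i := Var z] ! j) = val M s (ts ! j)" if "s \<in> X" "j < length ts" for s j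
    using that F[of s] z[of "ts ! j"] by (cases "i = j") (auto simp: val_upd)
  have ne: "ts \<noteq> []" "ts[i := Var z] \<noteq> []" using i by auto
  have S: "supplement X F z = (\<lambda>s. s(z \<mapsto> F s)) ` X" by (auto simp: supplement_def)
  show ?thesis
    unfolding tsat_Dep_nth[OF ne(1)] tsat_Dep_nth[OF ne(2)] length_list_update S ball_simps
    using i by (simp add: v del: fun_upd_apply cong: ball_cong)
qed

section \<open>Soundness\<close>

lemma tm_ok_tsubst: "tm_ok L t \<Longrightarrow> (\<And>v. tm_ok L (\<sigma> v)) \<Longrightarrow> tm_ok L (tsubst \<sigma> t)"
  by (induction t) (auto simp: list_all_iff)

lemma fo_subst [simp]: "fo (subst \<sigma> A) \<longleftrightarrow> fo A"
  by (induction A arbitrary: \<sigma>) auto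

lemma form_subst: "form L A \<Longrightarrow> (\<And>v. tm_ok L (\<sigma> v)) \<Longrightarrow> form L (subst \<sigma> A)"
  by (induction A arbitrary: \<sigma>) (auto simp: list_all_iff intro!: tm_ok_tsubst)

lemma form_conjs [simp]: "form L (conjs As) \<longleftrightarrow> (\<forall>A \<in> set As. form L A)"
  by (induction As rule: conjs.induct) auto

lemma form_exs [simp]: "form L (exs xs A) \<longleftrightarrow> form L A"
  by (induction xs) auto

lemma form_alls [simp]: "form L (alls xs A) \<longleftrightarrow> form L A"
  by (induction xs) auto

lemma form_depv [simp]: "form L (depv zs y)"
  by (auto simp: depv_def list_all_iff)

lemma form_dep_block [simp]: "form L (dep_block ds C) \<longleftrightarrow> form L C"
  by (auto simp: dep_block_def)

lemma form_eqs: "list_all (tm_ok L) ts \<Longrightarrow> list_all (tm_ok L) us \<Longrightarrow> form L (eqs ts us)"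
  by (force simp: eqs_def list_all_iff dest: set_zip_leftD set_zip_rightD)

lemma form_depE_premise [simp]: "form L (depE_premise xs ys ds B) \<longleftrightarrow> form L B"
  by (auto simp: depE_premise_def)

lemma form_depE_conclusion: "form L B \<Longrightarrow> form L (depE_conclusion xs ys xs' ys' ds B)"
  by (auto simp: depE_conclusion_def Let_def form_subst form_eqs list_all_iff)

lemma derives_form: "derives L \<Gamma> A \<Longrightarrow> form L A"
proof (induction rule: derives.induct)
  case (d_allE \<Gamma> x A t)
  then show ?case by (auto intro: form_subst)
next
  case (d_exI \<Gamma> A t x)
  have *: "tm_ok L (tsubst \<sigma> u) \<Longrightarrow> tm_ok L u" for \<sigma> u
    by (induction u) (auto simp: list_all_iff)
  have "form L (subst \<sigma> A) \<Longrightarrow> form L A" for \<sigma>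
    by (induction A arbitrary: \<sigma>) (auto simp: list_all_iff dest: *)
  with d_exI show ?case by simp
next
  case (d_unnest \<Gamma> ts i z)
  then have "tm_ok L t" if "t \<in> set (ts[i := Var z])" for t
    using set_update_subset_insert[of ts i "Var z"] that by (auto simp: list_all_iff)
  with d_unnest show ?case by (auto simp: list_all_iff)
next
  case (d_dep_distr \<Gamma> ds C es D)
  then show ?case by simp
next
  case (d_depE \<Gamma> xs ys ds B xs' ys')
  then show ?case by (simp add: form_depE_conclusion)
next
  case (d_eq_fun f ts us \<Gamma>)
  then show ?case by (simp add: form_eqs)
next
  case (d_eq_rel r ts us \<Gamma>)
  then show ?case by (simp add: form_eqs)
qed auto

lemma fv_conjs [simp]: "fv (conjs As) = (\<Union>A \<in> set As. fv A)"
  by (induction As rule: conjs.induct) auto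

lemma vars_conjs: "(\<Union>A \<in> set As. vars A) \<subseteq> vars (conjs As)"
  by (induction As rule: conjs.induct) auto

lemma fv_exs [simp]: "fv (exs xs A) = fv A - set xs"
  by (induction xs) auto

lemma fv_alls [simp]: "fv (alls xs A) = fv A - set xs"
  by (induction xs) auto

lemma vars_exs [simp]: "vars (exs xs A) = set xs \<union> vars A"
  by (induction xs) auto

lemma vars_alls [simp]: "vars (alls xs A) = set xs \<union> vars A"
  by (induction xs) auto

lemma fv_depv [simp]: "fv (depv zs y) = insert y (set zs)"
  by (auto simp: depv_def)

lemma vars_depv [simp]: "vars (depv zs y) = insert y (set zs)"
  by (auto simp: depv_def)

lemma fv_subset_vars: "fv A \<subseteq> vars A"
  by (induction A) auto

lemma fv_dep_block: "fv (dep_block ds C) = (fv C \<union> (\<Union>d \<in> set ds. set (fst d))) - snd ` set ds"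
  by (auto simp: dep_block_def case_prod_beta)

lemma vars_dep_block: "vars C \<union> (\<Union>d \<in> set ds. insert (snd d) (set (fst d))) \<subseteq> vars (dep_block ds C)"
  using vars_conjs[of "map (\<lambda>(zs, y). depv zs y) ds @ [C]"]
  by (auto simp: dep_block_def case_prod_beta)

lemma fv_subset_vars_dep_block: "fv C \<subseteq> vars (dep_block ds C)"
  using vars_dep_block[of C ds] fv_subset_vars[of C] by blast

lemma dep_subset_vars_dep_block: "(zs, y) \<in> set ds \<Longrightarrow> insert y (set zs) \<subseteq> vars (dep_block ds C)"
proof -
  assume "(zs, y) \<in> set ds"
  from UN_upper[OF this, of "\<lambda>d. insert (snd d) (set (fst d))"] show ?thesis
    unfolding fst_conv snd_conv using vars_dep_block[of C ds] by blast
qed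

lemma rename_nth: "distinct vs \<Longrightarrow> length vs = length vs' \<Longrightarrow> i < length vs \<Longrightarrow> rename vs vs' (vs ! i) = vs' ! i"
  by (auto simp: rename_def map_of_zip_nth)

lemma rename_other: "v \<notin> set vs \<Longrightarrow> rename vs vs' v = v"
  by (auto simp: rename_def split: option.splits dest: map_of_SomeD set_zip_leftD)

lemma rename_in: "distinct vs \<Longrightarrow> length vs = length vs' \<Longrightarrow> v \<in> set vs \<Longrightarrow> rename vs vs' v \<in> set vs'"
  by (metis in_set_conv_nth rename_nth)

lemma rename_inverse:
  assumes "distinct vs" "distinct vs'" "length vs = length vs'" "v \<in> set vs"
  shows "rename vs' vs (rename vs vs' v) = v"
  using assms by (metis in_set_conv_nth rename_nth)

lemma free_for_rename:
  assumes "\<And>v. v \<in> set vs \<Longrightarrow> \<rho> v \<notin> vars A" and "\<And>v. v \<notin> set vs \<Longrightarrow> \<rho> v = v"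
  shows "free_for (\<lambda>v. Var (\<rho> v)) A"
proof -
  \<comment> \<open>The property must survive \<open>\<sigma>(x := Var x)\<close> below a
    quantifier. Being fixed, or being sent to a variable that does not occur in the formula at all,
    is inherited by subformulas.\<close>
  have "(\<And>v. v \<in> fv A \<Longrightarrow> \<sigma> v = Var v \<or> (\<exists>u. \<sigma> v = Var u \<and> u \<notin> vars A)) \<Longrightarrow> free_for \<sigma> A" for \<sigma>
  proof (induction A arbitrary: \<sigma>)
    case (Exists x A)
    have "free_for (\<sigma>(x := Var x)) A"
      by (rule Exists.IH) (use Exists.prems in auto)
    moreover have "x \<notin> tvars (\<sigma> v)" if "v \<in> fv A - {x}" for v
      using Exists.prems[of v] that by auto
    ultimately show ?case by auto
  next
    case (Forall x A)
    have "free_for (\<sigma>(x := Var x)) A"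
      by (rule Forall.IH) (use Forall.prems in auto)
    moreover have "x \<notin> tvars (\<sigma> v)" if "v \<in> fv A - {x}" for v
      using Forall.prems[of v] that by auto
    ultimately show ?case by auto
  next
    case (And A B)
    have "free_for \<sigma> A" by (rule And.IH) (use And.prems in auto)
    moreover have "free_for \<sigma> B" by (rule And.IH) (use And.prems in auto)
    ultimately show ?case by simp
  next
    case (Or A B)
    have "free_for \<sigma> A" by (rule Or.IH) (use Or.prems in auto)
    moreover have "free_for \<sigma> B" by (rule Or.IH) (use Or.prems in auto)
    ultimately show ?case by simp
  qed auto
  from this[of "\<lambda>v. Var (\<rho> v)"] assms show ?thesis by metis
qed

text \<open>Under a total assignment every term denotes an element of the universe
  (\<open>val_universe\<close>); the rules that instantiate or introduce a quantifier by a term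
  depend on this.\<close>

definition total_asg :: "('f, 'r, 'u) struct \<Rightarrow> 'u asg \<Rightarrow> bool" where
  "total_asg M s \<longleftrightarrow> (\<forall>v. s v \<in> Some ` universe M)"

lemma total_upd: "total_asg M s \<Longrightarrow> a \<in> universe M \<Longrightarrow> total_asg M (s(x \<mapsto> a))"
  by (auto simp: total_asg_def)

lemma total_variants: "total_asg M s \<Longrightarrow> t \<in> variants M xs s \<Longrightarrow> total_asg M t"
  by (auto simp: total_asg_def variants_def)

lemma val_universe: "structure_of L M \<Longrightarrow> total_asg M s \<Longrightarrow> tm_ok L t \<Longrightarrow> val M s t \<in> universe M"
proof (induction t)
  case (Var x)
  then show ?case by (auto simp: total_asg_def) (metis imageE option.sel)
next
  case (Fun f ts)
  then have "set (map (val M s) ts) \<subseteq> universe M" by (auto simp: list_all_iff)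
  with Fun.prems show ?case by (simp add: structure_of_def)
qed

text \<open>Dependence atoms are not preserved by unions of teams in general. Here they are, because
  Skolem functions are defined for all arguments: those of the left block also serve the assignments
  of \<open>Z\<close>, those of the right block also serve \<open>Y\<close>, and freshness keeps the
  two evaluations apart.\<close>

lemma sound_dep_distr:
  assumes "tsat M X (Or (dep_block ds C) (dep_block es D))" and "universe M \<noteq> {}"
    and "fo C" "fo D" "dep_block_ok ds" "dep_block_ok es"
    and de: "set (map snd ds) \<inter> vars (dep_block es D) = {}"
    and ed: "set (map snd es) \<inter> vars (dep_block ds C) = {}"
  shows "tsat M X (dep_block (ds @ es) (Or C D))"
proof -
  from assms obtain Y Z where X: "X = Y \<union> Z" "tsat M Y (dep_block ds C)" "tsat M Z (dep_block es D)" by auto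
  obtain H where H: "\<And>y as. H y as \<in> universe M" "\<And>s. s \<in> Y \<Longrightarrow> sat M (skol H ds s) C"
    using X(2) tsat_dep_block[OF assms(5,3,2), of Y] by blast
  obtain K where K: "\<And>y as. K y as \<in> universe M" "\<And>s. s \<in> Z \<Longrightarrow> sat M (skol K es s) D"
    using X(3) tsat_dep_block[OF assms(6,4,2), of Z] by blast
  have VD: "fv D \<subseteq> - (snd ` set ds)" "\<And>zs y. (zs, y) \<in> set es \<Longrightarrow> insert y (set zs) \<subseteq> - (snd ` set ds)"
    using de fv_subset_vars_dep_block[of D es] dep_subset_vars_dep_block[of _ _ es D] unfolding set_map by blast+
  have VC: "fv C \<subseteq> - (snd ` set es)" "\<And>zs y. (zs, y) \<in> set ds \<Longrightarrow> insert y (set zs) \<subseteq> - (snd ` set es)"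
    using ed fv_subset_vars_dep_block[of C ds] dep_subset_vars_dep_block[of _ _ ds C] unfolding set_map by blast+
  have ok: "dep_block_ok (ds @ es)"
  proof (rule dep_block_ok_append)
    have "y \<notin> snd ` set es" if "y \<in> snd ` set ds" for y
    proof -
      from that obtain zs where "(zs, y) \<in> set ds" by force
      from VC(2)[OF this] show ?thesis by blast
    qed
    then show "snd ` set ds \<inter> snd ` set es = {}" by blast
    show "set zs \<inter> snd ` set es = {}" if "(zs, y) \<in> set ds" for zs y
      using VC(2)[OF that] by blast
  qed fact+
  \<comment> \<open>Skolem functions are indexed by the variable and not by its position, so those
    of two blocks with disjoint variables merge by a case distinction.\<close>
  let ?J = "\<lambda>y. if y \<in> snd ` set ds then H y else K y"
  have "sat M (skol ?J (ds @ es) s) (Or C D)" if "s \<in> X" for s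
  proof (cases "s \<in> Y")
    case True
    have "sat M (skol ?J (ds @ es) s) C \<longleftrightarrow> sat M (skol H ds s) C"
    proof (rule sat_cong)
      fix v assume v: "v \<in> fv C"
      then have "skol ?J (ds @ es) s v = skol ?J ds s v"
        unfolding skol_append using VC(1) by (intro skol_other) auto
      also have "skol ?J ds s v = skol H ds s v"
        by (rule skol_cong[of UNIV]) force+
      finally show "the (skol ?J (ds @ es) s v) = the (skol H ds s v)" by simp
    qed
    with H(2) True show ?thesis by simp
  next
    case False
    then have s: "s \<in> Z" using that X by auto
    have "sat M (skol ?J (ds @ es) s) D \<longleftrightarrow> sat M (skol K es s) D"
    proof (rule sat_cong)
      fix v assume v: "v \<in> fv D"
      have "skol ?J es (skol ?J ds s) v = skol K es s v"
        by (rule skol_cong[of "- (snd ` set ds)"]) (use VD v skol_other in auto)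
      then show "the (skol ?J (ds @ es) s v) = the (skol K es s v)" by (simp add: skol_append)
    qed
    with K(2) s show ?thesis by simp
  qed
  moreover have "?J y as \<in> universe M" for y as using H(1) K(1) by simp
  ultimately have "\<exists>J. (\<forall>y as. J y as \<in> universe M) \<and> (\<forall>s \<in> X. sat M (skol J (ds @ es) s) (Or C D))"
    by (intro exI[of _ ?J]) blast
  moreover have "fo (Or C D)" using assms by simp
  ultimately show ?thesis
    using tsat_dep_block[OF ok, of "Or C D" M X] assms(2) by blast
qed

text \<open>In the premise \<open>x\<close> is chosen before \<open>y\<close> and so without
  knowledge of it. By locality the choice can moreover be made uniform on assignments that agree on
  the free variables \<open>zs\<close>, and this is what the atom demands.\<close>

lemma sound_depI:
  assumes A: "form L A" and "tsat M X (Exists x (Forall y A))" and zs: "set zs = fv A - {x, y}"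
    and ne: "universe M \<noteq> {}"
  shows "tsat M X (Forall y (Exists x (And (depv zs x) A)))"
proof -
  from assms obtain F where F: "F ` X \<subseteq> universe M" "tsat M (duplicate (supplement X F x) (universe M) y) A"
    by auto
  obtain a0 where a0: "a0 \<in> universe M" using ne by auto
  \<comment> \<open>\<open>G t\<close> borrows the value of \<open>F\<close> at a representative of
    \<open>X\<close> that agrees with \<open>t\<close> on \<open>zs\<close>. The representative is
    picked from the predicate \<open>P t\<close>, which depends on \<open>t\<close> through
    \<open>zs\<close> only; hence the dependence atom.\<close>
  define P where "P t s \<longleftrightarrow> s \<in> X \<and> (\<forall>z \<in> set zs. the (s z) = the (t z))" for t s :: "'c asg"
  define G where "G t = (if \<exists>s. P t s then F (SOME s. P t s) else a0)" for t
  let ?D = "duplicate X (universe M) y"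
  have GU: "G t \<in> universe M" for t
    using F(1) a0 someI_ex[of "P t"] by (auto simp: G_def P_def)
  have Geq: "G t = G t'" if "\<forall>z \<in> set zs. the (t z) = the (t' z)" for t t'
  proof -
    have "P t = P t'" using that by (auto simp: P_def fun_eq_iff)
    then show ?thesis by (simp add: G_def)
  qed
  have xz: "x \<notin> set zs" "y \<notin> set zs" using zs by auto
  have "tsat M (supplement ?D G x) (depv zs x)"
    unfolding tsat_depv
  proof (intro ballI impI)
    fix t t' assume t: "t \<in> supplement ?D G x" "t' \<in> supplement ?D G x"
      and eq: "\<forall>z \<in> set zs. the (t z) = the (t' z)"
    then obtain u u' where u: "t = u(x \<mapsto> G u)" "t' = u'(x \<mapsto> G u')" by (auto simp: supplement_def)
    have "G u = G u'"
    proof (rule Geq)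
      show "\<forall>z \<in> set zs. the (u z) = the (u' z)"
      proof
        fix z assume z: "z \<in> set zs"
        with xz have "z \<noteq> x" by blast
        then show "the (u z) = the (u' z)" using bspec[OF eq z] unfolding u by simp
      qed
    qed
    then show "the (t x) = the (t' x)" unfolding u by simp
  qed
  moreover have "tsat M (supplement ?D G x) A"
  proof (rule tsat_local[OF A F(2)])
    fix t assume "t \<in> supplement ?D G x"
    then obtain s a where s: "s \<in> X" "a \<in> universe M" "t = s(y \<mapsto> a, x \<mapsto> G (s(y \<mapsto> a)))"
      by (auto simp: supplement_def duplicate_def)
    let ?u = "s(y \<mapsto> a)"
    have "P ?u s" using s(1) xz by (auto simp: P_def)
    define r where "r = (SOME s. P ?u s)"
    have r: "P ?u r" unfolding r_def using \<open>P ?u s\<close> by (rule someI[where P = "P ?u"])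
    have G: "G ?u = F r" using \<open>P ?u s\<close> by (auto simp: G_def r_def)
    \<comment> \<open>If \<open>x = y\<close>, the conclusion assigns the witness last and the
      premise the duplicated value last, so the duplicated value has to be the witness
      \<open>F r\<close>.\<close>
    let ?b = "if x = y then F r else a"
    have "?b \<in> universe M" using s r F(1) by (auto simp: P_def)
    then have "r(x \<mapsto> F r, y \<mapsto> ?b) \<in> duplicate (supplement X F x) (universe M) y"
      using r unfolding duplicate_def supplement_def P_def by blast
    moreover have "\<forall>v \<in> fv A. the (t v) = the ((r(x \<mapsto> F r, y \<mapsto> ?b)) v)"
    proof
      fix v assume v: "v \<in> fv A"
      show "the (t v) = the ((r(x \<mapsto> F r, y \<mapsto> ?b)) v)"
      proof (cases "v \<in> {x, y}")
        case False
        then have "v \<in> set zs" using v zs by auto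
        then have "the (r v) = the (?u v)" using r by (auto simp: P_def)
        then show ?thesis using False s(3) by auto
      qed (auto simp: s(3) G)
    qed
    ultimately show "\<exists>r \<in> duplicate (supplement X F x) (universe M) y. \<forall>v \<in> fv A. the (t v) = the (r v)"
      by blast
  qed
  ultimately show ?thesis using GU by (auto intro!: exI[of _ G])
qed

text \<open>The second round is answered from the team \<open>Y\<close> that answered the first: for
  new values of \<open>xs'\<close> take a member of \<open>Y\<close> with these values on
  \<open>xs\<close> and the same parameters, and copy its \<open>ys\<close> to \<open>ys'\<close>.
  Both answers then come from one team, so its dependence atoms yield the implications.\<close>

lemma sound_depE:
  assumes B: "form L B" and prem: "tsat M X (depE_premise xs ys ds B)" and ok: "depE_ok xs ys xs' ys' ds B"
    and tot: "\<forall>s \<in> X. total_asg M s"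
  shows "tsat M X (depE_conclusion xs ys xs' ys' ds B)"
proof -
  let ?vs = "xs @ ys" and ?vs' = "xs' @ ys'"
  define \<rho> where "\<rho> = rename ?vs ?vs'"
  define X1 where "X1 = (\<Union>s \<in> X. variants M xs s)"
  define As where "As = map (\<lambda>(ws, p). depv ws (ys ! p)) ds @ [B]"
  let ?imps = "map (\<lambda>(ws, p). Imp (eqs (map Var ws) (map (\<lambda>w. Var (\<rho> w)) ws))
                              (Eq (Var (ys ! p)) (Var (ys' ! p)))) (depE_atoms xs ys ds)"
  have dist: "distinct ?vs" "distinct ?vs'" "length ?vs = length ?vs'" "length xs = length xs'" "length ys = length ys'"
    using ok by (auto simp: depE_ok_def)
  have fresh: "set ?vs' \<inter> set ?vs = {}" "set ?vs' \<inter> vars B = {}"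
    using ok vars_conjs[of As] by (auto simp: depE_ok_def depE_premise_def As_def)
  have ds: "p < length ys" "set ws \<subseteq> set ?vs" if "(ws, p) \<in> set ds" for ws p
    using ok that set_take_subset[of p ys] by (fastforce simp: depE_ok_def)+
  have \<rho>ys: "\<rho> (ys ! p) = ys' ! p" if "p < length ys" for p
    using rename_nth[OF dist(1,3), of "length xs + p"] that dist(4) by (simp add: \<rho>_def nth_append)
  have \<rho>xs: "\<rho> (xs ! p) = xs' ! p" if "p < length xs" for p
    using rename_nth[OF dist(1,3), of p] that dist(4) by (simp add: \<rho>_def nth_append)
  have \<rho>other: "\<rho> v = v" if "v \<notin> set ?vs" for v
    using that by (auto simp: \<rho>_def rename_other)
  have \<rho>in: "\<rho> v \<in> set ?vs'" if "v \<in> set ?vs" for v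
    unfolding \<rho>_def using that dist by (intro rename_in) auto
  have \<rho>inx: "\<rho> v \<in> set xs'" if "v \<in> set xs" for v
    using that \<rho>xs dist(4) by (metis in_set_conv_nth)
  have \<rho>iny: "\<rho> v \<in> set ys'" if "v \<in> set ys" for v
    using that \<rho>ys dist(5) by (metis in_set_conv_nth)
  have inv: "rename ?vs' ?vs (\<rho> v) = v" if "v \<in> set ?vs" for v
    unfolding \<rho>_def using dist that by (intro rename_inverse) auto
  have ff: "free_for (\<lambda>v. Var (\<rho> v)) B"
    by (rule free_for_rename[of ?vs]) (use \<rho>in \<rho>other fresh in blast)+
  have "tsat M X1 (exs ys (conjs As))"
    using prem by (simp add: depE_premise_def tsat_alls X1_def As_def)
  then have "tsat M X1 (exs ys (And B (alls xs' (exs ys' (conjs (subst (\<lambda>v. Var (\<rho> v)) B # ?imps))))))"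
  proof (rule tsat_exs_mono)
    fix Y assume Y1: "\<forall>t \<in> Y. \<exists>s \<in> X1. t \<in> variants M ys s" and Y2: "\<forall>s \<in> X1. \<exists>t \<in> Y. t \<in> variants M ys s"
      and Y3: "tsat M Y (conjs As)"
    have YB: "tsat M Y B" using Y3 by (simp add: tsat_conjs As_def)
    have Yd: "tsat M Y (depv ws (ys ! p))" if "(ws, p) \<in> set ds" for ws p
      using Y3 that by (auto simp: tsat_conjs As_def)
    have Ytot: "total_asg M t" if "t \<in> Y" for t
      using that Y1 tot total_variants unfolding X1_def by (metis UN_E)
    \<comment> \<open>\<open>P u t\<close>: the member \<open>t\<close> of \<open>Y\<close> may
      answer \<open>u\<close>. The last clause repeats the first answer whenever the universal
      values are repeated; it provides coherence for the positions without a dependence atom, where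
      nothing else ties two members of \<open>Y\<close> together.\<close>
    define P where "P u t \<longleftrightarrow> t \<in> Y \<and> (\<forall>v. v \<notin> set ?vs \<union> set ?vs' \<longrightarrow> t v = u v) \<and>
      (\<forall>v \<in> set xs. t v = u (\<rho> v)) \<and> ((\<forall>v \<in> set xs. u (\<rho> v) = u v) \<longrightarrow> (\<forall>v \<in> set ys. t v = u v))" for u t :: "'c asg"
    have Pex: "\<exists>t'. P u t'" if t: "t \<in> Y" and u: "u \<in> variants M xs' t" for u t
    proof (cases "\<forall>v \<in> set xs. u (\<rho> v) = u v")
      case True
      have "u v = t v" if "v \<notin> set xs'" for v using u that by (auto simp: variants_def)
      then have "P u t" using t True fresh by (fastforce simp: P_def)
      then show ?thesis by blast
    next
      case False
      from t Y1 obtain s1 where s1: "s1 \<in> X1" "t \<in> variants M ys s1" by blast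
      then obtain s where s: "s \<in> X" "s1 \<in> variants M xs s" by (auto simp: X1_def)
      \<comment> \<open>\<open>X1\<close> arises by duplication along \<open>xs\<close>, so it is
        closed under replacing the values of \<open>xs\<close> within the universe.\<close>
      let ?s = "\<lambda>v. if v \<in> set xs then u (\<rho> v) else s v"
      have "u (\<rho> v) \<in> Some ` universe M" if "v \<in> set xs" for v
        using u \<rho>inx[OF that] by (auto simp: variants_def)
      then have "?s \<in> X1" using s by (auto simp: X1_def variants_def)
      then obtain t' where t': "t' \<in> Y" "t' \<in> variants M ys ?s" using Y2 by blast
      have "t' v = u v" if "v \<notin> set ?vs \<union> set ?vs'" for v
        using that t'(2) u s1(2) s(2) by (auto simp: variants_def)
      moreover have "t' v = u (\<rho> v)" if "v \<in> set xs" for v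
        using that t'(2) dist(1) by (auto simp: variants_def)
      ultimately have "P u t'" using t'(1) False by (auto simp: P_def)
      then show ?thesis by blast
    qed
    define h where "h u = (SOME t. P u t)" for u
    define g where "g u v = the (h u (rename ?vs' ?vs v))" for u v
    have h: "P u (h u)" if "t \<in> Y" "u \<in> variants M xs' t" for u t
      unfolding h_def using Pex[OF that] by (rule someI_ex)
    let ?Z = "\<Union>t \<in> Y. variants M xs' t"
    let ?W = "(\<lambda>s v. if v \<in> set ys' then Some (g s v) else s v) ` ?Z"
    \<comment> \<open>Every assignment of the second round is assembled from two members of
      \<open>Y\<close>: it reads \<open>t\<close> on the old variables and, through the renaming,
      \<open>u\<close> on the new ones.\<close>
    have W: "\<exists>t u. t \<in> Y \<and> u \<in> Y \<and> (\<forall>v. v \<notin> set ?vs' \<longrightarrow> w v = t v) \<and>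
        (\<forall>v \<in> set ?vs. the (w (\<rho> v)) = the (u v)) \<and> (\<forall>v. v \<notin> set ?vs \<union> set ?vs' \<longrightarrow> w v = u v) \<and>
        ((\<forall>v \<in> set xs. the (w (\<rho> v)) = the (w v)) \<longrightarrow> (\<forall>v \<in> set ys. the (w v) = the (u v)))"
      if "w \<in> ?W" for w
    proof -
      from that obtain t u where t: "t \<in> Y" "u \<in> variants M xs' t"
        and w: "w = (\<lambda>v. if v \<in> set ys' then Some (g u v) else u v)" by blast
      note P = h[OF t]
      have ut: "u v = t v" if "v \<notin> set xs'" for v using t(2) that by (auto simp: variants_def)
      have wt: "w v = t v" if "v \<notin> set ?vs'" for v using that ut w by auto
      have wx: "w (\<rho> v) = u (\<rho> v)" if "v \<in> set xs" for v using \<rho>inx[OF that] dist(2) by (auto simp: w)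
      have wv: "w v = u v" if "v \<in> set ?vs" for v using fresh that by (auto simp: w)
      have wu: "the (w (\<rho> v)) = the (h u v)" if "v \<in> set ?vs" for v
      proof (cases "v \<in> set xs")
        case True
        with P wx show ?thesis by (simp add: P_def)
      next
        case False
        with that have "v \<in> set ys" by simp
        from \<rho>iny[OF this] show ?thesis using inv[OF that] by (simp add: w g_def)
      qed
      have "total_asg M u" using t Ytot total_variants by blast
      then have tu: "\<exists>a. u v = Some a" for v by (auto simp: total_asg_def)
      have "\<forall>v \<in> set ys. the (w v) = the (h u v)" if "\<forall>v \<in> set xs. the (w (\<rho> v)) = the (w v)"
      proof -
        have "\<forall>v \<in> set xs. u (\<rho> v) = u v"
          using that wx wv tu by (metis Un_iff option.sel set_append)
        then show ?thesis using P wv by (simp add: P_def)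
      qed
      moreover have "w v = h u v" if "v \<notin> set ?vs \<union> set ?vs'" for v
        using that P by (auto simp: P_def w)
      moreover have "h u \<in> Y" using P by (simp add: P_def)
      ultimately show ?thesis using t(1) wt wu by blast
    qed
    have "tsat M ?W (conjs (subst (\<lambda>v. Var (\<rho> v)) B # ?imps))"
      unfolding tsat_conjs
    proof
      fix A assume "A \<in> set (subst (\<lambda>v. Var (\<rho> v)) B # ?imps)"
      then consider "A = subst (\<lambda>v. Var (\<rho> v)) B" | ws p where "(ws, p) \<in> set (depE_atoms xs ys ds)"
        "A = Imp (eqs (map Var ws) (map (\<lambda>w. Var (\<rho> w)) ws)) (Eq (Var (ys ! p)) (Var (ys' ! p)))"
        by auto
      then show "tsat M ?W A"
      proof cases
        case 1
        have "tsat M ?W (subst (\<lambda>v. Var (\<rho> v)) B)"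
        proof (rule tsat_transfer[OF B ff free_for_Var])
          show "tsat M Y (subst Var B)" using YB by simp
          show "\<forall>w \<in> ?W. \<exists>u \<in> Y. \<forall>v \<in> fv B. val M w (Var (\<rho> v)) = val M u (Var v)"
          proof
            fix w assume "w \<in> ?W"
            from W[OF this] obtain u where u: "u \<in> Y" "\<forall>v \<in> set ?vs. the (w (\<rho> v)) = the (u v)"
              "\<forall>v. v \<notin> set ?vs \<union> set ?vs' \<longrightarrow> w v = u v" by blast
            have "the (w (\<rho> v)) = the (u v)" if "v \<in> fv B" for v
            proof (cases "v \<in> set ?vs")
              case False
              moreover have "v \<notin> set ?vs'" using that fresh(2) fv_subset_vars[of B] by blast
              ultimately show ?thesis using u(3) \<rho>other by auto
            qed (use u in blast)
            with u(1) show "\<exists>u \<in> Y. \<forall>v \<in> fv B. val M w (Var (\<rho> v)) = val M u (Var v)" by auto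
          qed
        qed
        then show ?thesis using 1 by simp
      next
        case (2 ws p)
        have "sat M w A" if w: "w \<in> ?W" for w
        proof -
          from W[OF w] obtain t u where t: "t \<in> Y" "u \<in> Y" "\<forall>v. v \<notin> set ?vs' \<longrightarrow> w v = t v"
            "\<forall>v \<in> set ?vs. the (w (\<rho> v)) = the (u v)"
            "(\<forall>v \<in> set xs. the (w (\<rho> v)) = the (w v)) \<Longrightarrow> (\<forall>v \<in> set ys. the (w v) = the (u v))"
            by blast
          have wt: "the (w v) = the (t v)" if "v \<in> set ?vs" for v using t(3) that fresh(1) by auto
          have "the (w (ys ! p)) = the (w (ys' ! p))" if eq: "\<forall>v \<in> set ws. the (w v) = the (w (\<rho> v))"
          proof -
            from 2(1) consider "(ws, p) \<in> set ds" | "ws = xs" "p < length ys"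
              by (auto simp: depE_atoms_def)
            then show ?thesis
            proof cases
              case 1
              have y: "ys ! p \<in> set ?vs" using ds(1)[OF 1] by auto
              have "\<forall>v \<in> set ws. the (t v) = the (u v)"
                using ds(2)[OF 1] eq wt t(4) by (metis subsetD)
              then have "the (t (ys ! p)) = the (u (ys ! p))"
                using Yd[OF 1] t(1,2) unfolding tsat_depv by blast
              then show ?thesis using wt[OF y] t(4) y \<rho>ys[OF ds(1)[OF 1]] by metis
            next
              case 2
              have y: "ys ! p \<in> set ys" using 2(2) by auto
              have "the (w (ys ! p)) = the (u (ys ! p))" using t(5) eq 2(1) y by auto
              then show ?thesis using t(4) y \<rho>ys[OF 2(2)] by (metis Un_iff set_append)
            qed
          qed
          moreover have "sat M w (eqs (map Var ws) (map (\<lambda>w. Var (\<rho> w)) ws)) \<longleftrightarrow>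
              (\<forall>v \<in> set ws. the (w v) = the (w (\<rho> v)))"
            by (subst sat_eqs) (auto simp: comp_def)
          ultimately show ?thesis using 2(2) by auto
        qed
        moreover have "fo A" using 2(2) by simp
        ultimately show ?thesis by (simp add: tsat_fo)
      qed
    qed
    then have "tsat M ?Z (exs ys' (conjs (subst (\<lambda>v. Var (\<rho> v)) B # ?imps)))"
    proof (rule tsat_exsI)
      fix s r :: "'c asg" assume sr: "\<And>v. v \<notin> set ys' \<Longrightarrow> s v = r v"
      \<comment> \<open>The choice may not look at \<open>ys'\<close>, which is still to be
        assigned. All clauses of \<open>P\<close> concern \<open>xs\<close>, \<open>ys\<close>,
        \<open>xs'\<close> and the parameters only.\<close>
      have 1: "s (\<rho> v) = r (\<rho> v)" if "v \<in> set xs" for v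
        by (rule sr) (use \<rho>inx[OF that] dist(2) in auto)
      have 2: "s v = r v" if "v \<in> set ?vs" for v
      proof (rule sr)
        show "v \<notin> set ys'" using that fresh(1) by auto
      qed
      have 3: "s v = r v" if "v \<notin> set ?vs \<union> set ?vs'" for v using that sr by auto
      have "P s t \<longleftrightarrow> P r t" for t
      proof -
        have "(\<forall>v. v \<notin> set ?vs \<union> set ?vs' \<longrightarrow> t v = s v) \<longleftrightarrow> (\<forall>v. v \<notin> set ?vs \<union> set ?vs' \<longrightarrow> t v = r v)"
          using 3 by metis
        moreover have "(\<forall>v \<in> set xs. t v = s (\<rho> v)) \<longleftrightarrow> (\<forall>v \<in> set xs. t v = r (\<rho> v))"
          using 1 by simp
        moreover have "(\<forall>v \<in> set xs. s (\<rho> v) = s v) \<longleftrightarrow> (\<forall>v \<in> set xs. r (\<rho> v) = r v)"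
          using 1 2 by simp
        moreover have "(\<forall>v \<in> set ys. t v = s v) \<longleftrightarrow> (\<forall>v \<in> set ys. t v = r v)"
          using 2 by simp
        ultimately show ?thesis unfolding P_def by argo
      qed
      then have "P s = P r" by (rule ext)
      then show "g s = g r" by (simp add: g_def h_def fun_eq_iff)
    next
      fix s y assume "s \<in> ?Z" "y \<in> set ys'"
      then obtain t where "t \<in> Y" "s \<in> variants M xs' t" by blast
      then have "h s \<in> Y" using h by (auto simp: P_def)
      then have "h s (rename ?vs' ?vs y) \<in> Some ` universe M" using Ytot by (auto simp: total_asg_def)
      then show "g s y \<in> universe M" by (auto simp: g_def)
    qed
    then show "tsat M Y (And B (alls xs' (exs ys' (conjs (subst (\<lambda>v. Var (\<rho> v)) B # ?imps)))))"
      using YB by (simp add: tsat_alls)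
  qed
  then show ?thesis by (simp add: depE_conclusion_def Let_def tsat_alls X1_def \<rho>_def)
qed

lemma tsat_empty: "tsat M {} A"
  by (induction A) (auto simp: supplement_def duplicate_def)

text \<open>The team is arbitrary in the induction, since disjunctions pass to subteams, negation to
  singletons and quantifiers to extended teams. Well-formedness of the assumptions makes downward
  closure and locality available for them.\<close>

theorem derives_sound:
  assumes "derives L \<Gamma> A" and M: "structure_of L M"
  shows "\<forall>s \<in> X. total_asg M s \<Longrightarrow> \<forall>B \<in> \<Gamma>. form L B \<and> tsat M X B \<Longrightarrow> tsat M X A"
  using assms(1)
proof (induction arbitrary: X rule: derives.induct)
  case (d_weaken \<Gamma> A \<Delta>)
  then show ?case by blast
next
  case (d_disjE \<Gamma> A B C)
  \<comment> \<open>Each half of the team satisfies \<open>C\<close>. Gluing the halves requires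
    that \<open>C\<close> holds pointwise, hence the restriction of the rule to first-order
    conclusions.\<close>
  from d_disjE.IH(1)[OF d_disjE.prems] obtain Y Z where X: "X = Y \<union> Z" "tsat M Y A" "tsat M Z B" by auto
  have f: "form L A" "form L B" using derives_form[OF d_disjE.hyps(1)] by auto
  have "tsat M Y C" using d_disjE.prems X f by (intro d_disjE.IH(2)) (auto intro: tsat_mono)
  moreover have "tsat M Z C" using d_disjE.prems X f by (intro d_disjE.IH(3)) (auto intro: tsat_mono)
  ultimately show ?case using X(1) \<open>fo C\<close> by (auto simp: tsat_fo)
next
  case (d_negI A \<Gamma> B)
  have "\<not> sat M s A" if s: "s \<in> X" for s
  proof
    assume "sat M s A"
    \<comment> \<open>The contradiction has to be reached on a nonempty team, because the empty one
      satisfies \<open>And B (Neg B)\<close>.\<close>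
    then have "tsat M {s} A" using \<open>fo A\<close> by (simp add: tsat_fo)
    then have "tsat M {s} (And B (Neg B))"
      using d_negI.prems d_negI.hyps s by (intro d_negI.IH) (auto intro: tsat_mono[where X = X])
    then show False using \<open>fo B\<close> by (simp add: tsat_fo)
  qed
  then show ?case by simp
next
  case (d_negE \<Gamma> A)
  then show ?case by (simp add: tsat_fo)
next
  case (d_allI \<Gamma> A x)
  have "tsat M (duplicate X (universe M) x) A"
  proof (rule d_allI.IH)
    show "\<forall>s \<in> duplicate X (universe M) x. total_asg M s"
      using d_allI.prems by (auto simp: duplicate_def intro: total_upd)
    show "\<forall>B \<in> \<Gamma>. form L B \<and> tsat M (duplicate X (universe M) x) B"
    proof
      fix B assume B: "B \<in> \<Gamma>"
      have "tsat M (duplicate X (universe M) x) B"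
        by (rule tsat_local[of L B M X]) (use d_allI B in \<open>fastforce simp: duplicate_def\<close>)+
      then show "form L B \<and> tsat M (duplicate X (universe M) x) B" using B d_allI.prems by auto
    qed
  qed
  then show ?case by simp
next
  case (d_allE \<Gamma> x A t)
  have A: "form L A" using derives_form[OF d_allE.hyps(1)] by simp
  show ?case
  proof (rule tsat_transfer[OF A d_allE.hyps(3) free_for_Var])
    show "tsat M (duplicate X (universe M) x) (subst Var A)" using d_allE.IH d_allE.prems by simp
    show "\<forall>s \<in> X. \<exists>r \<in> duplicate X (universe M) x. \<forall>v \<in> fv A. val M s ((Var(x := t)) v) = val M r (Var v)"
    proof
      fix s assume s: "s \<in> X"
      then have "val M s t \<in> universe M" using d_allE M by (auto intro: val_universe)
      with s have "s(x \<mapsto> val M s t) \<in> duplicate X (universe M) x" by (auto simp: duplicate_def)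
      then show "\<exists>r \<in> duplicate X (universe M) x. \<forall>v \<in> fv A. val M s ((Var(x := t)) v) = val M r (Var v)"
        by (rule bexI[rotated]) simp
    qed
  qed
next
  case (d_exI \<Gamma> A t x)
  have A: "form L A" using derives_form[OF derives.d_exI[OF d_exI.hyps]] by simp
  let ?F = "\<lambda>s. val M s t"
  have "tsat M (supplement X ?F x) (subst Var A)"
  proof (rule tsat_transfer[OF A free_for_Var d_exI.hyps(3)])
    show "tsat M X (subst1 A t x)" using d_exI.IH d_exI.prems by simp
  qed (auto simp: supplement_def)
  moreover have "?F ` X \<subseteq> universe M" using d_exI M by (auto intro: val_universe)
  ultimately show ?case by (auto intro!: exI[of _ ?F])
next
  case (d_exE \<Gamma> x A \<Delta> B)
  have f: "form L A" "form L B" using derives_form[OF d_exE.hyps(1)] derives_form[OF d_exE.hyps(2)] by auto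
  from d_exE.IH(1)[of X] d_exE.prems obtain F where F: "F ` X \<subseteq> universe M" "tsat M (supplement X F x) A"
    by auto
  have "tsat M (supplement X F x) B"
  proof (rule d_exE.IH(2))
    show "\<forall>s \<in> supplement X F x. total_asg M s"
      using d_exE.prems F(1) by (auto simp: supplement_def intro!: total_upd)
    have "tsat M (supplement X F x) C" if "C \<in> \<Delta>" for C
      by (rule tsat_local[of L C M X]) (use d_exE that in \<open>fastforce simp: supplement_def\<close>)+
    then show "\<forall>C \<in> insert A \<Delta>. form L C \<and> tsat M (supplement X F x) C"
      using d_exE.prems F f by auto
  qed
  then show ?case
    by (rule tsat_local[OF f(2)]) (use d_exE.hyps in \<open>fastforce simp: supplement_def\<close>)
next
  case (d_disj_subst \<Gamma> A B C)
  from d_disj_subst.IH(1)[OF d_disj_subst.prems] obtain Y Z where X: "X = Y \<union> Z" "tsat M Y A" "tsat M Z B" by auto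
  have f: "form L B" using derives_form[OF d_disj_subst.hyps(1)] by auto
  have "tsat M Z C" using d_disj_subst.prems X f by (intro d_disj_subst.IH(2)) (auto intro: tsat_mono)
  with X show ?case by auto
next
  case (d_disj_comm \<Gamma> B A)
  from d_disj_comm.IH[OF d_disj_comm.prems] obtain Y Z where "X = Z \<union> Y" "tsat M Y B" "tsat M Z A"
    by auto
  then show ?case unfolding tsat.simps by blast
next
  case (d_disj_assoc \<Gamma> A B C)
  from d_disj_assoc.IH[OF d_disj_assoc.prems] obtain Y1 Y2 Z where
    "X = (Y1 \<union> Y2) \<union> Z" "tsat M Y1 A" "tsat M Y2 B" "tsat M Z C" by auto
  then have "X = Y1 \<union> (Y2 \<union> Z) \<and> tsat M Y1 A \<and> (\<exists>Y Z'. Y2 \<union> Z = Y \<union> Z' \<and> tsat M Y B \<and> tsat M Z' C)"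
    by blast
  then show ?case by auto
next
  case (d_all_scope \<Gamma> x A B)
  have f: "form L B" using derives_form[OF d_all_scope.hyps(1)] by simp
  from d_all_scope.IH[OF d_all_scope.prems] obtain Y Z where
    X: "X = Y \<union> Z" "tsat M (duplicate Y (universe M) x) A" "tsat M Z B" by auto
  have "tsat M (duplicate Z (universe M) x) B"
    by (rule tsat_local[OF f X(3)]) (use d_all_scope.hyps in \<open>fastforce simp: duplicate_def\<close>)
  moreover have "duplicate X (universe M) x = duplicate Y (universe M) x \<union> duplicate Z (universe M) x"
    using X(1) by (auto simp: duplicate_def)
  ultimately show ?case using X(2) by auto
next
  case (d_ex_scope \<Gamma> x A B)
  have f: "form L B" using derives_form[OF d_ex_scope.hyps(1)] by simp
  from d_ex_scope.IH[OF d_ex_scope.prems] obtain Y Z F where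
    X: "X = Y \<union> Z" "F ` Y \<subseteq> universe M" "tsat M (supplement Y F x) A" "tsat M Z B" by auto
  obtain a where a: "a \<in> universe M" using M by (auto simp: structure_of_def)
  \<comment> \<open>\<open>F\<close> is known to stay in the universe only on \<open>Y\<close>;
    elsewhere the default \<open>a\<close> is used, and \<open>B\<close> does not read
    \<open>x\<close>.\<close>
  define G where "G s = (if s \<in> Y then F s else a)" for s
  have "tsat M (supplement Z G x) B"
    by (rule tsat_local[OF f X(4)]) (use d_ex_scope.hyps in \<open>fastforce simp: supplement_def\<close>)
  moreover have "supplement X G x = supplement Y F x \<union> supplement Z G x"
    using X(1) by (auto simp: supplement_def G_def)
  moreover have "G ` X \<subseteq> universe M" using X(2) a by (auto simp: G_def)
  ultimately show ?case using X(3) by (auto intro!: exI[of _ G])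
next
  case (d_unnest \<Gamma> ts i z)
  let ?F = "\<lambda>s. val M s (ts ! i)"
  have ok: "list_all (tm_ok L) ts" using derives_form[OF d_unnest.hyps(1)] by simp
  then have F: "?F ` X \<subseteq> universe M"
    using d_unnest M by (auto simp: list_all_length intro!: val_universe)
  have z: "z \<notin> tvars t" if "t \<in> set ts" for t using d_unnest.hyps(3) that by auto
  have "tsat M X (Dep ts)" using d_unnest by blast
  then have "tsat M (supplement X ?F z) (Dep (ts[i := Var z]))"
    using tsat_unnest[of i ts z X ?F M] d_unnest.hyps(2) z by blast
  moreover have "tsat M (supplement X ?F z) (Eq (Var z) (ts ! i))"
    using z d_unnest.hyps(2) by (auto simp: supplement_def val_upd)
  ultimately show ?case using F by (auto intro!: exI[of _ ?F] simp del: tsat.simps(3))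
next
  case (d_dep_distr \<Gamma> ds C es D)
  show ?case by (rule sound_dep_distr) (use d_dep_distr M in \<open>auto simp: structure_of_def\<close>)
next
  case (d_depI \<Gamma> x y A zs)
  show ?case
    by (rule sound_depI[of L]) (use d_depI M derives_form[OF d_depI.hyps(1)] in \<open>auto simp: structure_of_def\<close>)
next
  case (d_depE \<Gamma> xs ys ds B xs' ys')
  show ?case
    by (rule sound_depE[of L]) (use d_depE derives_form[OF d_depE.hyps(1)] in auto)
next
  case (d_eq_fun f ts us \<Gamma>)
  then have "length ts = length us" by simp
  then show ?case by (subst tsat_fo) (auto simp: sat_eqs simp del: map_eq_conv)
next
  case (d_eq_rel r ts us \<Gamma>)
  then have "length ts = length us" by simp
  then show ?case by (subst tsat_fo) (auto simp: sat_eqs simp del: map_eq_conv)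
next
  case (d_eq_sym t u \<Gamma>)
  show ?case by (subst tsat_fo) auto
next
  case (d_eq_trans t u v \<Gamma>)
  show ?case by (subst tsat_fo) auto
next
  case (d_disjI1 \<Gamma> A B)
  then have "X = X \<union> {} \<and> tsat M X A \<and> tsat M {} B" by (simp add: tsat_empty)
  then show ?case unfolding tsat.simps by blast
next
  case (d_disjI2 \<Gamma> A B)
  then have "X = {} \<union> X \<and> tsat M {} B \<and> tsat M X A" by (simp add: tsat_empty)
  then show ?case unfolding tsat.simps by blast
qed auto

section \<open>Derived rules\<close>

lemma finite_tvars [simp]: "finite (tvars t)"
  by (induction t) auto

lemma finite_vars [simp]: "finite (vars A)"
  by (induction A) auto

lemma finite_fv [simp]: "finite (fv A)"
  by (rule finite_subset[OF fv_subset_vars]) simp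

lemma fresh_variable:
  assumes "finite (V :: nat set)"
  obtains z where "z \<notin> V"
  using ex_new_if_finite[OF infinite_UNIV_nat assms] by blast

text \<open>Used to find fresh variables when the assumptions mention all variables, and to pass
  from an inconsistent union of a chain to one of its members.\<close>

lemma derives_finite: "derives L \<Gamma> A \<Longrightarrow> \<exists>\<Delta> \<subseteq> \<Gamma>. finite \<Delta> \<and> derives L \<Delta> A"
proof (induction rule: derives.induct)
  case (d_assm A \<Gamma>)
  then show ?case by (intro exI[of _ "{A}"]) (auto intro: derives.d_assm)
next
  case (d_weaken \<Gamma> A \<Delta>)
  then show ?case by blast
next
  case (d_conjI \<Gamma> A B)
  then obtain D E where "D \<subseteq> \<Gamma>" "finite D" "derives L D A" "E \<subseteq> \<Gamma>" "finite E" "derives L E B" by blast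
  then have "derives L (D \<union> E) (And A B)" by (intro derives.d_conjI) (auto intro: derives.d_weaken)
  then show ?case using \<open>D \<subseteq> \<Gamma>\<close> \<open>finite D\<close> \<open>E \<subseteq> \<Gamma>\<close> \<open>finite E\<close> by (intro exI[of _ "D \<union> E"]) auto
next
  case (d_disjE \<Gamma> A B C)
  then obtain D E F where "D \<subseteq> \<Gamma>" "finite D" "derives L D (Or A B)" "E \<subseteq> insert A \<Gamma>" "finite E" "derives L E C"
    "F \<subseteq> insert B \<Gamma>" "finite F" "derives L F C" by blast
  moreover let ?G = "D \<union> (E - {A}) \<union> (F - {B})"
  have "derives L ?G C"
  proof (rule derives.d_disjE[OF _ _ _ \<open>fo C\<close>])
    show "derives L ?G (Or A B)" by (rule derives.d_weaken[OF \<open>derives L D (Or A B)\<close>]) blast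
    show "derives L (insert A ?G) C" by (rule derives.d_weaken[OF \<open>derives L E C\<close>]) blast
    show "derives L (insert B ?G) C" by (rule derives.d_weaken[OF \<open>derives L F C\<close>]) blast
  qed
  ultimately show ?case by (intro exI[of _ ?G]) auto
next
  case (d_negI A \<Gamma> B)
  then obtain D where D: "D \<subseteq> insert A \<Gamma>" "finite D" "derives L D (And B (Neg B))" by blast
  have "derives L (D - {A}) (Neg A)"
    by (rule derives.d_negI[of _ _ _ B]) (use D d_negI in \<open>auto elim!: derives.d_weaken\<close>)
  then show ?case using D by (intro exI[of _ "D - {A}"]) auto
next
  case (d_allI \<Gamma> A x)
  then obtain D where D: "D \<subseteq> \<Gamma>" "finite D" "derives L D A" by blast
  then have "derives L D (Forall x A)" using d_allI by (intro derives.d_allI) auto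
  with D show ?case by blast
next
  case (d_exE \<Gamma> x A \<Delta> B)
  then obtain D E where D: "D \<subseteq> \<Gamma>" "finite D" "derives L D (Exists x A)" "E \<subseteq> insert A \<Delta>" "finite E" "derives L E B"
    by blast
  have "derives L (D \<union> (E - {A})) B"
    by (rule derives.d_exE[of _ _ x A]) (use D d_exE in \<open>auto elim!: derives.d_weaken\<close>)
  with D show ?case by (intro exI[of _ "D \<union> (E - {A})"]) auto
next
  case (d_disj_subst \<Gamma> A B C)
  then obtain D E where D: "D \<subseteq> \<Gamma>" "finite D" "derives L D (Or A B)" "E \<subseteq> insert B \<Gamma>" "finite E" "derives L E C"
    by blast
  have "derives L (D \<union> (E - {B})) (Or A C)"
    by (rule derives.d_disj_subst[of _ _ A B]) (use D in \<open>auto elim!: derives.d_weaken\<close>)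
  with D show ?case by (intro exI[of _ "D \<union> (E - {B})"]) auto
next
  case (d_conjE1 \<Gamma> A B)
  then show ?case by (meson derives.d_conjE1)
next
  case (d_conjE2 \<Gamma> A B)
  then show ?case by (meson derives.d_conjE2)
next
  case (d_disjI1 \<Gamma> A B)
  then show ?case by (meson derives.d_disjI1)
next
  case (d_disjI2 \<Gamma> A B)
  then show ?case by (meson derives.d_disjI2)
next
  case (d_negE \<Gamma> A)
  then show ?case by (meson derives.d_negE)
next
  case (d_allE \<Gamma> x A t)
  then show ?case by (meson derives.d_allE)
next
  case (d_exI \<Gamma> A t x)
  then show ?case by (meson derives.d_exI)
next
  case (d_disj_comm \<Gamma> B A)
  then show ?case by (meson derives.d_disj_comm)
next
  case (d_disj_assoc \<Gamma> A B C)
  then show ?case by (meson derives.d_disj_assoc)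
next
  case (d_all_scope \<Gamma> x A B)
  then show ?case by (meson derives.d_all_scope)
next
  case (d_ex_scope \<Gamma> x A B)
  then show ?case by (meson derives.d_ex_scope)
next
  case (d_unnest \<Gamma> ts i z)
  then show ?case by (meson derives.d_unnest)
next
  case (d_dep_distr \<Gamma> ds C es D)
  then show ?case by (meson derives.d_dep_distr)
next
  case (d_depI \<Gamma> x y A zs)
  then show ?case by (meson derives.d_depI)
next
  case (d_depE \<Gamma> xs ys ds B xs' ys')
  then show ?case by (meson derives.d_depE)
next
  case (d_eq_refl t \<Gamma>)
  then show ?case by (meson derives.d_eq_refl empty_subsetI finite.emptyI)
next
  case (d_eq_sym t u \<Gamma>)
  then show ?case by (meson derives.d_eq_sym empty_subsetI finite.emptyI)
next
  case (d_eq_trans t u v \<Gamma>)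
  then show ?case by (meson derives.d_eq_trans empty_subsetI finite.emptyI)
next
  case (d_eq_fun f ts us \<Gamma>)
  then show ?case by (meson derives.d_eq_fun empty_subsetI finite.emptyI)
next
  case (d_eq_rel r ts us \<Gamma>)
  then show ?case by (meson derives.d_eq_rel empty_subsetI finite.emptyI)
qed

lemma allE_same: "derives L \<Gamma> (Forall x A) \<Longrightarrow> derives L \<Gamma> A"
  using d_allE[of L \<Gamma> x A "Var x"] by (simp add: fun_upd_idem)

lemma exI_same: "derives L \<Gamma> A \<Longrightarrow> derives L \<Gamma> (Exists x A)"
  using d_exI[where t = "Var x" and x = x and A = A] by (simp add: fun_upd_idem)

text \<open>There is no implication between formulas of dependence logic, but a vacuous existential
  quantifier makes cut derivable.\<close>

lemma cut:
  assumes "derives L \<Gamma> A" and "derives L (insert A \<Delta>) B"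
  shows "derives L (\<Gamma> \<union> \<Delta>) B"
proof -
  from derives_finite[OF assms(2)] obtain D where D: "D \<subseteq> insert A \<Delta>" "finite D" "derives L D B" by blast
  \<comment> \<open>\<open>\<Delta>\<close> may mention every variable, but only the finitely many
    assumptions in use constrain \<open>z\<close>.\<close>
  have "finite (fv A \<union> fv B \<union> (\<Union>C \<in> D - {A}. fv C))" using D(2) by auto
  then obtain z where z: "z \<notin> fv A \<union> fv B \<union> (\<Union>C \<in> D - {A}. fv C)" by (rule fresh_variable)
  have "derives L (insert A (D - {A})) B" using D(3) by (rule d_weaken) auto
  then have "derives L (\<Gamma> \<union> (D - {A})) B"
    using z by (intro d_exE[OF exI_same[OF assms(1), of z]]) auto
  then show ?thesis by (rule d_weaken) (use D in auto)
qed

lemma derives_trans: "derives L \<Gamma> A \<Longrightarrow> derives L {A} B \<Longrightarrow> derives L \<Gamma> B"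
  using cut[of L \<Gamma> A "{}" B] by simp

lemma cut_same: "derives L \<Gamma> A \<Longrightarrow> derives L (insert A \<Gamma>) B \<Longrightarrow> derives L \<Gamma> B"
  using cut[of L \<Gamma> A \<Gamma> B] by simp

lemma derives_conjs: "derives L \<Gamma> (conjs As) \<longleftrightarrow> (\<forall>A \<in> set As. derives L \<Gamma> A)"
proof (induction As rule: conjs.induct)
  case 1
  have "derives L {} (Eq (Var 0) (Var 0))" by (rule d_eq_refl) simp
  then have "derives L {} (Forall 0 (Eq (Var 0) (Var 0)))" by (rule d_allI) simp
  then show ?case by (auto elim: d_weaken)
next
  case (3 A B As)
  then show ?case by (auto intro: d_conjI dest: d_conjE1 d_conjE2)
qed auto

lemma alls_elim: "derives L \<Gamma> (alls xs A) \<Longrightarrow> derives L \<Gamma> A"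
  by (induction xs) (auto dest: allE_same)

lemma alls_intro: "derives L \<Gamma> A \<Longrightarrow> set xs \<inter> \<Union> (fv ` \<Gamma>) = {} \<Longrightarrow> derives L \<Gamma> (alls xs A)"
  by (induction xs) (auto intro!: d_allI)

lemma exs_intro: "derives L \<Gamma> A \<Longrightarrow> derives L \<Gamma> (exs xs A)"
  by (induction xs) (auto intro: exI_same)

lemma exs_elim:
  assumes "derives L (insert A \<Delta>) B" and "form L A"
    and "set ys \<inter> fv B = {}" and "set ys \<inter> \<Union> (fv ` \<Delta>) = {}"
  shows "derives L (insert (exs ys A) \<Delta>) B"
  using assms
proof (induction ys)
  case (Cons y ys)
  have "derives L {Exists y (exs ys A)} (Exists y (exs ys A))" using assms(2) by (intro d_assm) auto
  from d_exE[OF this, of \<Delta> B] Cons show ?case by auto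
qed simp

lemma Exists_mono: "derives L {A} B \<Longrightarrow> form L A \<Longrightarrow> derives L {Exists x A} (Exists x B)"
  using exs_elim[of L A "{}" "Exists x B" "[x]"] exI_same[of L "{A}" B x] by simp

lemma Forall_mono:
  assumes "derives L {A} B" and "form L A"
  shows "derives L {Forall x A} (Forall x B)"
proof (rule d_allI)
  have "derives L {Forall x A} A" by (rule allE_same[of L _ x], rule d_assm) (use assms(2) in auto)
  then show "derives L {Forall x A} B" using assms(1) by (rule derives_trans)
qed simp

lemma alls_mono: "derives L {A} B \<Longrightarrow> form L A \<Longrightarrow> derives L {alls xs A} (alls xs B)"
  by (induction xs) (auto intro: Forall_mono)

lemma Or_mono:
  assumes "derives L {A} A'" "derives L {B} B'" "form L A" "form L B"
  shows "derives L {Or A B} (Or A' B')"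
proof -
  have "derives L {Or A B} (Or A B)" using assms by (intro d_assm) auto
  then have "derives L {Or A B} (Or A B')" by (rule d_disj_subst) (auto intro: d_weaken[OF assms(2)])
  then have "derives L {Or A B} (Or B' A)" by (rule d_disj_comm)
  then have "derives L {Or A B} (Or B' A')" by (rule d_disj_subst) (auto intro: d_weaken[OF assms(1)])
  then show ?thesis by (rule d_disj_comm)
qed

lemma And_left: "form L A \<Longrightarrow> form L B \<Longrightarrow> derives L {And A B} A"
  by (rule d_conjE1[of _ _ _ B]) (auto intro: d_assm)

lemma And_right: "form L A \<Longrightarrow> form L B \<Longrightarrow> derives L {And A B} B"
  by (rule d_conjE2[of _ _ A]) (auto intro: d_assm)

text \<open>The negated empty conjunction is closed, first-order and a formula over every
  vocabulary. Being first-order, it is an admissible conclusion of disjunction elimination.\<close>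

definition Falsum :: "('f, 'r) fm" where
  "Falsum = Neg (conjs [])"

lemma fo_Falsum [simp]: "fo Falsum" and form_Falsum [simp]: "form L Falsum"
  and fv_Falsum [simp]: "fv Falsum = {}"
  by (auto simp: Falsum_def)

lemma derives_top: "derives L \<Gamma> (conjs [])"
  by (simp only: derives_conjs) simp

lemma negI_Falsum: "derives L (insert A \<Gamma>) Falsum \<Longrightarrow> form L A \<Longrightarrow> fo A \<Longrightarrow> derives L \<Gamma> (Neg A)"
  by (rule d_negI[of _ _ _ "conjs []"]) (auto intro: d_conjI derives_top simp: Falsum_def simp del: conjs.simps)

lemma contradiction:
  assumes "derives L \<Gamma> B" "derives L \<Gamma> (Neg B)"
  shows "derives L \<Gamma> Falsum"
proof -
  have "fo B" using derives_form[OF assms(2)] by simp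
  have "derives L (insert (conjs []) \<Gamma>) (And B (Neg B))"
    by (rule d_weaken[OF d_conjI[OF assms]]) auto
  then show ?thesis unfolding Falsum_def by (rule d_negI) (use \<open>fo B\<close> in auto)
qed

lemma raa: "derives L (insert (Neg A) \<Gamma>) Falsum \<Longrightarrow> form L A \<Longrightarrow> fo A \<Longrightarrow> derives L \<Gamma> A"
  by (rule d_negE, rule negI_Falsum) auto

lemma ex_falso: "derives L \<Gamma> Falsum \<Longrightarrow> form L A \<Longrightarrow> fo A \<Longrightarrow> derives L \<Gamma> A"
  by (rule raa, erule d_weaken) auto

text \<open>\<open>Imp\<close> is a disjunction, and disjunctions can be eliminated only towards
  first-order formulas; this is the source of \<open>fo B\<close>.\<close>

lemma imp_elim:
  assumes "derives L \<Gamma> (Imp A B)" and "derives L \<Gamma> A" and "fo B"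
  shows "derives L \<Gamma> B"
proof (rule d_disjE[OF assms(1)])
  have f: "form L (Neg A)" "form L B" using derives_form[OF assms(1)] by auto
  show "derives L (insert (Neg A) \<Gamma>) B"
    by (rule ex_falso[OF contradiction[of _ _ A]])
      (use f assms in \<open>auto intro: d_assm d_weaken[OF assms(2)]\<close>)
  show "derives L (insert B \<Gamma>) B" using f by (auto intro: d_assm)
qed fact

section \<open>De Morgan laws for first-order formulas\<close>

lemma neg_And:
  assumes "form L A" "form L B" "fo A" "fo B"
  shows "derives L {Neg (And A B)} (Or (Neg A) (Neg B))"
proof (rule raa)
  let ?G = "{Neg (Or (Neg A) (Neg B)), Neg (And A B)}"
  have N: "derives L (insert C ?G) (Neg (Or (Neg A) (Neg B)))" for C using assms by (intro d_assm) auto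
  have "derives L ?G A"
  proof (rule raa)
    have "derives L (insert (Neg A) ?G) (Or (Neg A) (Neg B))"
      using assms by (intro d_disjI1 d_assm) auto
    then show "derives L (insert (Neg A) ?G) Falsum" using N by (rule contradiction)
  qed (use assms in auto)
  moreover have "derives L ?G B"
  proof (rule raa)
    have "derives L (insert (Neg B) ?G) (Or (Neg A) (Neg B))"
      using assms by (intro d_disjI2 d_assm) auto
    then show "derives L (insert (Neg B) ?G) Falsum" using N by (rule contradiction)
  qed (use assms in auto)
  ultimately have "derives L ?G (And A B)" by (rule d_conjI)
  moreover have "derives L ?G (Neg (And A B))" using assms by (intro d_assm) auto
  ultimately show "derives L ?G Falsum" by (rule contradiction)
qed (use assms in auto)

lemma neg_Or:
  assumes "form L A" "form L B" "fo A" "fo B"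
  shows "derives L {Neg (Or A B)} (And (Neg A) (Neg B))"
proof (rule d_conjI)
  have N: "derives L (insert C {Neg (Or A B)}) (Neg (Or A B))" for C using assms by (intro d_assm) auto
  have "derives L (insert A {Neg (Or A B)}) (Or A B)" using assms by (intro d_disjI1 d_assm) auto
  from contradiction[OF this N] show "derives L {Neg (Or A B)} (Neg A)"
    using assms by (intro negI_Falsum) auto
  have "derives L (insert B {Neg (Or A B)}) (Or A B)" using assms by (intro d_disjI2 d_assm) auto
  from contradiction[OF this N] show "derives L {Neg (Or A B)} (Neg B)"
    using assms by (intro negI_Falsum) auto
qed

lemma neg_Exists:
  assumes "form L A" "fo A"
  shows "derives L {Neg (Exists x A)} (Forall x (Neg A))"
proof (rule d_allI)
  have "derives L (insert A {Neg (Exists x A)}) (Exists x A)" using assms by (intro exI_same d_assm) auto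
  moreover have "derives L (insert A {Neg (Exists x A)}) (Neg (Exists x A))" using assms by (intro d_assm) auto
  ultimately have "derives L (insert A {Neg (Exists x A)}) Falsum" by (rule contradiction)
  then show "derives L {Neg (Exists x A)} (Neg A)" using assms by (intro negI_Falsum) auto
qed simp

lemma neg_Forall:
  assumes "form L A" "fo A"
  shows "derives L {Neg (Forall x A)} (Exists x (Neg A))"
proof (rule raa)
  let ?G = "{Neg (Exists x (Neg A)), Neg (Forall x A)}"
  have "derives L ?G A"
  proof (rule raa)
    have "derives L (insert (Neg A) ?G) (Exists x (Neg A))" using assms by (intro exI_same d_assm) auto
    moreover have "derives L (insert (Neg A) ?G) (Neg (Exists x (Neg A)))" using assms by (intro d_assm) auto
    ultimately show "derives L (insert (Neg A) ?G) Falsum" by (rule contradiction)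
  qed (use assms in auto)
  then have "derives L ?G (Forall x A)" by (rule d_allI) simp
  moreover have "derives L ?G (Neg (Forall x A))" using assms by (intro d_assm) auto
  ultimately show "derives L ?G Falsum" by (rule contradiction)
qed (use assms in auto)

section \<open>Renaming of bound variables\<close>

lemma fv_tsubst: "tvars (tsubst \<sigma> t) = (\<Union>v \<in> tvars t. tvars (\<sigma> v))"
  by (induction t) auto

lemma fv_subst_subset: "fv (subst \<sigma> A) \<subseteq> (\<Union>v \<in> fv A. tvars (\<sigma> v))"
proof (induction A arbitrary: \<sigma>)
  case (Exists x A)
  have "fv (subst (\<sigma>(x := Var x)) A) \<subseteq> (\<Union>v \<in> fv A. tvars ((\<sigma>(x := Var x)) v))" by (rule Exists.IH)
  then show ?case by (fastforce split: if_splits)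
next
  case (Forall x A)
  have "fv (subst (\<sigma>(x := Var x)) A) \<subseteq> (\<Union>v \<in> fv A. tvars ((\<sigma>(x := Var x)) v))" by (rule Forall.IH)
  then show ?case by (fastforce split: if_splits)
next
  case (And A B)
  show ?case using And.IH(1)[of \<sigma>] And.IH(2)[of \<sigma>] by (simp add: UN_Un) blast
next
  case (Or A B)
  show ?case using Or.IH(1)[of \<sigma>] Or.IH(2)[of \<sigma>] by (simp add: UN_Un) blast
qed (auto simp: fv_tsubst)

lemma tsubst_idem: "(\<And>v. v \<in> tvars t \<Longrightarrow> \<sigma> v = Var v) \<Longrightarrow> tsubst \<sigma> t = t"
  by (induction t) (auto intro!: list.map_ident_strong)

lemma tsubst_tsubst: "tsubst \<tau> (tsubst \<sigma> t) = tsubst (\<lambda>v. tsubst \<tau> (\<sigma> v)) t"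
  by (induction t) auto

text \<open>Renaming \<open>x\<close> to a fresh \<open>x'\<close> and back is the identity. The
  substitution \<open>\<sigma>\<close> may rename \<open>x\<close> or leave it alone, because below
  a quantifier that binds \<open>x\<close> it is no longer renamed.\<close>

lemma rename_back:
  assumes "x' \<notin> vars A" and "\<And>v. v \<in> fv A \<Longrightarrow> \<sigma> v = Var v \<or> v = x \<and> \<sigma> v = Var x'"
    and "\<tau> x' = Var x" and "\<And>v. v \<noteq> x' \<Longrightarrow> \<tau> v = Var v"
  shows "subst \<tau> (subst \<sigma> A) = A" and "free_for \<tau> (subst \<sigma> A)"
proof -
  have T: "tsubst \<tau> (tsubst \<sigma> t) = t" if "x' \<notin> tvars t" "tvars t \<subseteq> W"
    "\<And>v. v \<in> W \<Longrightarrow> \<sigma> v = Var v \<or> v = x \<and> \<sigma> v = Var x'" for t \<sigma> W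
  proof -
    have "tsubst \<tau> (\<sigma> v) = Var v" if "v \<in> tvars t" for v
    proof -
      have "v \<in> W" "v \<noteq> x'" using that \<open>tvars t \<subseteq> W\<close> \<open>x' \<notin> tvars t\<close> by auto
      with \<open>\<And>v. v \<in> W \<Longrightarrow> \<sigma> v = Var v \<or> v = x \<and> \<sigma> v = Var x'\<close>[of v] assms(3,4) show ?thesis by auto
    qed
    then show ?thesis unfolding tsubst_tsubst by (rule tsubst_idem)
  qed
  have B: "\<tau>(y := Var y) = \<tau>" if "y \<noteq> x'" for y using assms(4) that by auto
  have F: "y \<notin> tvars (\<tau> v)" if "y \<noteq> x'" "v \<in> fv (subst (\<sigma>(y := Var y)) C)" "v \<noteq> y" "x' \<notin> vars C"
    "\<And>v. v \<in> fv C - {y} \<Longrightarrow> \<sigma> v = Var v \<or> v = x \<and> \<sigma> v = Var x'" for y v \<sigma> and C :: "('a, 'b) fm"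
  proof (cases "v = x'")
    case True
    from that(2) fv_subst_subset obtain u where u: "u \<in> fv C" "v \<in> tvars ((\<sigma>(y := Var y)) u)" by blast
    have "u \<noteq> x'" using u(1) that(4) fv_subset_vars by blast
    have "u \<noteq> y" using u(2) that(3) by (auto split: if_splits)
    then have "u = x" using u that(5)[of u] \<open>u \<noteq> x'\<close> True by auto
    then show ?thesis using assms(3) True \<open>u \<noteq> y\<close> by simp
  next
    case False
    then show ?thesis using assms(4) that(3) by simp
  qed
  from assms(1,2) have "subst \<tau> (subst \<sigma> A) = A \<and> free_for \<tau> (subst \<sigma> A)"
  proof (induction A arbitrary: \<sigma>)
    case (Eq t u)
    then show ?case using T[of t "tvars t \<union> tvars u" \<sigma>] T[of u "tvars t \<union> tvars u" \<sigma>] by auto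
  next
    case (Rel r ts)
    have "tsubst \<tau> (tsubst \<sigma> t) = t" if "t \<in> set ts" for t
      by (rule T[of t "\<Union> (tvars ` set ts)"]) (use Rel that in auto)
    then show ?case by (auto intro!: list.map_ident_strong)
  next
    case (Dep ts)
    have "tsubst \<tau> (tsubst \<sigma> t) = t" if "t \<in> set ts" for t
      by (rule T[of t "\<Union> (tvars ` set ts)"]) (use Dep that in auto)
    then show ?case by (auto intro!: list.map_ident_strong)
  next
    case (Exists y A)
    have y: "y \<noteq> x'" "x' \<notin> vars A" using Exists.prems(1) by auto
    have "subst \<tau> (subst (\<sigma>(y := Var y)) A) = A \<and> free_for \<tau> (subst (\<sigma>(y := Var y)) A)"
      by (rule Exists.IH[OF y(2)]) (use Exists.prems(2) in auto)
    moreover have "\<forall>v \<in> fv (subst (\<sigma>(y := Var y)) A) - {y}. y \<notin> tvars (\<tau> v)"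
      using F[of y _ \<sigma> A] y Exists.prems(2) by auto
    ultimately show ?case using B[OF y(1)] by simp
  next
    case (Forall y A)
    have y: "y \<noteq> x'" "x' \<notin> vars A" using Forall.prems(1) by auto
    have "subst \<tau> (subst (\<sigma>(y := Var y)) A) = A \<and> free_for \<tau> (subst (\<sigma>(y := Var y)) A)"
      by (rule Forall.IH[OF y(2)]) (use Forall.prems(2) in auto)
    moreover have "\<forall>v \<in> fv (subst (\<sigma>(y := Var y)) A) - {y}. y \<notin> tvars (\<tau> v)"
      using F[of y _ \<sigma> A] y Forall.prems(2) by auto
    ultimately show ?case using B[OF y(1)] by simp
  next
    case (And A B)
    have "subst \<tau> (subst \<sigma> A) = A \<and> free_for \<tau> (subst \<sigma> A)" by (rule And.IH(1)) (use And.prems in auto)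
    moreover have "subst \<tau> (subst \<sigma> B) = B \<and> free_for \<tau> (subst \<sigma> B)" by (rule And.IH(2)) (use And.prems in auto)
    ultimately show ?case by simp
  next
    case (Or A B)
    have "subst \<tau> (subst \<sigma> A) = A \<and> free_for \<tau> (subst \<sigma> A)" by (rule Or.IH(1)) (use Or.prems in auto)
    moreover have "subst \<tau> (subst \<sigma> B) = B \<and> free_for \<tau> (subst \<sigma> B)" by (rule Or.IH(2)) (use Or.prems in auto)
    ultimately show ?case by simp
  next
    case (Neg A)
    have "subst \<tau> (subst \<sigma> A) = A \<and> free_for \<tau> (subst \<sigma> A)" by (rule Neg.IH) (use Neg.prems in auto)
    then show ?case by simp
  qed
  then show "subst \<tau> (subst \<sigma> A) = A" and "free_for \<tau> (subst \<sigma> A)" by auto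
qed

lemma free_for_fresh:
  assumes "x' \<notin> vars A"
  shows "free_for1 (Var x') x A"
proof -
  from assms have "free_for (\<lambda>v. Var (if v = x then x' else v)) A"
    by (intro free_for_rename[of "[x]"]) auto
  moreover have "(\<lambda>v. Var (if v = x then x' else v)) = Var(x := Var x')" by auto
  ultimately show ?thesis by metis
qed

lemma subst_back:
  assumes "x' \<notin> vars A"
  shows "subst1 (subst1 A (Var x') x) (Var x) x' = A" "free_for1 (Var x) x' (subst1 A (Var x') x)"
  by (rule rename_back[OF assms, of _ x]; simp)+

lemma fv_subst_fresh: "fv (subst1 A (Var x') x) \<subseteq> insert x' (fv A - {x})"
  using fv_subst_subset[of "Var(x := Var x')" A] by (auto split: if_splits)

lemma form_subst_Var [simp]: "form L A \<Longrightarrow> form L (subst1 A (Var x') x)"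
  by (rule form_subst) auto

lemma Exists_alpha:
  assumes "x' \<notin> vars A" "form L A"
  shows "derives L {Exists x A} (Exists x' (subst1 A (Var x') x))"
    "derives L {Exists x' (subst1 A (Var x') x)} (Exists x A)"
proof -
  let ?B = "subst1 A (Var x') x"
  have "derives L {A} (subst1 ?B (Var x) x')" unfolding subst_back[OF assms(1)] using assms(2) by (auto intro: d_assm)
  then have "derives L {A} (Exists x' ?B)" by (rule d_exI) (use subst_back[OF assms(1)] in auto)
  moreover have "x \<notin> fv (Exists x' ?B)" using fv_subst_fresh[where x = x and x' = x' and A = A] by auto
  ultimately show "derives L {Exists x A} (Exists x' ?B)"
    using exs_elim[of L A "{}" _ "[x]"] assms by auto
  have "derives L {?B} (Exists x A)"
    by (rule d_exI[where t = "Var x'"]) (use assms free_for_fresh in \<open>auto intro: d_assm\<close>)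
  moreover have "x' \<notin> fv (Exists x A)" using assms(1) fv_subset_vars by auto
  ultimately show "derives L {Exists x' ?B} (Exists x A)"
    using exs_elim[of L ?B "{}" _ "[x']"] assms by auto
qed

lemma Forall_alpha:
  assumes "x' \<notin> vars A" "form L A"
  shows "derives L {Forall x A} (Forall x' (subst1 A (Var x') x))"
    "derives L {Forall x' (subst1 A (Var x') x)} (Forall x A)"
proof -
  let ?B = "subst1 A (Var x') x"
  have "derives L {Forall x A} (Forall x A)" using assms by (auto intro: d_assm)
  then have "derives L {Forall x A} ?B" by (rule d_allE) (use assms free_for_fresh in auto)
  moreover have "x' \<notin> fv (Forall x A)" using assms(1) fv_subset_vars by auto
  ultimately show "derives L {Forall x A} (Forall x' ?B)" by (intro d_allI) auto
  have "derives L {Forall x' ?B} (Forall x' ?B)" using assms by (auto intro: d_assm)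
  then have "derives L {Forall x' ?B} (subst1 ?B (Var x) x')" by (rule d_allE) (use subst_back[OF assms(1)] in auto)
  then have "derives L {Forall x' ?B} A" unfolding subst_back[OF assms(1)] .
  moreover have "x \<notin> fv (Forall x' ?B)" using fv_subst_fresh[where x = x and x' = x' and A = A] by auto
  ultimately show "derives L {Forall x' ?B} (Forall x A)" by (intro d_allI) auto
qed

section \<open>Moving quantifiers to the front\<close>

lemma Or_alls:
  assumes "form L P" "form L Q" "set xs \<inter> fv Q = {}"
  shows "derives L {Or (alls xs P) Q} (alls xs (Or P Q))"
  using assms
proof (induction xs)
  case Nil
  then show ?case by (auto intro: d_assm)
next
  case (Cons x xs)
  have "derives L {Or (Forall x (alls xs P)) Q} (Or (Forall x (alls xs P)) Q)" using Cons.prems by (intro d_assm) auto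
  then have "derives L {Or (Forall x (alls xs P)) Q} (Forall x (Or (alls xs P) Q))"
    by (rule d_all_scope) (use Cons.prems in auto)
  moreover have "derives L {Forall x (Or (alls xs P) Q)} (Forall x (alls xs (Or P Q)))"
    by (rule Forall_mono[OF Cons.IH]) (use Cons.prems in auto)
  ultimately show ?case unfolding alls_simps by (rule derives_trans)
qed

text \<open>Dependence introduction, iterated over a list of universal quantifiers. The price of
  moving the existential quantifier inwards is one atom, which records that its value does not
  depend on \<open>xs\<close>.\<close>

lemma Exists_alls_swap:
  assumes "form L P" "x \<notin> set xs" "distinct zs" "set zs = fv P - {x} - set xs"
  shows "derives L {Exists x (alls xs P)} (alls xs (Exists x (And (depv zs x) P)))"
  using assms
proof (induction xs arbitrary: P zs)
  case Nil
  \<comment> \<open>With no quantifier to pass, a vacuous \<open>Forall y\<close> is inserted so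
    that the rule still delivers the atom.\<close>
  obtain y where y: "y \<notin> insert x (fv P)" by (rule fresh_variable[of "insert x (fv P)"]) auto
  have "derives L {P} (Forall y P)" using Nil y by (intro d_allI d_assm) auto
  then have "derives L {Exists x P} (Exists x (Forall y P))" using Nil by (intro Exists_mono) auto
  then have "derives L {Exists x P} (Forall y (Exists x (And (depv zs x) P)))"
    by (rule d_depI) (use Nil y in auto)
  then show ?case by (auto dest: allE_same)
next
  case (Cons x1 xs)
  have f: "form L P" by fact
  \<comment> \<open>Every exchange adds an atom. The one from the first exchange already excludes
    all of \<open>x1 # xs\<close>, so it travels inside the matrix, and the atom over
    \<open>zs'\<close> supplied by the induction hypothesis is dropped.\<close>
  define zs' where "zs' = sorted_list_of_set (fv (And (depv zs x) P) - {x} - set xs)"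
  have "derives L {Exists x (Forall x1 (alls xs P))} (Exists x (Forall x1 (alls xs P)))"
    using f by (intro d_assm) auto
  then have "derives L {Exists x (Forall x1 (alls xs P))} (Forall x1 (Exists x (And (depv zs x) (alls xs P))))"
    by (rule d_depI) (use Cons.prems in auto)
  moreover have "derives L {Exists x (And (depv zs x) (alls xs P))} (alls xs (Exists x (And (depv zs x) P)))"
  proof -
    let ?A = "And (depv zs x) (alls xs P)" and ?P = "And (depv zs x) P"
    have "derives L {?A} (depv zs x)" "derives L {?A} (alls xs P)"
      using f by (auto intro!: And_left And_right)
    then have "derives L {?A} ?P" by (auto intro: d_conjI alls_elim)
    then have "derives L {?A} (alls xs ?P)" by (rule alls_intro) (use Cons.prems in auto)
    then have "derives L {Exists x ?A} (Exists x (alls xs ?P))" by (rule Exists_mono) (use f in simp)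
    moreover have "derives L {Exists x (alls xs ?P)} (alls xs (Exists x (And (depv zs' x) ?P)))"
      by (rule Cons.IH) (use Cons.prems in \<open>auto simp: zs'_def\<close>)
    moreover have "derives L {alls xs (Exists x (And (depv zs' x) ?P))} (alls xs (Exists x ?P))"
      by (rule alls_mono[OF Exists_mono[OF And_right]]) (use f in auto)
    ultimately show ?thesis by (meson derives_trans)
  qed
  then have "derives L {Forall x1 (Exists x (And (depv zs x) (alls xs P)))}
      (Forall x1 (alls xs (Exists x (And (depv zs x) P))))"
    by (rule Forall_mono) (use f in auto)
  ultimately show ?case unfolding alls_simps by (rule derives_trans)
qed

section \<open>Normal forms\<close>

text \<open>Arguments come from \<open>W\<close> or from variables quantified earlier in the block,
  so no dependence is circular. Together with freshness and distinctness this implies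
  \<open>dep_block_ok\<close>, and it is also the condition under which dependence elimination
  applies.\<close>

fun deps_in :: "nat set \<Rightarrow> (nat list \<times> nat) list \<Rightarrow> bool" where
  "deps_in W [] \<longleftrightarrow> True"
| "deps_in W ((zs, y) # ds) \<longleftrightarrow> set zs \<subseteq> W \<and> deps_in (insert y W) ds"

lemma deps_in_mono: "deps_in W ds \<Longrightarrow> W \<subseteq> W' \<Longrightarrow> deps_in W' ds"
proof (induction W ds arbitrary: W' rule: deps_in.induct)
  case (2 W zs y ds)
  then have "deps_in (insert y W') ds" by auto
  with 2 show ?case by auto
qed simp

lemma deps_in_append: "deps_in W (ds @ es) \<longleftrightarrow> deps_in W ds \<and> deps_in (W \<union> snd ` set ds) es"
  by (induction W ds rule: deps_in.induct) (auto simp: insert_commute)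

lemma deps_inD: "deps_in W ds \<Longrightarrow> (zs, y) \<in> set ds \<Longrightarrow> set zs \<subseteq> W \<union> snd ` set ds"
  by (induction W ds rule: deps_in.induct) fastforce+

lemma deps_in_ok: "deps_in W ds \<Longrightarrow> W \<inter> snd ` set ds = {} \<Longrightarrow> distinct (map snd ds) \<Longrightarrow> dep_block_ok ds"
  by (induction W ds rule: deps_in.induct) auto

lemma skol_cong_deps:
  "deps_in V ds \<Longrightarrow> (\<And>v. v \<in> V \<Longrightarrow> s v = r v) \<Longrightarrow> v \<in> V \<union> snd ` set ds \<Longrightarrow> skol H ds s v = skol H ds r v"
proof (induction V ds arbitrary: s r rule: deps_in.induct)
  case (2 V zs y ds)
  then have *: "map (\<lambda>z. the (s z)) zs = map (\<lambda>z. the (r z)) zs" by auto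
  have "skol H ds (s(y \<mapsto> H y (map (\<lambda>z. the (s z)) zs))) v = skol H ds (r(y \<mapsto> H y (map (\<lambda>z. the (r z)) zs))) v"
    unfolding * by (rule 2(1)) (use 2 in auto)
  then show ?case by simp
qed simp

lemma vars_conjs_eq: "As \<noteq> [] \<Longrightarrow> vars (conjs As) = (\<Union>A \<in> set As. vars A)"
  by (induction As rule: conjs.induct) auto

lemma vars_qfree: "qfree A \<Longrightarrow> vars A = fv A"
  by (induction A) auto

definition nf_shape :: "('f, 'r) voc \<Rightarrow> nat set \<Rightarrow> nat list \<Rightarrow> (nat list \<times> nat) list \<Rightarrow> ('f, 'r) fm \<Rightarrow> bool" where
  "nf_shape L W xs ds C \<longleftrightarrow> distinct (xs @ map snd ds) \<and> set (xs @ map snd ds) \<inter> W = {} \<and>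
     deps_in (W \<union> set xs) ds \<and> fo C \<and> qfree C \<and> form L C \<and> fv C \<subseteq> W \<union> set xs \<union> snd ` set ds"

lemma nf_shape_ok: "nf_shape L W xs ds C \<Longrightarrow> dep_block_ok ds"
  unfolding nf_shape_def by (rule deps_in_ok[of "W \<union> set xs"]) auto

lemma nf_shape_dep_vars:
  assumes "nf_shape L W xs ds C"
  shows "vars (dep_block ds C) \<subseteq> W \<union> set xs \<union> snd ` set ds"
proof
  fix v assume "v \<in> vars (dep_block ds C)"
  then consider "v \<in> snd ` set ds" | "v \<in> vars C" | zs y where "(zs, y) \<in> set ds" "v \<in> insert y (set zs)"
    by (auto simp: dep_block_def vars_conjs_eq)
  then show "v \<in> W \<union> set xs \<union> snd ` set ds"
  proof cases
    case 2
    then show ?thesis using assms vars_qfree[of C] by (auto simp: nf_shape_def)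
  next
    case (3 zs y)
    have "y \<in> snd ` set ds" using 3(1) by force
    moreover have "set zs \<subseteq> W \<union> set xs \<union> snd ` set ds"
      using assms deps_inD[OF _ 3(1)] unfolding nf_shape_def by blast
    ultimately show ?thesis using 3(2) by blast
  qed blast
qed

lemma nf_shape_fv: "nf_shape L W xs ds C \<Longrightarrow> fv (dep_block ds C) \<subseteq> W \<union> set xs"
  using nf_shape_dep_vars[of L W xs ds C] fv_subset_vars[of "dep_block ds C"] unfolding fv_dep_block by blast

lemma nf_shape_mono:
  "nf_shape L W xs ds C \<Longrightarrow> W \<subseteq> W' \<Longrightarrow> set (xs @ map snd ds) \<inter> W' = {} \<Longrightarrow> nf_shape L W' xs ds C"
  unfolding nf_shape_def using deps_in_mono[of "W \<union> set xs" ds "W' \<union> set xs"] by blast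

text \<open>The way to the normal form has to be a derivation, as consistency must be preserved. The
  way back is needed only in models, where a model of the normal form has to be a model of
  \<open>A\<close>. The type of universes is an argument because it cannot be quantified inside the
  formula.\<close>

definition nf_of :: "'u itself \<Rightarrow> ('f, 'r) voc \<Rightarrow> ('f, 'r) fm \<Rightarrow> nat list \<Rightarrow> (nat list \<times> nat) list \<Rightarrow> ('f, 'r) fm \<Rightarrow> bool" where
  "nf_of _ L A xs ds C \<longleftrightarrow> nf_shape L (fv A) xs ds C \<and> derives L {A} (alls xs (dep_block ds C)) \<and>
     (\<forall>(M :: ('f, 'r, 'u) struct) X. structure_of L M \<longrightarrow> (\<forall>s \<in> X. total_asg M s) \<longrightarrow>
        tsat M X (alls xs (dep_block ds C)) \<longrightarrow> tsat M X A)"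

text \<open>The quantified variables can be made to avoid any finite set; this allows the normal
  forms of two subformulas to be combined without clashes.\<close>

definition has_nf :: "'u itself \<Rightarrow> ('f, 'r) voc \<Rightarrow> ('f, 'r) fm \<Rightarrow> bool" where
  "has_nf u L A \<longleftrightarrow> (\<forall>V. finite V \<longrightarrow>
     (\<exists>xs ds C. set (xs @ map snd ds) \<inter> V = {} \<and> nf_of u L A xs ds C))"

lemma has_nfE:
  assumes "has_nf u L A" "finite V"
  obtains xs ds C where "set (xs @ map snd ds) \<inter> V = {}" "nf_of u L A xs ds C"
  using assms unfolding has_nf_def by blast

lemma has_nf_equiv:
  assumes B: "has_nf TYPE('u) L B" and d: "derives L {A} B" and "fv B \<subseteq> fv A"
    and sem: "\<And>(M :: ('f, 'r, 'u) struct) X. structure_of L M \<Longrightarrow> \<forall>s \<in> X. total_asg M s \<Longrightarrow> tsat M X B \<Longrightarrow> tsat M X A"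
  shows "has_nf TYPE('u) L (A :: ('f, 'r) fm)"
  unfolding has_nf_def
proof (intro allI impI)
  fix V :: "nat set" assume "finite V"
  then obtain xs ds C where C: "set (xs @ map snd ds) \<inter> (V \<union> fv A) = {}" "nf_of TYPE('u) L B xs ds C"
    by (auto intro: has_nfE[OF B, of "V \<union> fv A"])
  have "nf_shape L (fv A) xs ds C"
    by (rule nf_shape_mono[OF _ assms(3)]) (use C in \<open>auto simp: nf_of_def\<close>)
  moreover have "derives L {A} (alls xs (dep_block ds C))"
    using derives_trans[OF d] C(2) unfolding nf_of_def by blast
  ultimately have "nf_of TYPE('u) L A xs ds C"
    using C(2) sem unfolding nf_of_def by blast
  with C(1) show "\<exists>xs ds C. set (xs @ map snd ds) \<inter> V = {} \<and> nf_of TYPE('u) L A xs ds C" by blast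
qed

lemma dep_block_Nil [simp]: "dep_block [] C = C"
  by (simp add: dep_block_def)

lemma has_nf_qfree: "fo A \<Longrightarrow> qfree A \<Longrightarrow> form L A \<Longrightarrow> has_nf TYPE('u) L A"
  unfolding has_nf_def nf_of_def nf_shape_def
  by (intro allI impI exI[of _ "[]"] exI[of _ A]) (auto intro: d_assm)

lemma dep_block_elim:
  assumes "derives L \<Gamma> (dep_block ds C)" and "derives L (insert (conjs (map (\<lambda>(zs, y). depv zs y) ds @ [C])) \<Delta>) B"
    and "form L C" and "snd ` set ds \<inter> fv B = {}" and "snd ` set ds \<inter> \<Union> (fv ` \<Delta>) = {}"
  shows "derives L (\<Gamma> \<union> \<Delta>) B"
proof -
  have "derives L (insert (exs (map snd ds) (conjs (map (\<lambda>(zs, y). depv zs y) ds @ [C]))) \<Delta>) B"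
    by (rule exs_elim) (use assms in auto)
  with assms(1) show ?thesis unfolding dep_block_def by (rule cut)
qed

lemma dep_block_parts:
  assumes "form L C"
  shows "derives L (insert (conjs (map (\<lambda>(zs, y). depv zs y) ds @ [C])) \<Gamma>) C"
    and "(zs, y) \<in> set ds \<Longrightarrow> derives L (insert (conjs (map (\<lambda>(zs, y). depv zs y) ds @ [C])) \<Gamma>) (depv zs y)"
proof -
  have "derives L (insert (conjs (map (\<lambda>(zs, y). depv zs y) ds @ [C])) \<Gamma>) (conjs (map (\<lambda>(zs, y). depv zs y) ds @ [C]))"
    using assms by (intro d_assm) auto
  then show "derives L (insert (conjs (map (\<lambda>(zs, y). depv zs y) ds @ [C])) \<Gamma>) C"
    and "(zs, y) \<in> set ds \<Longrightarrow> derives L (insert (conjs (map (\<lambda>(zs, y). depv zs y) ds @ [C])) \<Gamma>) (depv zs y)"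
    unfolding derives_conjs by auto
qed

lemma dep_block_intro:
  assumes "derives L \<Gamma> C" and "\<And>zs y. (zs, y) \<in> set ds \<Longrightarrow> derives L \<Gamma> (depv zs y)"
  shows "derives L \<Gamma> (dep_block ds C)"
  unfolding dep_block_def by (rule exs_intro) (use assms in \<open>auto simp: derives_conjs\<close>)

text \<open>Blocks of a conjunction can be merged by derivation and also separated again, so here
  the semantic direction follows from soundness.\<close>

lemma has_nf_And:
  assumes A: "has_nf TYPE('u) L A" and B: "has_nf TYPE('u) L B" and f: "form L A" "form L B"
  shows "has_nf TYPE('u) L (And A (B :: ('f, 'r) fm))"
  unfolding has_nf_def
proof (intro allI impI)
  fix V :: "nat set" assume V: "finite V"
  obtain xs ds C where C: "set (xs @ map snd ds) \<inter> (V \<union> fv A \<union> fv B) = {}" "nf_of TYPE('u) L A xs ds C"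
    by (rule has_nfE[OF A, of "V \<union> fv A \<union> fv B"]) (use V in auto)
  obtain xs' es D where D: "set (xs' @ map snd es) \<inter> (V \<union> fv A \<union> fv B \<union> set (xs @ map snd ds)) = {}"
    "nf_of TYPE('u) L B xs' es D"
    by (rule has_nfE[OF B, of "V \<union> fv A \<union> fv B \<union> set (xs @ map snd ds)"]) (use V in auto)
  have sC: "nf_shape L (fv A) xs ds C" and sD: "nf_shape L (fv B) xs' es D"
    using C(2) D(2) by (auto simp: nf_of_def)
  note s = sC[unfolded nf_shape_def] sD[unfolded nf_shape_def]
  have fvC: "fv (dep_block ds C) \<subseteq> fv A \<union> set xs" and fvD: "fv (dep_block es D) \<subseteq> fv B \<union> set xs'"
    using nf_shape_fv[OF sC] nf_shape_fv[OF sD] by auto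
  let ?Q1 = "conjs (map (\<lambda>(zs, y). depv zs y) ds @ [C])" and ?Q2 = "conjs (map (\<lambda>(zs, y). depv zs y) es @ [D])"
  have v1: "fv ?Q1 \<subseteq> fv A \<union> set xs \<union> snd ` set ds"
    using fvC unfolding fv_dep_block by (auto simp: case_prod_beta)
  let ?N = "alls (xs @ xs') (dep_block (ds @ es) (And C D))"
  have shape: "nf_shape L (fv (And A B)) (xs @ xs') (ds @ es) (And C D)"
  proof -
    have "deps_in (fv (And A B) \<union> set (xs @ xs')) ds"
      by (rule deps_in_mono[of "fv A \<union> set xs"]) (use s in auto)
    moreover have "deps_in (fv (And A B) \<union> set (xs @ xs') \<union> snd ` set ds) es"
      by (rule deps_in_mono[of "fv B \<union> set xs'"]) (use s in auto)
    ultimately show ?thesis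
      using s C(1) D(1) unfolding nf_shape_def deps_in_append by auto
  qed
  have "derives L {And A B} ?N"
    unfolding alls_append
  proof (rule alls_intro, rule alls_intro)
    have "derives L {And A B} (alls xs (dep_block ds C))"
      using And_left[OF f] C(2) derives_trans unfolding nf_of_def by blast
    then have 1: "derives L {And A B} (dep_block ds C)" by (rule alls_elim)
    have "derives L {And A B} (alls xs' (dep_block es D))"
      using And_right[OF f] D(2) derives_trans unfolding nf_of_def by blast
    then have 2: "derives L {And A B} (dep_block es D)" by (rule alls_elim)
    have "derives L {?Q2, ?Q1} (dep_block (ds @ es) (And C D))"
    proof (rule dep_block_intro)
      show "derives L {?Q2, ?Q1} (And C D)"
        using dep_block_parts(1)[of L C ds "{?Q2}"] dep_block_parts(1)[of L D es "{?Q1}"] s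
        by (auto intro!: d_conjI simp: insert_commute)
      show "derives L {?Q2, ?Q1} (depv zs y)" if "(zs, y) \<in> set (ds @ es)" for zs y
        using dep_block_parts(2)[of L C zs y ds "{?Q2}"] dep_block_parts(2)[of L D zs y es "{?Q1}"] s that
        by (auto simp: insert_commute)
    qed
    then have "derives L ({And A B} \<union> {?Q1}) (dep_block (ds @ es) (And C D))"
    proof (rule dep_block_elim[OF 2])
      show "snd ` set es \<inter> fv (dep_block (ds @ es) (And C D)) = {}" unfolding fv_dep_block by auto
      have "snd ` set es \<inter> (fv A \<union> set xs \<union> snd ` set ds) = {}"
        using D(1) unfolding set_append set_map by blast
      then show "snd ` set es \<inter> \<Union> (fv ` {?Q1}) = {}" using v1 by blast
    qed (use s in auto)
    then have "derives L (insert ?Q1 {And A B}) (dep_block (ds @ es) (And C D))" by (simp add: insert_commute)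
    then have "derives L ({And A B} \<union> {And A B}) (dep_block (ds @ es) (And C D))"
    proof (rule dep_block_elim[OF 1])
      show "snd ` set ds \<inter> fv (dep_block (ds @ es) (And C D)) = {}" unfolding fv_dep_block by auto
      show "snd ` set ds \<inter> \<Union> (fv ` {And A B}) = {}" using C(1) by auto
    qed (use s in auto)
    then show "derives L {And A B} (dep_block (ds @ es) (And C D))" by simp
  qed (use C(1) D(1) in auto)
  moreover have "derives L {?N} (alls xs (dep_block ds C))" "derives L {?N} (alls xs' (dep_block es D))"
  proof -
    let ?Q = "conjs (map (\<lambda>(zs, y). depv zs y) (ds @ es) @ [And C D])"
    have fN: "form L ?N" using s by auto
    have N: "derives L {?N} (dep_block (ds @ es) (And C D))"
      by (rule alls_elim, rule d_assm) (use fN in auto)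
    have CD: "form L (And C D)" using s by auto
    note p = dep_block_parts[OF CD, where ds = "ds @ es" and \<Gamma> = "{}"]
    have "set xs \<inter> snd ` set ds = {}" "set xs' \<inter> snd ` set es = {}" using s by simp_all
    then have dis: "snd ` set (ds @ es) \<inter> (fv A \<union> set xs) = {}" "snd ` set (ds @ es) \<inter> (fv B \<union> set xs') = {}"
      using C(1) D(1) by (simp_all add: image_Un Int_Un_distrib Int_Un_distrib2 Int_commute)
    have "derives L {?Q} (dep_block ds C)"
      by (rule dep_block_intro) (use p in \<open>auto dest: d_conjE1\<close>)
    then have "derives L ({?N} \<union> {}) (dep_block ds C)"
      by (rule dep_block_elim[OF N]) (use CD fvC dis in \<open>simp_all, blast\<close>)
    then show "derives L {?N} (alls xs (dep_block ds C))"
      by (intro alls_intro) auto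
    have "derives L {?Q} (dep_block es D)"
      by (rule dep_block_intro) (use p in \<open>auto dest: d_conjE2\<close>)
    then have "derives L ({?N} \<union> {}) (dep_block es D)"
      by (rule dep_block_elim[OF N]) (use CD fvD dis in \<open>simp_all, blast\<close>)
    then show "derives L {?N} (alls xs' (dep_block es D))"
      by (intro alls_intro) auto
  qed
  moreover have "form L ?N" using s by auto
  ultimately have "nf_of TYPE('u) L (And A B) (xs @ xs') (ds @ es) (And C D)"
    using shape C(2) D(2) derives_sound[of L "{?N}"] unfolding nf_of_def
    by (metis singletonD tsat.simps(5))
  moreover have "set ((xs @ xs') @ map snd (ds @ es)) \<inter> V = {}" using C(1) D(1) by auto
  ultimately show "\<exists>xs ds C. set (xs @ map snd ds) \<inter> V = {} \<and> nf_of TYPE('u) L (And A B) xs ds C" by blast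
qed

text \<open>The derivation pulls both universal prefixes out and ends with dependence distribution.
  The way back is argued semantically, by reading the split of the team off the common Skolem
  functions.\<close>

lemma has_nf_Or:
  assumes A: "has_nf TYPE('u) L A" and B: "has_nf TYPE('u) L B" and f: "form L A" "form L B"
  shows "has_nf TYPE('u) L (Or A (B :: ('f, 'r) fm))"
  unfolding has_nf_def
proof (intro allI impI)
  fix V :: "nat set" assume V: "finite V"
  obtain xs ds C where C: "set (xs @ map snd ds) \<inter> (V \<union> fv A \<union> fv B) = {}" "nf_of TYPE('u) L A xs ds C"
    by (rule has_nfE[OF A, of "V \<union> fv A \<union> fv B"]) (use V in auto)
  obtain xs' es D where D: "set (xs' @ map snd es) \<inter> (V \<union> fv A \<union> fv B \<union> set (xs @ map snd ds)) = {}"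
    "nf_of TYPE('u) L B xs' es D"
    by (rule has_nfE[OF B, of "V \<union> fv A \<union> fv B \<union> set (xs @ map snd ds)"]) (use V in auto)
  have sC: "nf_shape L (fv A) xs ds C" and sD: "nf_shape L (fv B) xs' es D"
    using C(2) D(2) by (auto simp: nf_of_def)
  note s = sC[unfolded nf_shape_def] sD[unfolded nf_shape_def]
  let ?P = "dep_block ds C" and ?Q = "dep_block es D"
  let ?N = "alls (xs @ xs') (dep_block (ds @ es) (Or C D))"
  have shape: "nf_shape L (fv (Or A B)) (xs @ xs') (ds @ es) (Or C D)"
  proof -
    have "deps_in (fv (Or A B) \<union> set (xs @ xs')) ds"
      by (rule deps_in_mono[of "fv A \<union> set xs"]) (use s in auto)
    moreover have "deps_in (fv (Or A B) \<union> set (xs @ xs') \<union> snd ` set ds) es"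
      by (rule deps_in_mono[of "fv B \<union> set xs'"]) (use s in auto)
    ultimately show ?thesis
      using s C(1) D(1) unfolding nf_shape_def deps_in_append by auto
  qed
  have fP: "form L ?P" "form L ?Q" using s by auto
  have fvP: "fv ?P \<subseteq> fv A \<union> set xs" "fv ?Q \<subseteq> fv B \<union> set xs'"
    using nf_shape_fv[OF sC] nf_shape_fv[OF sD] by auto
  have "derives L {Or A B} ?N"
  proof -
    have "derives L {Or A B} (Or (alls xs ?P) (alls xs' ?Q))"
      using C(2) D(2) f by (intro Or_mono) (auto simp: nf_of_def)
    moreover have "derives L {Or (alls xs ?P) (alls xs' ?Q)} (alls xs (Or ?P (alls xs' ?Q)))"
      by (rule Or_alls) (use fP fvP C(1) D(1) in auto)
    moreover have "derives L {Or ?P (alls xs' ?Q)} (alls xs' (dep_block (ds @ es) (Or C D)))"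
    proof -
      have "derives L {Or ?P (alls xs' ?Q)} (Or (alls xs' ?Q) ?P)"
        by (rule d_disj_comm, rule d_assm) (use fP in auto)
      moreover have "derives L {Or (alls xs' ?Q) ?P} (alls xs' (Or ?Q ?P))"
        by (rule Or_alls) (use fP fvP C(1) D(1) in auto)
      moreover have "derives L {alls xs' (Or ?Q ?P)} (alls xs' (dep_block (ds @ es) (Or C D)))"
      proof (rule alls_mono)
        have "derives L {Or ?Q ?P} (Or ?P ?Q)"
          by (rule d_disj_comm, rule d_assm) (use fP in auto)
        then show "derives L {Or ?Q ?P} (dep_block (ds @ es) (Or C D))"
        proof (rule d_dep_distr)
          show "set (map snd ds) \<inter> vars ?Q = {}"
            using nf_shape_dep_vars[OF sD] C(1) D(1) by auto
          show "set (map snd es) \<inter> vars ?P = {}"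
            using nf_shape_dep_vars[OF sC] C(1) D(1) by auto
        qed (use s nf_shape_ok[OF sC] nf_shape_ok[OF sD] in auto)
      qed (use fP in auto)
      ultimately show ?thesis by (meson derives_trans)
    qed
    then have "derives L {alls xs (Or ?P (alls xs' ?Q))} ?N"
      unfolding alls_append by (rule alls_mono) (use fP in auto)
    ultimately show ?thesis by (meson derives_trans)
  qed
  moreover have "tsat M X (Or A B)"
    if M: "structure_of L M" and tot: "\<forall>s \<in> X. total_asg M s" and N: "tsat M X ?N" for M :: "('f, 'r, 'u) struct" and X
  proof -
    have ne: "universe M \<noteq> {}" using M by (simp add: structure_of_def)
    have okN: "dep_block_ok (ds @ es)" using nf_shape_ok[OF shape] .
    have "fo (Or C D)" using s by simp
    from N obtain H where H: "\<And>y as. H y as \<in> universe M"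
      "\<And>s t. s \<in> X \<Longrightarrow> t \<in> variants M (xs @ xs') s \<Longrightarrow> sat M (skol H (ds @ es) t) (Or C D)"
      unfolding tsat_alls_dep_block[OF okN \<open>fo (Or C D)\<close> ne] by blast
    \<comment> \<open>The two sides consist of the assignments for which one disjunct succeeds for
      all values of its own universal variables.\<close>
    define Y where "Y = {s \<in> X. \<forall>t \<in> variants M xs s. sat M (skol H ds t) C}"
    define Z where "Z = {s \<in> X. \<forall>t \<in> variants M xs' s. sat M (skol H es t) D}"
    have "tsat M Y (alls xs ?P)"
      using H(1) s by (subst tsat_alls_dep_block[OF nf_shape_ok[OF sC] _ ne]) (auto simp: Y_def)
    moreover have "\<forall>s \<in> Y. total_asg M s" using tot by (auto simp: Y_def)
    ultimately have "tsat M Y A" using C(2) M unfolding nf_of_def by blast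
    have "tsat M Z (alls xs' ?Q)"
      using H(1) s by (subst tsat_alls_dep_block[OF nf_shape_ok[OF sD] _ ne]) (auto simp: Z_def)
    moreover have "\<forall>s \<in> Z. total_asg M s" using tot by (auto simp: Z_def)
    ultimately have "tsat M Z B" using D(2) M unfolding nf_of_def by blast
    have "s \<in> Y \<union> Z" if sX: "s \<in> X" for s
    proof (rule ccontr)
      assume "s \<notin> Y \<union> Z"
      then obtain t1 t2 where t1: "t1 \<in> variants M xs s" "\<not> sat M (skol H ds t1) C"
        and t2: "t2 \<in> variants M xs' s" "\<not> sat M (skol H es t2) D"
        using sX unfolding Y_def Z_def by blast
      \<comment> \<open>Counterexamples to the two disjuncts concern the disjoint lists
        \<open>xs\<close> and \<open>xs'\<close>, so they combine into one assignment that refutes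
        both \<open>C\<close> and \<open>D\<close>.\<close>
      define t where "t v = (if v \<in> set xs then t1 v else t2 v)" for v
      have tt1: "t v = t1 v" if "v \<in> fv A \<union> set xs" for v
        using that t1(1) t2(1) C(1) D(1) by (auto simp: t_def variants_def)
      have tt2: "t v = t2 v" if "v \<in> fv B \<union> set xs'" for v
        using that t1(1) t2(1) C(1) D(1) by (auto simp: t_def variants_def)
      have "t \<in> variants M (xs @ xs') s"
        using t1(1) t2(1) by (auto simp: t_def variants_def)
      from H(2)[OF sX this] have "sat M (skol H es (skol H ds t)) (Or C D)" by (simp add: skol_append)
      moreover have "sat M (skol H es (skol H ds t)) C \<longleftrightarrow> sat M (skol H ds t1) C"
      proof (rule sat_cong)
        fix v assume v: "v \<in> fv C"
        then have "v \<in> fv A \<union> set xs \<union> snd ` set ds" using s by auto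
        then have "v \<notin> snd ` set es" using D(1) C(1) by auto
        moreover have "skol H ds t v = skol H ds t1 v"
          by (rule skol_cong_deps[of "fv A \<union> set xs"]) (use s tt1 \<open>v \<in> fv A \<union> set xs \<union> snd ` set ds\<close> in auto)
        ultimately show "the (skol H es (skol H ds t) v) = the (skol H ds t1 v)" by (simp add: skol_other)
      qed
      moreover have "sat M (skol H es (skol H ds t)) D \<longleftrightarrow> sat M (skol H es t2) D"
      proof (rule sat_cong)
        fix v assume v: "v \<in> fv D"
        have "skol H es (skol H ds t) v = skol H es t2 v"
        proof (rule skol_cong_deps[of "fv B \<union> set xs'"])
          show "skol H ds t v = t2 v" if "v \<in> fv B \<union> set xs'" for v
          proof -
            have "v \<notin> snd ` set ds" using that D(1) C(1) by auto
            then show ?thesis using tt2[OF that] by (simp add: skol_other)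
          qed
        qed (use s v in auto)
        then show "the (skol H es (skol H ds t) v) = the (skol H es t2 v)" by simp
      qed
      ultimately show False using t1(2) t2(2) by simp
    qed
    then have "X = Y \<union> Z" by (auto simp: Y_def Z_def)
    with \<open>tsat M Y A\<close> \<open>tsat M Z B\<close> show ?thesis by auto
  qed
  ultimately have "nf_of TYPE('u) L (Or A B) (xs @ xs') (ds @ es) (Or C D)"
    using shape unfolding nf_of_def by blast
  moreover have "set ((xs @ xs') @ map snd (ds @ es)) \<inter> V = {}" using C(1) D(1) by auto
  ultimately show "\<exists>xs ds C. set (xs @ map snd ds) \<inter> V = {} \<and> nf_of TYPE('u) L (Or A B) xs ds C" by blast
qed

text \<open>The set to be avoided may contain \<open>x\<close>, so the bound variable is renamed
  first and a normal form of the renamed body is used.\<close>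

lemma has_nf_Forall:
  assumes A: "\<And>x'. x' \<notin> vars A \<Longrightarrow> has_nf TYPE('u) L (subst1 A (Var x') x)" and f: "form L A"
  shows "has_nf TYPE('u) L (Forall x (A :: ('f, 'r) fm))"
  unfolding has_nf_def
proof (intro allI impI)
  fix V :: "nat set" assume V: "finite V"
  obtain x' where x': "x' \<notin> V \<union> vars A" by (rule fresh_variable[of "V \<union> vars A"]) (use V in auto)
  let ?A = "subst1 A (Var x') x" and ?F = "Forall x A"
  have nf: "has_nf TYPE('u) L ?A" using A x' by auto
  obtain xs ds C where C: "set (xs @ map snd ds) \<inter> (V \<union> insert x' (fv A)) = {}" "nf_of TYPE('u) L ?A xs ds C"
    by (rule has_nfE[OF nf, of "V \<union> insert x' (fv A)"]) (use V in auto)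
  have fv: "fv ?A \<subseteq> insert x' (fv ?F)" using fv_subst_fresh[where A = A and x = x and x' = x'] by auto
  have x'F: "x' \<notin> fv ?F" using x' fv_subset_vars by auto
  have s: "nf_shape L (fv ?A) xs ds C" and d: "derives L {?A} (alls xs (dep_block ds C))"
    using C(2) by (auto simp: nf_of_def)
  have "nf_shape L (insert x' (fv ?F)) xs ds C"
    by (rule nf_shape_mono[OF s fv]) (use C(1) in auto)
  then have "nf_shape L (fv ?F) (x' # xs) ds C"
    using x'F C(1) unfolding nf_shape_def by auto
  moreover have "derives L {?F} (alls (x' # xs) (dep_block ds C))"
    using derives_trans[OF Forall_alpha(1)[of x' A L x] Forall_mono[OF d]] x' f by auto
  moreover have "tsat M X ?F"
    if M: "structure_of L M" and tot: "\<forall>s \<in> X. total_asg M s" and N: "tsat M X (alls (x' # xs) (dep_block ds C))"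
    for M :: "('f, 'r, 'u) struct" and X
  proof -
    have "tsat M (duplicate X (universe M) x') (alls xs (dep_block ds C))" using N by simp
    moreover have "\<forall>s \<in> duplicate X (universe M) x'. total_asg M s"
      using tot by (auto simp: duplicate_def intro: total_upd)
    ultimately have "tsat M (duplicate X (universe M) x') ?A" using C(2) M unfolding nf_of_def by blast
    then have "tsat M X (Forall x' ?A)" by simp
    moreover have "derives L {Forall x' ?A} ?F" using Forall_alpha(2)[of x' A L x] x' f by auto
    ultimately show ?thesis using derives_sound[OF _ M tot] f by (metis form.simps(8) form_subst_Var singletonD)
  qed
  ultimately have "nf_of TYPE('u) L ?F (x' # xs) ds C" unfolding nf_of_def by blast
  moreover have "set ((x' # xs) @ map snd ds) \<inter> V = {}" using C(1) x' by auto
  ultimately show "\<exists>xs ds C. set (xs @ map snd ds) \<inter> V = {} \<and> nf_of TYPE('u) L ?F xs ds C" by blast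
qed

text \<open>The existential quantifier passes the universal prefix of the body and becomes the first
  entry of the block. The arguments of its atom are free variables of the whole formula.\<close>

lemma has_nf_Exists:
  assumes A: "\<And>x'. x' \<notin> vars A \<Longrightarrow> has_nf TYPE('u) L (subst1 A (Var x') x)" and f: "form L A"
  shows "has_nf TYPE('u) L (Exists x (A :: ('f, 'r) fm))"
  unfolding has_nf_def
proof (intro allI impI)
  fix V :: "nat set" assume V: "finite V"
  obtain x' where x': "x' \<notin> V \<union> vars A" by (rule fresh_variable[of "V \<union> vars A"]) (use V in auto)
  let ?A = "subst1 A (Var x') x" and ?F = "Exists x A"
  have nf: "has_nf TYPE('u) L ?A" using A x' by auto
  obtain xs ds C where C: "set (xs @ map snd ds) \<inter> (V \<union> insert x' (fv A)) = {}" "nf_of TYPE('u) L ?A xs ds C"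
    by (rule has_nfE[OF nf, of "V \<union> insert x' (fv A)"]) (use V in auto)
  have fv: "fv ?A \<subseteq> insert x' (fv ?F)" using fv_subst_fresh[where A = A and x = x and x' = x'] by auto
  have x'F: "x' \<notin> fv ?F" using x' fv_subset_vars by auto
  have s: "nf_shape L (fv ?A) xs ds C" and d: "derives L {?A} (alls xs (dep_block ds C))"
    using C(2) by (auto simp: nf_of_def)
  let ?P = "dep_block ds C"
  define zs where "zs = sorted_list_of_set (fv ?P - {x'} - set xs)"
  have zs: "distinct zs" "set zs = fv ?P - {x'} - set xs" by (auto simp: zs_def)
  have fC: "form L C" using s by (auto simp: nf_shape_def)
  have zsF: "set zs \<subseteq> fv ?F" using zs nf_shape_fv[OF s] fv by blast
  have s': "nf_shape L (insert x' (fv ?F)) xs ds C"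
    by (rule nf_shape_mono[OF s fv]) (use C(1) in auto)
  have shape: "nf_shape L (fv ?F) xs ((zs, x') # ds) C"
  proof -
    have "deps_in (fv ?F \<union> set xs) ((zs, x') # ds)" using s' zsF unfolding nf_shape_def by auto
    then show ?thesis using s' x'F C(1) unfolding nf_shape_def by auto
  qed
  have "derives L {?F} (alls xs (dep_block ((zs, x') # ds) C))"
  proof -
    have "derives L {?F} (Exists x' ?A)" using Exists_alpha(1)[of x' A L x] x' f by auto
    moreover have "derives L {Exists x' ?A} (Exists x' (alls xs ?P))"
      by (rule Exists_mono[OF d]) (use f in auto)
    moreover have "derives L {Exists x' (alls xs ?P)} (alls xs (Exists x' (And (depv zs x') ?P)))"
      by (rule Exists_alls_swap) (use zs C(1) fC in auto)
    moreover have "derives L {alls xs (Exists x' (And (depv zs x') ?P))} (alls xs (dep_block ((zs, x') # ds) C))"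
    proof (rule alls_mono)
      let ?B = "And (depv zs x') ?P"
      let ?Q = "conjs (map (\<lambda>(zs, y). depv zs y) ds @ [C])"
      have B: "derives L {?B} (depv zs x')" "derives L {?B} ?P" using fC by (auto intro!: And_left And_right)
      have "derives L {?Q, depv zs x'} (dep_block ((zs, x') # ds) C)"
        by (rule dep_block_intro) (use dep_block_parts[OF fC, where ds = ds and \<Gamma> = "{depv zs x'}"] in \<open>auto intro: d_assm\<close>)
      then have "derives L ({?B} \<union> {depv zs x'}) (dep_block ((zs, x') # ds) C)"
        by (rule dep_block_elim[OF B(2)]) (use fC zsF C(1) in \<open>auto simp: fv_dep_block\<close>)
      then have "derives L (insert (depv zs x') {?B}) (dep_block ((zs, x') # ds) C)" by (simp add: insert_commute)
      then have "derives L {?B} (dep_block ((zs, x') # ds) C)" by (rule cut_same[OF B(1)])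
      then show "derives L {Exists x' ?B} (dep_block ((zs, x') # ds) C)"
        using exs_elim[of L ?B "{}" "dep_block ((zs, x') # ds) C" "[x']"] fC by (simp add: fv_dep_block)
    qed (use fC in auto)
    ultimately show ?thesis by (meson derives_trans)
  qed
  moreover have "tsat M X ?F"
    if M: "structure_of L M" and tot: "\<forall>s \<in> X. total_asg M s"
      and N: "tsat M X (alls xs (dep_block ((zs, x') # ds) C))"
    for M :: "('f, 'r, 'u) struct" and X
  proof -
    have ne: "universe M \<noteq> {}" using M by (simp add: structure_of_def)
    have foC: "fo C" using s by (simp add: nf_shape_def)
    from N obtain H where H: "\<And>y as. H y as \<in> universe M"
      "\<And>s t. s \<in> X \<Longrightarrow> t \<in> variants M xs s \<Longrightarrow> sat M (skol H ((zs, x') # ds) t) C"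
      unfolding tsat_alls_dep_block[OF nf_shape_ok[OF shape] foC ne] by blast
    let ?G = "\<lambda>s. H x' (map (\<lambda>z. the (s z)) zs)"
    let ?X = "supplement X ?G x'"
    have "tsat M ?X (alls xs ?P)"
      unfolding tsat_alls_dep_block[OF nf_shape_ok[OF s] foC ne]
    proof (intro exI[of _ H] conjI allI ballI H(1))
      fix r t assume "r \<in> ?X" and t: "t \<in> variants M xs r"
      then obtain u where u: "u \<in> X" "r = u(x' \<mapsto> ?G u)" by (auto simp: supplement_def)
      \<comment> \<open>\<open>t\<close> already carries the witness at \<open>x'\<close>. Resetting
        that value gives a variant of the original assignment, from which the first Skolem step
        restores \<open>t\<close>.\<close>
      let ?t = "t(x' := u x')"
      have x'xs: "x' \<notin> set xs" using C(1) by auto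
      have "?t \<in> variants M xs u" using t x'xs unfolding u by (auto simp: variants_def)
      from H(2)[OF u(1) this] have "sat M (skol H ds (?t(x' \<mapsto> H x' (map (\<lambda>z. the (?t z)) zs)))) C" by simp
      moreover have "map (\<lambda>z. the (?t z)) zs = map (\<lambda>z. the (u z)) zs"
        using t zs(2) unfolding u by (auto simp: variants_def)
      moreover have "?t(x' \<mapsto> ?G u) = t"
        using t x'xs unfolding u by (auto simp: variants_def fun_eq_iff)
      ultimately show "sat M (skol H ds t) C" by metis
    qed
    moreover have "\<forall>s \<in> ?X. total_asg M s"
      using tot H(1) by (auto simp: supplement_def intro!: total_upd)
    ultimately have "tsat M ?X ?A" using C(2) M unfolding nf_of_def by blast
    then have "tsat M X (Exists x' ?A)" using H(1) by (auto intro!: exI[of _ ?G])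
    moreover have "derives L {Exists x' ?A} ?F" using Exists_alpha(2)[of x' A L x] x' f by auto
    ultimately show ?thesis using derives_sound[OF _ M tot] f by (metis form.simps(7) form_subst_Var singletonD)
  qed
  ultimately have "nf_of TYPE('u) L ?F xs ((zs, x') # ds) C" using shape unfolding nf_of_def by blast
  moreover have "set (xs @ map snd ((zs, x') # ds)) \<inter> V = {}" using C(1) x' by auto
  ultimately show "\<exists>xs ds C. set (xs @ map snd ds) \<inter> V = {} \<and> nf_of TYPE('u) L ?F xs ds C" by blast
qed

text \<open>Unnesting the last term names its value by \<open>y\<close>. The atom then has variables
  only, as a block requires, and the term survives in the matrix \<open>y = t\<close>.\<close>

lemma has_nf_Dep_Var:
  assumes "tm_ok L t"
  shows "has_nf TYPE('u) L (Dep (map Var vs @ [t]) :: ('f, 'r) fm)"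
  unfolding has_nf_def
proof (intro allI impI)
  fix V :: "nat set" assume V: "finite V"
  let ?A = "Dep (map Var vs @ [t]) :: ('f, 'r) fm"
  obtain y where y: "y \<notin> V \<union> fv ?A" by (rule fresh_variable[of "V \<union> fv ?A"]) (use V in auto)
  let ?C = "Eq (Var y) t :: ('f, 'r) fm"
  have shape: "nf_shape L (fv ?A) [] [(vs, y)] ?C"
    using y assms by (auto simp: nf_shape_def)
  have "derives L {?A} ?A" using assms by (intro d_assm) (auto simp: list_all_iff)
  then have "derives L {?A} (Exists y (And (Dep ((map Var vs @ [t])[length vs := Var y])) (Eq (Var y) ((map Var vs @ [t]) ! length vs))))"
    by (rule d_unnest) (use y in auto)
  moreover have "(map Var vs @ [t])[length vs := Var y] = map Var (vs @ [y])" "(map Var vs @ [t]) ! length vs = t"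
    by (simp_all add: list_update_append nth_append)
  ultimately have "derives L {?A} (alls [] (dep_block [(vs, y)] ?C))"
    by (simp add: dep_block_def depv_def)
  moreover have "tsat M X ?A"
    if M: "structure_of L M" and N: "tsat M X (alls [] (dep_block [(vs, y)] ?C))"
    for M :: "('f, 'r, 'u) struct" and X
  proof -
    have ne: "universe M \<noteq> {}" using M by (simp add: structure_of_def)
    from N obtain H where "\<And>s. s \<in> X \<Longrightarrow> sat M (skol H [(vs, y)] s) ?C"
      using tsat_dep_block[OF nf_shape_ok[OF shape], of ?C M X] ne by auto
    then have "val M s t = H y (map (\<lambda>z. the (s z)) vs)" if "s \<in> X" for s
      using that y by (auto simp: val_upd)
    then show ?thesis by (auto simp: butlast_append intro!: arg_cong[where f = "H y"])
  qed
  ultimately have "nf_of TYPE('u) L ?A [] [(vs, y)] ?C" using shape unfolding nf_of_def by blast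
  moreover have "set ([] @ map snd [(vs, y)]) \<inter> V = {}" using y by auto
  ultimately show "\<exists>xs ds C. set (xs @ map snd ds) \<inter> V = {} \<and> nf_of TYPE('u) L ?A xs ds C" by blast
qed

lemma tsat_unnest_converse:
  assumes X: "tsat M X (Exists z (And (Dep (ts[i := Var z])) (Eq (Var z) (ts ! i))))"
    and i: "i < length ts" and z: "\<And>t. t \<in> set ts \<Longrightarrow> z \<notin> tvars t"
  shows "tsat M X (Dep ts)"
proof -
  from X obtain F where F: "tsat M (supplement X F z) (Dep (ts[i := Var z]))"
    "\<forall>s \<in> supplement X F z. the (s z) = val M s (ts ! i)"
    by (auto simp del: tsat.simps(3))
  have "F s = val M s (ts ! i)" if "s \<in> X" for s
  proof -
    have "s(z \<mapsto> F s) \<in> supplement X F z" using that by (auto simp: supplement_def)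
    from bspec[OF F(2) this] show ?thesis using z[of "ts ! i"] i by (simp add: val_upd)
  qed
  from tsat_unnest[OF i z this] F(1) show ?thesis by blast
qed

lemma has_nf_Dep:
  assumes "list_all (tm_ok L) ts" "ts \<noteq> []"
  shows "has_nf TYPE('u) L (Dep ts :: ('f, 'r) fm)"
  using assms
\<comment> \<open>The measure counts the arguments that are not variables. The last entry, at index
  \<open>length ts - 1\<close>, is left to \<open>has_nf_Dep_Var\<close>.\<close>
proof (induction "card {i. i < length ts - 1 \<and> ts ! i \<notin> range Var}" arbitrary: ts rule: less_induct)
  case less
  show ?case
  proof (cases "\<exists>i < length ts - 1. ts ! i \<notin> range Var")
    case False
    define vs where "vs = map (\<lambda>t. SOME v. t = Var v) (butlast ts)"
    have "Var (SOME v. t = Var v) = t" if "t \<in> set (butlast ts)" for t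
    proof -
      have "t \<in> range Var" using False that by (auto simp: in_set_conv_nth nth_butlast)
      then have "\<exists>v. t = Var v" by blast
      from someI_ex[OF this] show ?thesis by simp
    qed
    then have "map Var vs = butlast ts" by (auto simp: vs_def intro: map_idI)
    then have "ts = map Var vs @ [last ts]" using less.prems by simp
    moreover have "tm_ok L (last ts)" using less.prems by (auto simp: list_all_iff)
    ultimately show ?thesis using has_nf_Dep_Var by metis
  next
    case True
    then obtain i where i: "i < length ts - 1" "ts ! i \<notin> range Var" by blast
    let ?A = "Dep ts :: ('f, 'r) fm"
    obtain z where z: "z \<notin> fv ?A" by (rule fresh_variable[of "fv ?A"]) auto
    have iz: "z \<notin> tvars t" if "t \<in> set ts" for t using that z by auto
    have tok: "tm_ok L (ts ! i)" using less.prems i by (auto simp: list_all_iff)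
    let ?B = "And (Dep (ts[i := Var z])) (Eq (Var z) (ts ! i)) :: ('f, 'r) fm"
    have up: "list_all (tm_ok L) (ts[i := Var w])" for w
      using less.prems set_update_subset_insert[of ts i "Var w"] by (auto simp: list_all_iff)
    have D: "has_nf TYPE('u) L (Dep (ts[i := Var w]) :: ('f, 'r) fm)" for w
    proof (rule less.hyps)
      let ?S = "\<lambda>ts :: 'f tm list. {j. j < length ts - 1 \<and> ts ! j \<notin> range Var}"
      have "i \<in> ?S ts" "i \<notin> ?S (ts[i := Var w])" using i by auto
      moreover have "?S (ts[i := Var w]) \<subseteq> ?S ts" using i by (auto simp: nth_list_update split: if_splits)
      moreover have "finite (?S ts)" by simp
      ultimately show "card (?S (ts[i := Var w])) < card (?S ts)" by (intro psubset_card_mono) auto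
    qed (use up less.prems in auto)
    have E: "has_nf TYPE('u) L (Exists z ?B)"
    proof (rule has_nf_Exists)
      fix z' assume "z' \<notin> vars ?B"
      have id: "tsubst (Var(z := Var z')) t = t" if "t \<in> set ts" for t
        using iz[OF that] by (intro tsubst_idem) auto
      have "map (tsubst (Var(z := Var z'))) (ts[i := Var z]) = ts[i := Var z']"
        using id by (auto simp: map_update list.map_ident_strong)
      moreover have "tsubst (Var(z := Var z')) (ts ! i) = ts ! i" using i by (intro id) auto
      ultimately have "subst1 ?B (Var z') z = And (Dep (ts[i := Var z'])) (Eq (Var z') (ts ! i))" by simp
      moreover have "has_nf TYPE('u) L (And (Dep (ts[i := Var z'])) (Eq (Var z') (ts ! i)) :: ('f, 'r) fm)"
        by (rule has_nf_And[OF D has_nf_qfree]) (use tok up less.prems in auto)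
      ultimately show "has_nf TYPE('u) L (subst1 ?B (Var z') z)" by simp
    qed (use tok up less.prems in auto)
    show ?thesis
    proof (rule has_nf_equiv[OF E])
      have "derives L {?A} ?A" using less.prems by (intro d_assm) auto
      then show "derives L {?A} (Exists z ?B)" by (rule d_unnest) (use i z in auto)
      show "fv (Exists z ?B) \<subseteq> fv ?A"
      proof -
        have "tvars t - {z} \<subseteq> fv ?A" if "t \<in> set (ts[i := Var z])" for t
          using set_update_subset_insert[of ts i "Var z"] that by auto
        moreover have "tvars (ts ! i) \<subseteq> fv ?A" using i by auto
        ultimately show ?thesis by auto
      qed
      show "tsat M X ?A" if "tsat M X (Exists z ?B)" for M :: "('f, 'r, 'u) struct" and X
        by (rule tsat_unnest_converse[OF that _ iz]) (use i in auto)
    qed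
  qed
qed

text \<open>The bodies of quantifiers are renamed before the induction hypothesis is applied to
  them, so a measure invariant under substitution replaces structural induction.\<close>

primrec depth :: "('f, 'r) fm \<Rightarrow> nat" where
  "depth (Eq t u) = 0"
| "depth (Rel r ts) = 0"
| "depth (Dep ts) = 0"
| "depth (Neg A) = Suc (depth A)"
| "depth (And A B) = Suc (max (depth A) (depth B))"
| "depth (Or A B) = Suc (max (depth A) (depth B))"
| "depth (Exists x A) = Suc (depth A)"
| "depth (Forall x A) = Suc (depth A)"

lemma depth_subst [simp]: "depth (subst \<sigma> A) = depth A"
  by (induction A arbitrary: \<sigma>) auto

text \<open>A formula and its negation are treated together, since negation is pushed inwards by the
  De Morgan laws until it reaches atoms.\<close>

lemma normal_form_both:
  "form L A \<Longrightarrow> has_nf TYPE('u) L A \<and> (fo A \<longrightarrow> has_nf TYPE('u) L (Neg A :: ('f, 'r) fm))"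
proof (induction "depth A" arbitrary: A rule: less_induct)
  case less
  note IH = less.hyps and f = less.prems
  show ?case
  proof (cases A)
    case (Eq t u)
    then show ?thesis using f by (auto intro!: has_nf_qfree)
  next
    case (Rel r ts)
    then show ?thesis using f by (auto intro!: has_nf_qfree)
  next
    case (Dep ts)
    then show ?thesis using f by (auto intro!: has_nf_Dep)
  next
    case (Neg B)
    have B: "form L B" "fo B" using f Neg by auto
    have "has_nf TYPE('u) L B" "has_nf TYPE('u) L (Neg B)" using IH[of B] Neg B by auto
    moreover have "has_nf TYPE('u) L (Neg (Neg B))"
    proof (rule has_nf_equiv[OF \<open>has_nf TYPE('u) L B\<close>])
      show "derives L {Neg (Neg B)} B" by (rule d_negE[OF d_assm]) (use B in auto)
      show "tsat M X (Neg (Neg B))" if "tsat M X B" for M :: "('f, 'r, 'u) struct" and X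
        using that B(2) by (simp add: tsat_fo)
    qed simp
    ultimately show ?thesis using Neg by simp
  next
    case (And B C)
    have g: "form L B" "form L C" using f And by auto
    have "has_nf TYPE('u) L (And B C)" using IH[of B] IH[of C] And g by (intro has_nf_And) auto
    moreover have "has_nf TYPE('u) L (Neg (And B C))" if fo: "fo B" "fo C"
    proof (rule has_nf_equiv[OF _ neg_And])
      show "has_nf TYPE('u) L (Or (Neg B) (Neg C))" using IH[of B] IH[of C] And g fo by (intro has_nf_Or) auto
    qed (use g fo in \<open>auto simp: tsat_fo\<close>)
    ultimately show ?thesis using And by simp
  next
    case (Or B C)
    have g: "form L B" "form L C" using f Or by auto
    have "has_nf TYPE('u) L (Or B C)" using IH[of B] IH[of C] Or g by (intro has_nf_Or) auto
    moreover have "has_nf TYPE('u) L (Neg (Or B C))" if fo: "fo B" "fo C"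
    proof (rule has_nf_equiv[OF _ neg_Or])
      show "has_nf TYPE('u) L (And (Neg B) (Neg C))" using IH[of B] IH[of C] Or g fo by (intro has_nf_And) auto
    qed (use g fo in \<open>auto simp: tsat_fo\<close>)
    ultimately show ?thesis using Or by simp
  next
    case (Exists x B)
    have g: "form L B" using f Exists by auto
    have I: "has_nf TYPE('u) L (subst1 B (Var x') x)" "fo B \<Longrightarrow> has_nf TYPE('u) L (subst1 (Neg B) (Var x') x)" for x'
      using IH[of "subst1 B (Var x') x"] Exists g by auto
    have "has_nf TYPE('u) L (Exists x B)" using I g by (intro has_nf_Exists) auto
    moreover have "has_nf TYPE('u) L (Neg (Exists x B))" if fo: "fo B"
    proof (rule has_nf_equiv[OF has_nf_Forall neg_Exists])
      show "tsat M X (Neg (Exists x B))" if "tsat M X (Forall x (Neg B))" for M :: "('f, 'r, 'u) struct" and X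
        using that tsat_fo[of "Forall x (Neg B)" M X] fo by simp
    qed (use I g fo in auto)
    ultimately show ?thesis using Exists by simp
  next
    case (Forall x B)
    have g: "form L B" using f Forall by auto
    have I: "has_nf TYPE('u) L (subst1 B (Var x') x)" "fo B \<Longrightarrow> has_nf TYPE('u) L (subst1 (Neg B) (Var x') x)" for x'
      using IH[of "subst1 B (Var x') x"] Forall g by auto
    have "has_nf TYPE('u) L (Forall x B)" using I g by (intro has_nf_Forall) auto
    moreover have "has_nf TYPE('u) L (Neg (Forall x B))" if fo: "fo B"
    proof (rule has_nf_equiv[OF has_nf_Exists neg_Forall])
      show "tsat M X (Neg (Forall x B))" if "tsat M X (Exists x (Neg B))" for M :: "('f, 'r, 'u) struct" and X
        using that tsat_fo[of "Exists x (Neg B)" M X] fo by simp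
    qed (use I g fo in auto)
    ultimately show ?thesis using Forall by simp
  qed
qed

theorem normal_form:
  assumes "form L A" "finite V"
  obtains xs ds C where "set (xs @ map snd ds) \<inter> V = {}" "nf_of TYPE('u) L A xs ds C"
  using normal_form_both[OF assms(1)] assms(2) has_nfE by blast

section \<open>Term models\<close>

lemma lepoll_UNIV_times:
  assumes "infinite (UNIV :: 'u set)"
  shows "(UNIV :: ('u \<times> 'u) set) \<lesssim> (UNIV :: 'u set)"
proof -
  have "\<exists>f. inj_on f (UNIV \<times> UNIV :: ('u \<times> 'u) set) \<and> f ` (UNIV \<times> UNIV) \<subseteq> (UNIV :: 'u set)"
    using card_of_Times_same_infinite[OF assms] ordIso_iff_ordLeq card_of_ordLeq by blast
  then show ?thesis unfolding lepoll_def by (simp add: UNIV_Times_UNIV)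
qed

lemma lepoll_times:
  assumes "infinite (UNIV :: 'u set)" "A \<lesssim> (UNIV :: 'u set)" "B \<lesssim> (UNIV :: 'u set)"
  shows "A \<times> B \<lesssim> (UNIV :: 'u set)"
  using lepoll_trans[OF times_lepoll_mono[OF assms(2,3)]] lepoll_UNIV_times[OF assms(1)] by simp

lemma lepoll_nat: "infinite (UNIV :: 'u set) \<Longrightarrow> (A :: nat set) \<lesssim> (UNIV :: 'u set)"
  by (meson infinite_le_lepoll lepoll_trans subset_imp_lepoll subset_UNIV)

lemma lepoll_Plus:
  assumes "infinite (UNIV :: 'u set)" "A \<lesssim> (UNIV :: 'u set)" "B \<lesssim> (UNIV :: 'u set)"
  shows "A <+> B \<lesssim> (UNIV :: 'u set)"
proof -
  obtain f where f: "inj_on f A" "f ` A \<subseteq> (UNIV :: 'u set)" using assms(2) unfolding lepoll_def by auto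
  obtain g where g: "inj_on g B" "g ` B \<subseteq> (UNIV :: 'u set)" using assms(3) unfolding lepoll_def by auto
  have "inj_on (case_sum (\<lambda>a. (0 :: nat, f a)) (\<lambda>b. (1, g b))) (A <+> B)"
    by (rule inj_onI) (use inj_onD[OF f(1)] inj_onD[OF g(1)] in \<open>auto elim!: PlusE\<close>)
  then have "A <+> B \<lesssim> (UNIV :: (nat \<times> 'u) set)" unfolding lepoll_def by blast
  also have "(UNIV :: (nat \<times> 'u) set) \<lesssim> (UNIV :: 'u set)"
    using lepoll_times[OF assms(1) lepoll_nat[OF assms(1), of UNIV] lepoll_refl] by simp
  finally show ?thesis .
qed

primrec tm_enc :: "(nat \<Rightarrow> 'u) \<Rightarrow> ('f \<Rightarrow> 'u list \<Rightarrow> 'u) \<Rightarrow> 'f tm \<Rightarrow> 'u" where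
  "tm_enc a b (Var x) = a x"
| "tm_enc a b (Fun f ts) = b f (map (tm_enc a b) ts)"

lemma terms_lepoll:
  fixes L :: "('f, 'r) voc"
  assumes inf: "infinite (UNIV :: 'u set)" and F: "dom (funs L) \<lesssim> (UNIV :: 'u set)"
  shows "{t. tm_ok L t} \<lesssim> (UNIV :: 'u set)"
proof -
  obtain N :: "nat \<Rightarrow> 'u" where N: "inj N" using infinite_countable_subset[OF inf] by blast
  obtain p :: "'u \<times> 'u \<Rightarrow> 'u" where p: "inj p" using lepoll_UNIV_times[OF inf] by (auto simp: lepoll_def)
  obtain c :: "'f \<Rightarrow> 'u" where c: "inj_on c (dom (funs L))" using F by (auto simp: lepoll_def)
  define l where "l as = foldr (\<lambda>a b. p (a, b)) as (N 0)" for as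
  have pe: "p x = p y \<longleftrightarrow> x = y" for x y using p by (simp add: inj_eq)
  have Ne: "N x = N y \<longleftrightarrow> x = y" for x y using N by (simp add: inj_eq)
  have l: "length as = length bs \<Longrightarrow> l as = l bs \<Longrightarrow> as = bs" for as bs
    by (induction as bs rule: list_induct2) (auto simp: l_def pe)
  \<comment> \<open>The codes \<open>N 0\<close> and \<open>N 1\<close> separate variables from
    applications. The number of arguments is coded too, because \<open>l\<close> is injective only
    among lists of equal length.\<close>
  define e where "e = tm_enc (\<lambda>x. p (N 0, N x)) (\<lambda>f as. p (N 1, p (c f, p (N (length as), l as))))"
  have "tm_ok L t \<Longrightarrow> tm_ok L u \<Longrightarrow> e t = e u \<Longrightarrow> t = u" for t u
  proof (induction t arbitrary: u)
    case (Var x)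
    then show ?case by (cases u) (auto simp: e_def pe Ne)
  next
    case (Fun f ts)
    then obtain g us where u: "u = Fun g us" by (cases u) (auto simp: e_def pe Ne)
    with Fun.prems have eq: "c f = c g" "length ts = length us" "l (map e ts) = l (map e us)"
      by (auto simp: e_def pe Ne)
    have "f = g" using Fun.prems c eq(1) u by (auto dest!: inj_onD)
    have m: "map e ts = map e us" using l eq by simp
    have "ts = us"
    proof (rule nth_equalityI[OF eq(2)])
      fix i assume i: "i < length ts"
      have "e (ts ! i) = e (us ! i)" using m i eq(2) by (metis nth_map)
      then show "ts ! i = us ! i" using i eq(2) Fun.prems u by (intro Fun.IH) (auto simp: list_all_length)
    qed
    then show ?case using u \<open>f = g\<close> by simp
  qed
  then have "inj_on e {t. tm_ok L t}" by (auto simp: inj_on_def)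
  then show ?thesis unfolding lepoll_def by blast
qed

text \<open>Zorn's lemma is applied because the vocabulary may be uncountable. Only first-order
  formulas are decided, as only they have negations.\<close>

lemma lindenbaum:
  assumes "\<not> derives L \<Gamma>\<^sub>0 Falsum"
  obtains \<Gamma> where "\<Gamma>\<^sub>0 \<subseteq> \<Gamma>" "\<not> derives L \<Gamma> Falsum"
    "\<And>A. form L A \<Longrightarrow> fo A \<Longrightarrow> derives L \<Gamma> A \<or> derives L \<Gamma> (Neg A)"
proof -
  let ?S = "{\<Gamma>. \<Gamma>\<^sub>0 \<subseteq> \<Gamma> \<and> \<not> derives L \<Gamma> Falsum}"
  have "\<exists>M \<in> ?S. \<forall>X \<in> ?S. M \<subseteq> X \<longrightarrow> X = M"
  proof (rule subset_Zorn_nonempty)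
    show "?S \<noteq> {}" using assms by auto
    fix C assume C: "C \<noteq> {}" "subset.chain ?S C"
    have "\<not> derives L (\<Union> C) Falsum"
    proof
      assume "derives L (\<Union> C) Falsum"
      then obtain D where D: "D \<subseteq> \<Union> C" "finite D" "derives L D Falsum" using derives_finite by blast
      obtain B where B: "B \<in> C" "D \<subseteq> B" by (rule finite_subset_Union_chain[OF D(2,1) C])
      have "\<not> derives L B Falsum" using B(1) C(2) unfolding subset.chain_def by blast
      then show False using d_weaken[OF D(3) B(2)] by blast
    qed
    moreover have "\<Gamma>\<^sub>0 \<subseteq> \<Union> C" using C unfolding subset.chain_def by blast
    ultimately show "\<Union> C \<in> ?S" by simp
  qed
  then obtain \<Gamma> where m: "\<Gamma> \<in> ?S" "\<forall>X \<in> ?S. \<Gamma> \<subseteq> X \<longrightarrow> X = \<Gamma>" ..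
  from m(1) have G: "\<Gamma>\<^sub>0 \<subseteq> \<Gamma>" "\<not> derives L \<Gamma> Falsum" by simp_all
  have max: "X = \<Gamma>" if "\<Gamma> \<subseteq> X" "\<not> derives L X Falsum" for X
    using bspec[OF m(2), of X] that G(1) by simp
  show thesis
  proof (rule that[OF G])
    fix A :: "('a, 'b) fm" assume A: "form L A" "fo A"
    show "derives L \<Gamma> A \<or> derives L \<Gamma> (Neg A)"
    proof (cases "derives L (insert A \<Gamma>) Falsum")
      case True
      then show ?thesis using negI_Falsum A by blast
    next
      case False
      then have "insert A \<Gamma> = \<Gamma>" using max by blast
      then show ?thesis using A by (auto intro: d_assm)
    qed
  qed
qed

lemma derives_eqs:
  assumes "length ts = length us" "\<And>i. i < length ts \<Longrightarrow> derives L \<Gamma> (Eq (ts ! i) (us ! i))"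
  shows "derives L \<Gamma> (eqs ts us)"
  unfolding eqs_def derives_conjs using assms by (auto simp: in_set_zip)

text \<open>Only function symbols are restricted, since they alone determine the number of terms and
  thus the size of the term model.\<close>

definition subvoc :: "('f, 'r) voc \<Rightarrow> ('f, 'r) voc \<Rightarrow> bool" where
  "subvoc K L \<longleftrightarrow> funs K \<subseteq>\<^sub>m funs L \<and> rels K = rels L"

lemma funs_subvoc: "subvoc K L \<Longrightarrow> funs K f = Some n \<Longrightarrow> funs L f = Some n"
  unfolding subvoc_def map_le_def by (metis domI)

lemma tm_ok_subvoc: "subvoc K L \<Longrightarrow> tm_ok K t \<Longrightarrow> tm_ok L t"
  by (induction t) (auto simp: list_all_iff funs_subvoc)

lemma form_subvoc: "subvoc K L \<Longrightarrow> form K A \<Longrightarrow> form L A"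
  by (induction A) (auto simp: list_all_iff tm_ok_subvoc, auto simp: subvoc_def)

text \<open>The elements are classes of \<open>K\<close>-terms under equality derivable over
  \<open>L\<close>, with variables acting as constants through \<open>s\<close>. Restricting the
  terms to \<open>K\<close> bounds the universe even if \<open>L\<close> is large. Agreement with
  derivability is claimed for quantifier-free formulas only, which is why no witnesses are
  required.\<close>

lemma term_model:
  fixes L K :: "('f, 'r) voc"
  assumes inf: "infinite (UNIV :: 'u set)" and K: "dom (funs K) \<lesssim> (UNIV :: 'u set)" "subvoc K L"
    and cons: "\<not> derives L \<Gamma>\<^sub>0 Falsum"
  obtains M :: "('f, 'r, 'u) struct" and s where
    "\<And>f as. fint M f as \<in> universe M" "universe M = val M s ` {t. tm_ok K t}" "total_asg M s"
    "\<And>A. qfree A \<Longrightarrow> fo A \<Longrightarrow> form K A \<Longrightarrow> derives L \<Gamma>\<^sub>0 A \<Longrightarrow> sat M s A"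
proof -
  from lindenbaum[OF cons] obtain \<Gamma> where G: "\<Gamma>\<^sub>0 \<subseteq> \<Gamma>" "\<not> derives L \<Gamma> Falsum"
    and compl: "\<And>A. form L A \<Longrightarrow> fo A \<Longrightarrow> derives L \<Gamma> A \<or> derives L \<Gamma> (Neg A)" by blast
  define G where "G = {t. tm_ok K t}"
  obtain e :: "'f tm \<Rightarrow> 'u" where e: "inj_on e G"
    using terms_lepoll[OF inf K(1)] by (auto simp: lepoll_def G_def)
  have GL: "tm_ok L t" if "t \<in> G" for t using that tm_ok_subvoc[OF K(2)] by (simp add: G_def)
  define E where "E t u \<longleftrightarrow> derives L \<Gamma> (Eq t u)" for t u
  have Eref: "E t t" if "t \<in> G" for t using GL[OF that] by (auto simp: E_def intro: d_eq_refl)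
  have Esym: "E u t" if "E t u" "t \<in> G" "u \<in> G" for t u
    using that imp_elim[OF d_eq_sym] GL unfolding E_def by (metis fo.simps(1))
  have Etrans: "E t v" if "E t u" "E u v" "t \<in> G" "u \<in> G" "v \<in> G" for t u v
    using that imp_elim[OF d_eq_trans d_conjI] GL unfolding E_def by (metis fo.simps(1))
  define rep where "rep t = (SOME u. u \<in> G \<and> E t u)" for t
  have rep: "rep t \<in> G \<and> E t (rep t)" if "t \<in> G" for t
    unfolding rep_def by (rule someI[of "\<lambda>u. u \<in> G \<and> E t u" t]) (use that Eref in auto)
  \<comment> \<open>A class is represented by the code of a chosen member, so that the universe lies
    in the type \<open>'u\<close>.\<close>
  define g where "g t = e (rep t)" for t
  have g: "g t = g u \<longleftrightarrow> E t u" if "t \<in> G" "u \<in> G" for t u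
  proof
    assume "g t = g u"
    then have "rep t = rep u" using e rep that by (auto simp: g_def dest: inj_onD)
    then show "E t u" using rep that Esym Etrans by metis
  next
    assume "E t u"
    have "v \<in> G \<and> E t v \<longleftrightarrow> v \<in> G \<and> E u v" for v
      using Etrans[OF \<open>E t u\<close>, of v] Etrans[OF Esym[OF \<open>E t u\<close>], of v] that by blast
    then have "(\<lambda>v. v \<in> G \<and> E t v) = (\<lambda>v. v \<in> G \<and> E u v)" by (rule ext)
    then show "g t = g u" by (simp add: g_def rep_def)
  qed
  define h where "h = inv_into G g"
  have h: "h a \<in> G" "g (h a) = a" if "a \<in> g ` G" for a
    using that by (auto simp: h_def inv_into_into f_inv_into_f)
  have hE: "E (h (g t)) t" if "t \<in> G" for t using h[of "g t"] that g by auto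
  have v0: "Var 0 \<in> G" by (simp add: G_def)
  \<comment> \<open>Symbols outside \<open>K\<close> and lists of the wrong length or range get the
    value of \<open>Var 0\<close>. Thus \<open>fint\<close> stays in the universe for all inputs, as
    Skolem functions read off the model must.\<close>
  define M :: "('f, 'r, 'u) struct" where "M = \<lparr>universe = g ` G,
    fint = (\<lambda>f as. if funs K f = Some (length as) \<and> set as \<subseteq> g ` G then g (Fun f (map h as)) else g (Var 0)),
    rint = (\<lambda>r as. derives L \<Gamma> (Rel r (map h as)))\<rparr>"
  define s where "s v = Some (g (Var v))" for v
  have val: "val M s t = g t" if "t \<in> G" for t
    using that
  proof (induction t)
    case (Fun f ts)
    have ts: "t \<in> G" if "t \<in> set ts" for t using Fun.prems that by (auto simp: G_def list_all_iff)
    have f: "funs K f = Some (length ts)" using Fun.prems by (simp add: G_def)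
    have "map (val M s) ts = map g ts" using Fun.IH ts by auto
    moreover have "fint M f (map g ts) = g (Fun f (map h (map g ts)))"
      using f ts by (auto simp: M_def simp del: map_map)
    ultimately have "val M s (Fun f ts) = g (Fun f (map h (map g ts)))" by (metis val.simps(2))
    also have "\<dots> = g (Fun f ts)"
    proof -
      have G1: "Fun f (map h (map g ts)) \<in> G" using f ts h by (auto simp: G_def list_all_iff)
      have "derives L \<Gamma> (eqs (map h (map g ts)) ts)"
        by (rule derives_eqs) (use ts hE in \<open>auto simp: E_def\<close>)
      then have "E (Fun f (map h (map g ts))) (Fun f ts)"
        unfolding E_def using imp_elim[OF d_eq_fun] GL[OF G1] GL[OF Fun.prems] by (metis fo.simps(1))
      then show ?thesis using g G1 Fun.prems by blast
    qed
    finally show ?case .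
  qed (simp add: s_def)
  have neg: "derives L \<Gamma> (Neg A) \<longleftrightarrow> \<not> derives L \<Gamma> A" if "form L A" "fo A" for A
    using compl[OF that] contradiction[of L \<Gamma> A] G(2) by blast
  have sat: "sat M s A \<longleftrightarrow> derives L \<Gamma> A" if "qfree A" "fo A" "form K A" for A
    using that
  proof (induction A)
    case (Eq t u)
    then have "t \<in> G" "u \<in> G" by (auto simp: G_def)
    then show ?case using g val by (simp add: E_def)
  next
    case (Rel r ts)
    have ts: "t \<in> G" if "t \<in> set ts" for t using Rel.prems that by (auto simp: G_def list_all_iff)
    have r: "form L (Rel r ts)" using Rel.prems form_subvoc[OF K(2)] by blast
    then have r': "form L (Rel r (map h (map g ts)))" using ts h GL by (auto simp: list_all_iff)
    have "map (val M s) ts = map g ts" using val ts by auto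
    moreover have "rint M r (map g ts) \<longleftrightarrow> derives L \<Gamma> (Rel r (map h (map g ts)))" by (simp add: M_def)
    ultimately have "sat M s (Rel r ts) \<longleftrightarrow> derives L \<Gamma> (Rel r (map h (map g ts)))" by (metis sat.simps(2))
    also have "\<dots> \<longleftrightarrow> derives L \<Gamma> (Rel r ts)"
    proof -
      have e1: "derives L \<Gamma> (eqs (map h (map g ts)) ts)"
        by (rule derives_eqs) (use ts hE in \<open>auto simp: E_def\<close>)
      have e2: "derives L \<Gamma> (eqs ts (map h (map g ts)))"
      proof (rule derives_eqs)
        fix i assume i: "i < length ts"
        then have "ts ! i \<in> G" using ts by auto
        then have "E (ts ! i) (h (g (ts ! i)))" using hE Esym h by blast
        then show "derives L \<Gamma> (Eq (ts ! i) (map h (map g ts) ! i))" using i by (simp add: E_def)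
      qed simp
      have i1: "derives L \<Gamma> (Imp (Rel r (map h (map g ts))) (Rel r ts))"
        by (rule imp_elim[OF d_eq_rel[OF r' r] e1]) simp
      have i2: "derives L \<Gamma> (Imp (Rel r ts) (Rel r (map h (map g ts))))"
        by (rule imp_elim[OF d_eq_rel[OF r r'] e2]) simp
      show ?thesis using imp_elim[OF i1] imp_elim[OF i2] by auto
    qed
    finally show ?case .
  next
    case (Neg A)
    then show ?case using neg[of A] form_subvoc[OF K(2)] by auto
  next
    case (And A B)
    then show ?case by (auto intro: d_conjI dest: d_conjE1 d_conjE2)
  next
    case (Or A B)
    then have f: "form L A" "fo A" "form L B" "fo B" using form_subvoc[OF K(2)] by auto
    have "derives L \<Gamma> A \<or> derives L \<Gamma> B" if "derives L \<Gamma> (Or A B)"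
    proof (rule ccontr)
      assume "\<not> (derives L \<Gamma> A \<or> derives L \<Gamma> B)"
      then have n: "derives L \<Gamma> (Neg A)" "derives L \<Gamma> (Neg B)" using neg f by auto
      have "derives L (insert A \<Gamma>) Falsum"
        by (rule contradiction[of _ _ A]) (use f in \<open>auto intro: d_assm d_weaken[OF n(1)]\<close>)
      moreover have "derives L (insert B \<Gamma>) Falsum"
        by (rule contradiction[of _ _ B]) (use f in \<open>auto intro: d_assm d_weaken[OF n(2)]\<close>)
      ultimately show False using d_disjE[OF that] G(2) by auto
    qed
    then show ?case using Or f by (auto intro: d_disjI1 d_disjI2)
  qed auto
  show thesis
  proof (rule that[of M s])
    show "fint M f as \<in> universe M" for f as
      using h v0 by (auto simp: M_def intro!: imageI) (auto simp: G_def list_all_iff)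
    show "universe M = val M s ` {t. tm_ok K t}"
      using val by (auto simp: M_def G_def)
    show "total_asg M s" by (auto simp: total_asg_def s_def M_def G_def)
    show "sat M s A" if "qfree A" "fo A" "form K A" "derives L \<Gamma>\<^sub>0 A" for A
      using sat[OF that(1-3)] d_weaken[OF that(4) G(1)] by blast
  qed
qed

section \<open>Models of a single sentence\<close>

text \<open>The conjuncts at any depth. The matrices of the game are nested conjunctions, and this
  avoids tracking where a conjunct sits.\<close>

fun parts :: "('f, 'r) fm \<Rightarrow> ('f, 'r) fm set" where
  "parts (And A B) = insert (And A B) (parts A \<union> parts B)"
| "parts A = {A}"

lemma parts_refl: "A \<in> parts A"
  by (cases A) auto

lemma derives_parts: "B \<in> parts A \<Longrightarrow> derives L \<Gamma> A \<Longrightarrow> derives L \<Gamma> B"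
  by (induction A rule: parts.induct) (auto dest: d_conjE1 d_conjE2)

lemma parts_subst: "B \<in> parts A \<Longrightarrow> subst \<sigma> B \<in> parts (subst \<sigma> A)"
  by (induction A rule: parts.induct) auto

lemma parts_conjs: "A \<in> set As \<Longrightarrow> B \<in> parts A \<Longrightarrow> B \<in> parts (conjs As)"
  by (induction As rule: conjs.induct) auto

lemma subst_conjs: "subst \<sigma> (conjs As) = conjs (map (subst \<sigma>) As)"
  by (induction As rule: conjs.induct) auto

lemma subst_eqs: "subst \<sigma> (eqs ts us) = eqs (map (tsubst \<sigma>) ts) (map (tsubst \<sigma>) us)"
  by (auto simp: eqs_def subst_conjs zip_map_map intro!: arg_cong[where f = conjs])

lemma tsubst_cong: "(\<And>v. v \<in> tvars t \<Longrightarrow> \<sigma> v = \<tau> v) \<Longrightarrow> tsubst \<sigma> t = tsubst \<tau> t"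
  by (induction t) auto

lemma subst_cong: "\<forall>v \<in> fv A. \<sigma> v = \<tau> v \<Longrightarrow> subst \<sigma> A = subst \<tau> A"
proof (induction A arbitrary: \<sigma> \<tau>)
  case (Exists x A)
  have "subst (\<sigma>(x := Var x)) A = subst (\<tau>(x := Var x)) A"
    by (rule Exists.IH) (use Exists.prems in auto)
  then show ?case by simp
next
  case (Forall x A)
  have "subst (\<sigma>(x := Var x)) A = subst (\<tau>(x := Var x)) A"
    by (rule Forall.IH) (use Forall.prems in auto)
  then show ?case by simp
next
  case (And A B)
  show ?case using And.IH(1)[of \<sigma> \<tau>] And.IH(2)[of \<sigma> \<tau>] And.prems by simp
next
  case (Or A B)
  show ?case using Or.IH(1)[of \<sigma> \<tau>] Or.IH(2)[of \<sigma> \<tau>] Or.prems by simp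
next
  case (Neg A)
  show ?case using Neg.IH[of \<sigma> \<tau>] Neg.prems by simp
qed (auto intro!: tsubst_cong)

lemma subst_subst_qfree: "qfree A \<Longrightarrow> subst \<tau> (subst \<sigma> A) = subst (\<lambda>v. tsubst \<tau> (\<sigma> v)) A"
  by (induction A) (auto simp: tsubst_tsubst)

lemma qfree_subst: "qfree (subst \<sigma> A) \<longleftrightarrow> qfree A"
  by (induction A arbitrary: \<sigma>) auto

lemma free_for_qfree: "qfree A \<Longrightarrow> free_for \<sigma> A"
  by (induction A) auto

lemma vars_subst_rename: "vars (subst (\<lambda>v. Var (\<rho> v)) A) \<subseteq> vars A \<union> \<rho> ` vars A"
proof (induction A arbitrary: \<rho>)
  case (Exists x A)
  have "vars (subst (\<lambda>v. Var ((\<rho>(x := x)) v)) A) \<subseteq> vars A \<union> (\<rho>(x := x)) ` vars A" by (rule Exists.IH)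
  moreover have "(\<lambda>v. Var ((\<rho>(x := x)) v)) = (\<lambda>v. Var (\<rho> v))(x := Var x)" by auto
  ultimately have "vars (subst ((\<lambda>v. Var (\<rho> v))(x := Var x)) A) \<subseteq> vars A \<union> (\<rho>(x := x)) ` vars A" by metis
  moreover have "(\<rho>(x := x)) ` vars A \<subseteq> insert x (\<rho> ` vars A)" by auto
  ultimately show ?case unfolding subst.simps vars.simps by blast
next
  case (Forall x A)
  have "vars (subst (\<lambda>v. Var ((\<rho>(x := x)) v)) A) \<subseteq> vars A \<union> (\<rho>(x := x)) ` vars A" by (rule Forall.IH)
  moreover have "(\<lambda>v. Var ((\<rho>(x := x)) v)) = (\<lambda>v. Var (\<rho> v))(x := Var x)" by auto
  ultimately have "vars (subst ((\<lambda>v. Var (\<rho> v))(x := Var x)) A) \<subseteq> vars A \<union> (\<rho>(x := x)) ` vars A" by metis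
  moreover have "(\<rho>(x := x)) ` vars A \<subseteq> insert x (\<rho> ` vars A)" by auto
  ultimately show ?case unfolding subst.simps vars.simps by blast
next
  case (And A B)
  show ?case using And.IH(1)[of \<rho>] And.IH(2)[of \<rho>] by auto
next
  case (Or A B)
  show ?case using Or.IH(1)[of \<rho>] Or.IH(2)[of \<rho>] by auto
qed (auto simp: fv_tsubst)

lemma vars_conjs_upper: "vars (conjs As) \<subseteq> insert 0 (\<Union>A \<in> set As. vars A)"
  by (induction As rule: conjs.induct) auto

lemma vars_eqs:
  "vars (eqs ts us :: ('f, 'r) fm) \<subseteq> insert 0 (\<Union> (tvars ` set ts) \<union> \<Union> (tvars ` set us))"
proof -
  have "(\<Union>A \<in> set (map2 Eq ts us :: ('f, 'r) fm list). vars A) \<subseteq> \<Union> (tvars ` set ts) \<union> \<Union> (tvars ` set us)"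
    by (force dest: set_zip_leftD set_zip_rightD)
  then show ?thesis
    unfolding eqs_def by (intro subset_trans[OF vars_conjs_upper] insert_mono)
qed

lemma qfree_conjs: "As \<noteq> [] \<Longrightarrow> qfree (conjs As) \<longleftrightarrow> (\<forall>A \<in> set As. qfree A)"
  by (induction As rule: conjs.induct) auto

lemma exs_mono: "derives L {A} B \<Longrightarrow> form L A \<Longrightarrow> derives L {exs ys A} (exs ys B)"
  by (induction ys) (auto intro: Exists_mono)

lemma deps_in_nth: "deps_in W ds \<Longrightarrow> p < length ds \<Longrightarrow> set (fst (ds ! p)) \<subseteq> W \<union> snd ` set (take p ds)"
proof (induction W ds arbitrary: p rule: deps_in.induct)
  case (2 W zs y ds)
  then show ?case by (cases p) auto
qed simp

text \<open>An equation with a fresh left-hand side can be discharged: otherwise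
  \<open>x \<noteq> t\<close> is derivable, generalising over \<open>x\<close> and instantiating
  with \<open>t\<close> refutes \<open>t = t\<close>.\<close>

lemma drop_equations:
  assumes "derives L (\<Gamma> \<union> (\<lambda>(x, t). Eq (Var x) t) ` set ps) Falsum" "distinct (map fst ps)"
    "\<And>x t. (x, t) \<in> set ps \<Longrightarrow> tm_ok L t \<and> tvars t \<inter> fst ` set ps = {}" "fst ` set ps \<inter> \<Union> (fv ` \<Gamma>) = {}"
  shows "derives L \<Gamma> Falsum"
  using assms
proof (induction ps)
  case (Cons q ps)
  obtain x t where q: "q = (x, t)" by (cases q)
  let ?\<Delta> = "\<Gamma> \<union> (\<lambda>(x, t). Eq (Var x) t) ` set ps"
  have t: "tm_ok L t" "x \<notin> tvars t" using Cons.prems(3)[of x t] q by auto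
  have "derives L (insert (Eq (Var x) t) ?\<Delta>) Falsum" using Cons.prems(1) by (simp add: q)
  then have "derives L ?\<Delta> (Neg (Eq (Var x) t))" using t by (intro negI_Falsum) auto
  moreover have "x \<notin> \<Union> (fv ` ?\<Delta>)"
  proof -
    have "x \<noteq> y \<and> x \<notin> tvars u" if "(y, u) \<in> set ps" for y u
      using Cons.prems(3)[of y u] Cons.prems(2) that q by force
    then show ?thesis using Cons.prems(4) q by force
  qed
  ultimately have "derives L ?\<Delta> (Forall x (Neg (Eq (Var x) t)))" by (rule d_allI)
  then have "derives L ?\<Delta> (subst1 (Neg (Eq (Var x) t)) t x)" using t by (intro d_allE) auto
  moreover have "tsubst (Var(x := t)) t = t" using t(2) by (intro tsubst_idem) auto
  ultimately have "derives L ?\<Delta> (Neg (Eq t t))" by simp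
  moreover have "derives L ?\<Delta> (Eq t t)" using t(1) by (rule d_eq_refl)
  ultimately have "derives L ?\<Delta> Falsum" by (rule contradiction[rotated])
  then show ?case
  proof (rule Cons.IH)
    show "tm_ok L u \<and> tvars u \<inter> fst ` set ps = {}" if "(y, u) \<in> set ps" for y u
      using Cons.prems(3)[of y u] that by auto
  qed (use Cons.prems in auto)
qed simp

text \<open>The lists \<open>b k\<close> are fresh copies of the quantified variables \<open>xs\<close>, \<open>ys\<close> of a normal form.
  Dependence elimination with parameters turns the position \<open>R k\<close> of the game, in which \<open>k\<close> rounds have
  been played, into \<open>\<forall>x\<exists>y (E k \<and> R (k + 1))\<close>, since dependence atoms may occur in its matrix. In round
  \<open>k\<close> the universal player chooses the tuple of terms \<open>e k\<close>.\<close>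

locale game =
  fixes L :: "('f, 'r) voc" and xs :: "nat list" and ds :: "(nat list \<times> nat) list" and C :: "('f, 'r) fm"
    and b :: "nat \<Rightarrow> nat list" and e :: "nat \<Rightarrow> 'f tm list"
  assumes shape: "nf_shape L {} xs ds C"
    and b_0: "b 0 = xs @ map snd ds"
    and length_b: "length (b k) = length xs + length ds"
    and distinct_b: "distinct (b k)"
    and disjoint_b: "i < k \<Longrightarrow> set (b i) \<inter> set (b k) = {}"
    and zero_b: "0 \<notin> set (b k)"
    and length_e: "length (e k) = length xs"
    and e_ok: "t \<in> set (e k) \<Longrightarrow> tm_ok L t"
    and e_fresh: "i \<le> k \<Longrightarrow> t \<in> set (e i) \<Longrightarrow> tvars t \<inter> set (b k) = {}"
begin

definition X :: "nat \<Rightarrow> nat list" where "X k = take (length xs) (b k)"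
definition Y :: "nat \<Rightarrow> nat list" where "Y k = drop (length xs) (b k)"
definition copy :: "nat \<Rightarrow> nat \<Rightarrow> nat" where "copy k = rename (b 0) (b k)"
definition next_copy :: "nat \<Rightarrow> nat \<Rightarrow> nat" where "next_copy k = rename (b k) (b (Suc k))"
definition w :: "nat \<Rightarrow> nat \<Rightarrow> nat list" where "w k p = map (copy k) (fst (ds ! p))"
definition atoms :: "nat \<Rightarrow> (nat list \<times> nat) list" where
  "atoms k = map (\<lambda>p. (w k p, p)) [0..<length ds]"
definition coherent :: "nat \<Rightarrow> nat \<Rightarrow> nat \<Rightarrow> ('f, 'r) fm" where
  "coherent i k p = Imp (eqs (map Var (w i p)) (map Var (w k p))) (Eq (Var (Y i ! p)) (Var (Y k ! p)))"

text \<open>The successor step copies the inner matrix of \<open>depE_conclusion\<close>, so that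
  \<open>round\<close> is an instance of the rule. Blocks before \<open>b k\<close> are parameters,
  and \<open>next_copy k\<close> does not touch them.\<close>

primrec E :: "nat \<Rightarrow> ('f, 'r) fm" where
  "E 0 = conjs (map (\<lambda>(zs, y). depv zs y) ds @ [C])"
| "E (Suc k) = conjs (subst (\<lambda>v. Var (next_copy k v)) (E k) #
     map (\<lambda>(ws, p). Imp (eqs (map Var ws) (map (\<lambda>w. Var (next_copy k w)) ws))
                        (Eq (Var (Y k ! p)) (Var (Y (Suc k) ! p)))) (depE_atoms (X k) (Y k) (atoms k)))"

definition R :: "nat \<Rightarrow> ('f, 'r) fm" where "R k = alls (X k) (exs (Y k) (E k))"

text \<open>A move is recorded by equations and not substituted. The matrices therefore keep their
  variables, and no capture condition arises.\<close>

definition eqns :: "nat \<Rightarrow> ('f, 'r) fm set" where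
  "eqns k = (\<lambda>(x, t). Eq (Var x) t) ` set (zip (X k) (e k))"

text \<open>The position before round \<open>k\<close>: \<open>R k\<close> is the game still to be
  played, the other formulas record past moves and answers.\<close>

primrec D :: "nat \<Rightarrow> ('f, 'r) fm set" where
  "D 0 = {R 0}"
| "D (Suc k) = D k \<union> eqns k \<union> {E k, R (Suc k)}"

lemma XY: "X k @ Y k = b k" "length (X k) = length xs" "length (Y k) = length ds"
  by (auto simp: X_def Y_def length_b)

lemma XY_0: "X 0 = xs" "Y 0 = map snd ds"
  by (auto simp: X_def Y_def b_0)

lemma C_props: "fo C" "qfree C" "form L C" "fv C \<subseteq> set (b 0)"
  using shape by (auto simp: nf_shape_def b_0)

lemma deps: "deps_in (set xs) ds"
  using shape by (simp add: nf_shape_def)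

lemma w_0_subset: "p < length ds \<Longrightarrow> set (fst (ds ! p)) \<subseteq> set xs \<union> set (take p (map snd ds))"
  using deps_in_nth[OF deps, of p] by (simp add: take_map)

lemma w_0_subset_b: "p < length ds \<Longrightarrow> set (fst (ds ! p)) \<subseteq> set (b 0)"
  using w_0_subset[of p] set_take_subset[of p "map snd ds"] by (auto simp: b_0)

lemma rename_self: "rename vs vs v = v"
  by (auto simp: rename_def split: option.splits dest!: map_of_SomeD) (auto simp: in_set_zip)

lemma copy_0: "copy 0 = id"
  by (auto simp: copy_def rename_self)

lemma map_copy: "map (copy k) (b 0) = b k"
  by (rule nth_equalityI) (auto simp: copy_def length_b rename_nth[OF distinct_b])

lemma copy_X: "map (copy k) xs = X k" and copy_Y: "map (copy k) (map snd ds) = Y k"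
proof -
  have "b k = map (copy k) xs @ map (copy k) (map snd ds)"
    using map_copy[of k] by (simp only: b_0 map_append)
  then show "map (copy k) xs = X k" "map (copy k) (map snd ds) = Y k"
    unfolding X_def Y_def by (simp_all only: take_append drop_append length_map) simp_all
qed

lemma copy_Y_nth: "p < length ds \<Longrightarrow> copy k (snd (ds ! p)) = Y k ! p"
  by (simp flip: copy_Y)

lemma copy_X_nth: "p < length xs \<Longrightarrow> copy k (xs ! p) = X k ! p"
  by (simp flip: copy_X)

lemma copy_in: "v \<in> set (b 0) \<Longrightarrow> copy k v \<in> set (b k)"
  unfolding copy_def by (rule rename_in) (auto simp: distinct_b length_b)

lemma next_copy_copy: "v \<in> set (b 0) \<Longrightarrow> next_copy k (copy k v) = copy (Suc k) v"
proof -
  assume "v \<in> set (b 0)"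
  then obtain i where i: "i < length (b 0)" "v = b 0 ! i" by (auto simp: in_set_conv_nth)
  then show ?thesis
    by (simp add: copy_def next_copy_def rename_nth[OF distinct_b] length_b)
qed

lemma next_copy_earlier: "i < k \<Longrightarrow> v \<in> set (b i) \<Longrightarrow> next_copy k v = v"
  using disjoint_b[of i k] by (auto simp: next_copy_def intro!: rename_other)

lemma w_in: "p < length ds \<Longrightarrow> set (w k p) \<subseteq> set (b k)"
  using w_0_subset_b[of p] copy_in by (auto simp: w_def)

lemma Y_in: "p < length ds \<Longrightarrow> Y k ! p \<in> set (b k)"
  using XY(3)[of k] by (auto simp flip: XY(1))

lemma map_next_copy_w: "p < length ds \<Longrightarrow> map (next_copy k) (w k p) = w (Suc k) p"
  using w_0_subset_b[of p] next_copy_copy by (auto simp: w_def)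

lemma next_copy_Y: "p < length ds \<Longrightarrow> next_copy k (Y k ! p) = Y (Suc k) ! p"
  using next_copy_copy[of "snd (ds ! p)" k] by (simp add: copy_Y_nth b_0)

lemma form_E: "form L (E k)"
  by (induction k) (auto simp: C_props form_subst form_eqs list_all_iff)

lemma form_R: "form L (R k)"
  by (simp add: R_def form_E)

text \<open>Renaming block \<open>k\<close> to block \<open>Suc k\<close> carries matrix and atoms
  along and fixes earlier blocks, so a constraint between rounds \<open>i\<close> and
  \<open>k\<close> becomes one between \<open>i\<close> and \<open>Suc k\<close>. The rule itself
  contributes only the pair of consecutive rounds; together all pairs are covered.\<close>

lemma parts_E:
  shows "subst (\<lambda>v. Var (copy k v)) C \<in> parts (E k)"
    and "p < length ds \<Longrightarrow> depv (w k p) (Y k ! p) \<in> parts (E k)"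
    and "p < length ds \<Longrightarrow> i < k \<Longrightarrow> coherent i k p \<in> parts (E k)"
proof (induction k arbitrary: i)
  case 0
  {
    case 1
    have "subst (\<lambda>v. Var (copy 0 v)) C = C" by (simp add: copy_0)
    moreover have "C \<in> parts (E 0)" unfolding E.simps by (rule parts_conjs[OF _ parts_refl]) simp
    ultimately show ?case by metis
  next
    case 2
    have "depv (fst (ds ! p)) (snd (ds ! p)) \<in> set (map (\<lambda>(zs, y). depv zs y) ds @ [C])"
      using 2 by (auto simp: case_prod_beta intro!: image_eqI[of _ _ "ds ! p"])
    then have "depv (fst (ds ! p)) (snd (ds ! p)) \<in> parts (E 0)"
      unfolding E.simps by (rule parts_conjs[OF _ parts_refl])
    then show ?case using 2 by (simp add: w_def copy_0 XY_0)
  next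
    case 3
    then show ?case by simp
  }
next
  case (Suc k)
  have part: "subst (\<lambda>v. Var (next_copy k v)) A \<in> parts (E (Suc k))" if "A \<in> parts (E k)" for A
    unfolding E.simps by (rule parts_conjs[OF _ parts_subst[OF that]]) simp
  {
    case 1
    have "subst (\<lambda>v. Var (next_copy k v)) (subst (\<lambda>v. Var (copy k v)) C) = subst (\<lambda>v. Var (copy (Suc k) v)) C"
      unfolding subst_subst_qfree[OF C_props(2)] using C_props(4) next_copy_copy by (intro subst_cong) auto
    then show ?case using part[OF Suc.IH(1)] by metis
  next
    case 2
    have "subst (\<lambda>v. Var (next_copy k v)) (depv (w k p) (Y k ! p)) = depv (w (Suc k) p) (Y (Suc k) ! p)"
      using next_copy_Y[OF 2] map_next_copy_w[OF 2, symmetric] by (simp add: depv_def)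
    then show ?case using part[OF Suc.IH(2)[OF 2]] by metis
  next
    case 3
    note p = 3(1)
    show ?case
    proof (cases "i = k")
      case True
      have "(w k p, p) \<in> set (depE_atoms (X k) (Y k) (atoms k))"
        using p by (auto simp: depE_atoms_def atoms_def)
      moreover have "coherent k (Suc k) p = Imp (eqs (map Var (w k p)) (map (\<lambda>w. Var (next_copy k w)) (w k p)))
          (Eq (Var (Y k ! p)) (Var (Y (Suc k) ! p)))"
        unfolding coherent_def map_next_copy_w[OF p, symmetric] by (simp add: comp_def)
      ultimately have "coherent k (Suc k) p \<in> parts (E (Suc k))"
        unfolding E.simps by (intro parts_conjs[OF _ parts_refl]) force
      then show ?thesis using True by simp
    next
      case False
      then have i: "i < k" using 3 by simp
      have "map (next_copy k) (w i p) = w i p"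
        using w_in[OF p, of i] next_copy_earlier[OF i] by (auto intro!: map_idI)
      moreover have "next_copy k (Y i ! p) = Y i ! p" by (rule next_copy_earlier[OF i Y_in[OF p]])
      ultimately have "subst (\<lambda>v. Var (next_copy k v)) (coherent i k p) = coherent i (Suc k) p"
        using map_next_copy_w[OF p, of k] next_copy_Y[OF p, of k]
        by (simp add: coherent_def subst_eqs comp_def flip: map_map[of Var])
          (metis (no_types, lifting) list.map_comp map_eq_conv o_apply)
      then show ?thesis using part[OF Suc.IH(3)[OF p i]] by metis
    qed
  }
qed

text \<open>An atom without arguments leads to an equation between empty tuples, that is, to the
  empty conjunction, which binds 0.\<close>

lemma vars_E: "vars (E k) \<subseteq> insert 0 (\<Union>i \<le> k. set (b i))"
proof -
  define Z where "Z k = insert 0 (\<Union>i \<le> k. set (b i))" for k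
  have bZ: "set (b k) \<subseteq> Z k" for k by (auto simp: Z_def)
  have up: "Z k \<subseteq> Z (Suc k)" for k by (auto simp: Z_def le_Suc_eq)
  have nc: "next_copy k v \<in> Z (Suc k)" if v: "v \<in> Z k" for k v
  proof (cases "v \<in> set (b k)")
    case True
    then have "next_copy k v \<in> set (b (Suc k))"
      unfolding next_copy_def by (intro rename_in) (auto simp: distinct_b length_b)
    then show ?thesis using bZ by blast
  next
    case False
    then have "next_copy k v = v" by (simp add: next_copy_def rename_other)
    then show ?thesis using v up by auto
  qed
  have "vars (E k) \<subseteq> Z k"
  proof (induction k)
    case 0
    have "vars (conjs (map (\<lambda>(zs, y). depv zs y) ds @ [C])) \<subseteq> vars (dep_block ds C)"
      by (simp add: dep_block_def)
    also have "\<dots> \<subseteq> set (b 0)" using nf_shape_dep_vars[OF shape] by (auto simp: b_0)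
    finally show ?case using bZ by auto
  next
    case (Suc k)
    have "next_copy k ` vars (E k) \<subseteq> Z (Suc k)" using Suc.IH nc by auto
    then have 1: "vars (subst (\<lambda>v. Var (next_copy k v)) (E k)) \<subseteq> Z (Suc k)"
      by (rule subset_trans[OF vars_subst_rename Un_least[OF subset_trans[OF Suc.IH up]]])
    have 2: "vars (Imp (eqs (map Var ws) (map (\<lambda>w. Var (next_copy k w)) ws))
        (Eq (Var (Y k ! p)) (Var (Y (Suc k) ! p))) :: ('f, 'r) fm) \<subseteq> Z (Suc k)"
      if a: "(ws, p) \<in> set (depE_atoms (X k) (Y k) (atoms k))" for ws p
    proof -
      have p: "p < length ds" using a by (auto simp: depE_atoms_def atoms_def XY)
      from a consider "ws = w k p" | "ws = X k" by (auto simp: depE_atoms_def atoms_def)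
      then have "set ws \<subseteq> set (b k)"
        using w_in[OF p, of k] set_take_subset[of "length xs" "b k"] by cases (simp_all add: X_def)
      then have ws: "set ws \<subseteq> Z k" using bZ by auto
      then have "next_copy k ` set ws \<subseteq> Z (Suc k)" using nc by auto
      moreover have "vars (eqs (map Var ws) (map (\<lambda>w. Var (next_copy k w)) ws) :: ('f, 'r) fm)
          \<subseteq> insert 0 (set ws \<union> next_copy k ` set ws)"
        using vars_eqs[of "map Var ws" "map (\<lambda>w. Var (next_copy k w)) ws"] by auto
      moreover have "0 \<in> Z (Suc k)" by (simp add: Z_def)
      ultimately have "vars (eqs (map Var ws) (map (\<lambda>w. Var (next_copy k w)) ws) :: ('f, 'r) fm) \<subseteq> Z (Suc k)"
        using ws up[of k] by (meson Un_least insert_subset subset_trans)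
      moreover have "Y k ! p \<in> Z (Suc k)" "Y (Suc k) ! p \<in> Z (Suc k)"
        using Y_in[OF p, of k] Y_in[OF p, of "Suc k"] bZ up[of k] by auto
      ultimately show ?thesis by simp
    qed
    have "vars A \<subseteq> Z (Suc k)" if "A \<in> set (subst (\<lambda>v. Var (next_copy k v)) (E k) #
        map (\<lambda>(ws, p). Imp (eqs (map Var ws) (map (\<lambda>w. Var (next_copy k w)) ws))
          (Eq (Var (Y k ! p)) (Var (Y (Suc k) ! p)))) (depE_atoms (X k) (Y k) (atoms k)))" for A
    proof (cases "A = subst (\<lambda>v. Var (next_copy k v)) (E k)")
      case False
      with that obtain ws p where "(ws, p) \<in> set (depE_atoms (X k) (Y k) (atoms k))"
        "A = Imp (eqs (map Var ws) (map (\<lambda>w. Var (next_copy k w)) ws)) (Eq (Var (Y k ! p)) (Var (Y (Suc k) ! p)))"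
        by auto
      then show ?thesis using 2 by blast
    qed (use 1 in blast)
    moreover have "0 \<in> Z (Suc k)" by (simp add: Z_def)
    ultimately show ?case unfolding E.simps
      by (intro subset_trans[OF vars_conjs_upper] insert_subsetI UN_least)
  qed
  then show ?thesis by (simp only: Z_def)
qed

lemma atoms_subset: "(ws, p) \<in> set (atoms k) \<Longrightarrow> p < length ds \<and> set ws \<subseteq> set (X k) \<union> set (take p (Y k))"
proof -
  assume a: "(ws, p) \<in> set (atoms k)"
  then have p: "p < length ds" and ws: "ws = w k p" by (auto simp: atoms_def)
  have "set ws = copy k ` set (fst (ds ! p))" by (simp add: ws w_def)
  also have "\<dots> \<subseteq> copy k ` (set xs \<union> set (take p (map snd ds)))" using w_0_subset[OF p] by (rule image_mono)
  also have "\<dots> = set (X k) \<union> set (take p (Y k))"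
    by (simp add: image_Un take_map image_image flip: copy_X copy_Y)
  finally show ?thesis using p by blast
qed

text \<open>The atoms are parts of \<open>E k\<close>, so \<open>E k\<close> implies the matrix of
  the premise with \<open>B = E k\<close>. As \<open>B\<close> keeps the atoms, its renamed copy in
  the conclusion is ready for the next application.\<close>

lemma round: "derives L {R k} (alls (X k) (exs (Y k) (And (E k) (R (Suc k)))))"
proof -
  have "derives L {E k} (conjs (map (\<lambda>(ws, p). depv ws (Y k ! p)) (atoms k) @ [E k]))"
    unfolding derives_conjs
  proof
    fix A assume "A \<in> set (map (\<lambda>(ws, p). depv ws (Y k ! p)) (atoms k) @ [E k])"
    then have "A \<in> parts (E k)" using parts_E(2) by (auto simp: atoms_def intro: parts_refl)
    then show "derives L {E k} A" by (rule derives_parts) (auto intro: d_assm form_E)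
  qed
  then have "derives L {R k} (depE_premise (X k) (Y k) (atoms k) (E k))"
    unfolding R_def depE_premise_def by (intro alls_mono exs_mono) (auto simp: form_E)
  moreover have "depE_ok (X k) (Y k) (X (Suc k)) (Y (Suc k)) (atoms k) (E k)"
  proof -
    have "vars (depE_premise (X k) (Y k) (atoms k) (E k)) \<subseteq> insert 0 (\<Union>i \<le> k. set (b i))"
    proof -
      have XYk: "set (X k) \<union> set (Y k) \<subseteq> (\<Union>i \<le> k. set (b i))" by (auto simp flip: XY(1))
      have "vars A \<subseteq> insert 0 (\<Union>i \<le> k. set (b i))"
        if "A \<in> set (map (\<lambda>(ws, p). depv ws (Y k ! p)) (atoms k) @ [E k])" for A
        using that vars_E[of k] w_in[of _ k] Y_in[of _ k] by (auto simp: atoms_def) blast+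
      then have "vars (conjs (map (\<lambda>(ws, p). depv ws (Y k ! p)) (atoms k) @ [E k])) \<subseteq> insert 0 (\<Union>i \<le> k. set (b i))"
        using vars_conjs_upper[of "map (\<lambda>(ws, p). depv ws (Y k ! p)) (atoms k) @ [E k]"] by blast
      then show ?thesis using XYk by (auto simp: depE_premise_def)
    qed
    moreover have "set (b (Suc k)) \<inter> insert 0 (\<Union>i \<le> k. set (b i)) = {}"
    proof -
      have "set (b (Suc k)) \<inter> set (b i) = {}" if "i \<le> k" for i using disjoint_b[of i "Suc k"] that by auto
      then show ?thesis using zero_b[of "Suc k"] by blast
    qed
    moreover have "map snd (atoms k) = [0..<length ds]" by (simp add: atoms_def comp_def)
    moreover have "\<forall>(ws, p) \<in> set (atoms k). p < length (Y k) \<and> set ws \<subseteq> set (X k) \<union> set (take p (Y k))"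
      using atoms_subset XY(3) by auto
    ultimately show ?thesis
      unfolding depE_ok_def XY(1) by (simp add: distinct_b XY(2,3)) blast
  qed
  ultimately have "derives L {R k} (depE_conclusion (X k) (Y k) (X (Suc k)) (Y (Suc k)) (atoms k) (E k))"
    by (rule d_depE)
  then show ?thesis
    by (simp add: depE_conclusion_def Let_def XY R_def next_copy_def)
qed

lemma fv_eqns: "\<Union> (fv ` eqns k) \<subseteq> set (X k) \<union> \<Union> (tvars ` set (e k))"
proof
  fix v assume "v \<in> \<Union> (fv ` eqns k)"
  then obtain x t where xt: "(x, t) \<in> set (zip (X k) (e k))" "v = x \<or> v \<in> tvars t"
    by (auto simp: eqns_def)
  then show "v \<in> set (X k) \<union> \<Union> (tvars ` set (e k))"
    using set_zip_leftD[OF xt(1)] set_zip_rightD[OF xt(1)] by blast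
qed

lemma fv_D: "\<Union> (fv ` D k) \<subseteq> insert 0 (\<Union>i < k. set (b i) \<union> \<Union> (tvars ` set (e i)))"
proof -
  define W where "W k = insert 0 (\<Union>i < k. set (b i) \<union> \<Union> (tvars ` set (e i)))" for k
  have W_Suc: "W (Suc k) = W k \<union> (set (b k) \<union> \<Union> (tvars ` set (e k)))" for k
    by (simp add: W_def lessThan_Suc Un_ac)
  have "insert 0 (\<Union>i \<le> k. set (b i)) \<subseteq> W (Suc k)" for k
    unfolding W_def lessThan_Suc_atMost by blast
  then have E: "fv (E k) \<subseteq> W (Suc k)" for k
    using vars_E[of k] fv_subset_vars[of "E k"] by (meson subset_trans)
  have R: "fv (R k) \<subseteq> W k" for k
  proof
    fix v assume v: "v \<in> fv (R k)"
    then have "v \<notin> set (X k @ Y k)" by (simp add: R_def)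
    moreover have "v \<in> insert 0 (\<Union>i \<le> k. set (b i))"
      using v vars_E[of k] fv_subset_vars[of "E k"] by (auto simp: R_def)
    ultimately show "v \<in> W k"
      unfolding XY(1) by (auto simp: W_def le_less)
  qed
  have "\<Union> (fv ` D k) \<subseteq> W k"
  proof (induction k)
    case 0
    then show ?case using R[of 0] by simp
  next
    case (Suc k)
    have "set (X k) \<subseteq> set (b k)" by (simp add: X_def set_take_subset)
    then have "\<Union> (fv ` eqns k) \<subseteq> W (Suc k)"
      using fv_eqns[of k] unfolding W_Suc by blast
    moreover have "\<Union> (fv ` D k) \<subseteq> W (Suc k)" using Suc.IH unfolding W_Suc by blast
    moreover have "\<Union> (fv ` D (Suc k)) = \<Union> (fv ` D k) \<union> \<Union> (fv ` eqns k) \<union> (fv (E k) \<union> fv (R (Suc k)))" by auto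
    ultimately show ?case using R[of "Suc k"] E[of k] by (simp only: Un_least)
  qed
  then show ?thesis by (simp only: W_def)
qed

text \<open>This provides the eigenvariable conditions of round \<open>k\<close>, for the
  existential block as well as for the equations.\<close>

lemma b_fresh_D: "set (b k) \<inter> \<Union> (fv ` D k) = {}"
proof -
  have "set (b k) \<inter> (set (b i) \<union> \<Union> (tvars ` set (e i))) = {}" if "i < k" for i
    using disjoint_b[OF that] e_fresh[of i k] that by fastforce
  then show ?thesis using fv_D[of k] zero_b[of k] by blast
qed

lemma X_subset: "set (X k) \<subseteq> set (b k)" and Y_subset: "set (Y k) \<subseteq> set (b k)"
  by (simp_all add: X_def Y_def set_take_subset set_drop_subset)

lemma XY_disjoint: "distinct (X k)" "set (Y k) \<inter> set (X k) = {}"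
proof -
  have "distinct (X k @ Y k)" unfolding XY(1) by (rule distinct_b)
  then show "distinct (X k)" "set (Y k) \<inter> set (X k) = {}" by auto
qed

lemma b_fresh_e: "set (b k) \<inter> \<Union> (tvars ` set (e k)) = {}"
proof -
  have "set (b k) \<inter> tvars t = {}" if "t \<in> set (e k)" for t using e_fresh[of k k t] that by auto
  then show ?thesis by blast
qed

lemma R_in_D: "R k \<in> D k"
  by (cases k) auto

text \<open>A refutation after the round is pulled back through it. The universal quantifiers are
  instantiated by the variables \<open>X k\<close> themselves, the answers \<open>Y k\<close> are
  eliminated as eigenvariables, and the equations of the move go by
  \<open>drop_equations\<close>.\<close>

lemma D_consistent:
  assumes "\<not> derives L {R 0} Falsum"
  shows "\<not> derives L (D k) Falsum"
proof (induction k)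
  case (Suc k)
  show ?case
  proof
    assume F: "derives L (D (Suc k)) Falsum"
    let ?P = "D k \<union> eqns k" and ?A = "And (E k) (R (Suc k))"
    have fA: "form L ?A" by (simp add: form_E form_R)
    have "derives L (insert ?A ?P) ?A" using fA by (intro d_assm) auto
    then have A: "derives L (insert ?A ?P) (E k)" "derives L (insert ?A ?P) (R (Suc k))"
      by (rule d_conjE1, rule d_conjE2)
    have "derives L (insert (R (Suc k)) (insert (E k) (insert ?A ?P))) Falsum"
      by (rule d_weaken[OF F]) auto
    then have "derives L (insert (E k) (insert ?A ?P)) Falsum"
      by (rule cut_same[OF d_weaken[OF A(2)], rotated]) auto
    then have "derives L (insert ?A ?P) Falsum" by (rule cut_same[OF A(1)])
    then have "derives L (insert (exs (Y k) ?A) ?P) Falsum"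
    proof (rule exs_elim[OF _ fA])
      have "set (Y k) \<inter> \<Union> (fv ` D k) = {}" using b_fresh_D[of k] Y_subset[of k] by blast
      moreover have "set (Y k) \<inter> \<Union> (tvars ` set (e k)) = {}" using b_fresh_e[of k] Y_subset[of k] by blast
      then have "set (Y k) \<inter> \<Union> (fv ` eqns k) = {}" using fv_eqns[of k] XY_disjoint(2)[of k] by blast
      ultimately show "set (Y k) \<inter> \<Union> (fv ` ?P) = {}" unfolding image_Un Union_Un_distrib by blast
    qed simp
    moreover have "derives L ?P (exs (Y k) ?A)"
      using d_weaken[OF alls_elim[OF round[of k]], of ?P] R_in_D[of k] by auto
    ultimately have "derives L ?P Falsum" using cut_same by blast
    then have "derives L (D k) Falsum"
      unfolding eqns_def
    proof (rule drop_equations)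
      have f: "map fst (zip (X k) (e k)) = X k" by (simp add: XY length_e)
      then show "distinct (map fst (zip (X k) (e k)))" by (simp only: XY_disjoint(1))
      have f': "fst ` set (zip (X k) (e k)) = set (X k)" using f by (metis set_map)
      show "tm_ok L t \<and> tvars t \<inter> fst ` set (zip (X k) (e k)) = {}" if "(x, t) \<in> set (zip (X k) (e k))" for x t
      proof -
        have t: "t \<in> set (e k)" by (rule set_zip_rightD[OF that])
        then show ?thesis unfolding f' using e_ok[OF t] e_fresh[OF order_refl t] X_subset[of k] by blast
      qed
      show "fst ` set (zip (X k) (e k)) \<inter> \<Union> (fv ` D k) = {}"
        unfolding f' using b_fresh_D[of k] X_subset[of k] by blast
    qed
    then show False using Suc by simp
  qed
qed (use assms in simp)

lemma D_union_consistent: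
  assumes "\<not> derives L {R 0} Falsum"
  shows "\<not> derives L (\<Union> (range D)) Falsum"
proof
  assume "derives L (\<Union> (range D)) Falsum"
  then obtain F where F: "F \<subseteq> \<Union> (range D)" "finite F" "derives L F Falsum" using derives_finite by blast
  have mono: "D i \<subseteq> D j" if "i \<le> j" for i j
    using that by (rule lift_Suc_mono_le[of D, rotated]) auto
  from F(2,1) have "\<exists>k. F \<subseteq> D k"
  proof (induction F)
    case (insert A F)
    then obtain k j where "F \<subseteq> D k" "A \<in> D j" by auto
    then have "insert A F \<subseteq> D (max k j)" using mono[of k "max k j"] mono[of j "max k j"] by auto
    then show ?case by blast
  qed simp
  then show False using d_weaken[OF F(3)] D_consistent[OF assms] by blast
qed

lemma game_facts:
  shows "i < length xs \<Longrightarrow> derives L (\<Union> (range D)) (Eq (Var (X k ! i)) (e k ! i))"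
    and "derives L (\<Union> (range D)) (subst (\<lambda>v. Var (copy k v)) C)"
    and "p < length ds \<Longrightarrow> i < k \<Longrightarrow> derives L (\<Union> (range D)) (coherent i k p)"
proof -
  have E: "derives L (\<Union> (range D)) (E k)" by (rule d_assm) (auto intro!: exI[of _ "Suc k"] simp: form_E)
  show "derives L (\<Union> (range D)) (subst (\<lambda>v. Var (copy k v)) C)"
    by (rule derives_parts[OF parts_E(1) E])
  show "p < length ds \<Longrightarrow> i < k \<Longrightarrow> derives L (\<Union> (range D)) (coherent i k p)"
    by (rule derives_parts[OF parts_E(3) E])
  assume i: "i < length xs"
  then have z: "(X k ! i, e k ! i) \<in> set (zip (X k) (e k))" by (auto simp: set_zip XY length_e)
  have "Eq (Var (X k ! i)) (e k ! i) \<in> eqns k"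
    unfolding eqns_def by (rule image_eqI[OF _ z]) simp
  then have "Eq (Var (X k ! i)) (e k ! i) \<in> D (Suc k)" by simp
  moreover have "tm_ok L (e k ! i)" by (rule e_ok[of _ k]) (use i length_e in simp)
  ultimately show "derives L (\<Union> (range D)) (Eq (Var (X k ! i)) (e k ! i))" by (intro d_assm) (auto simp del: D.simps)
qed

end

context game
begin

text \<open>Elements of the model are values of \<open>K\<close>-terms, so any values of the
  universal variables were played in some round, and the answers of that round satisfy the
  matrix.\<close>

lemma game_model:
  fixes K :: "('f, 'r) voc"
  assumes inf: "infinite (UNIV :: 'u set)" and K: "dom (funs K) \<lesssim> (UNIV :: 'u set)" "subvoc K L" "form K C"
    and eK: "\<And>k t. t \<in> set (e k) \<Longrightarrow> tm_ok K t"
    and cover: "\<And>ts. length ts = length xs \<Longrightarrow> \<forall>t \<in> set ts. tm_ok K t \<Longrightarrow> \<exists>k. e k = ts"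
    and cons: "\<not> derives L {R 0} Falsum"
  obtains M :: "('f, 'r, 'u) struct" and s where "structure_of L M" "total_asg M s"
    "tsat M {s} (alls xs (dep_block ds C))"
proof -
  let ?G = "\<Union> (range D)"
  obtain M :: "('f, 'r, 'u) struct" and s where
    M: "\<And>f as. fint M f as \<in> universe M" "universe M = val M s ` {t. tm_ok K t}" "total_asg M s"
    and sat: "\<And>A. qfree A \<Longrightarrow> fo A \<Longrightarrow> form K A \<Longrightarrow> derives L ?G A \<Longrightarrow> sat M s A"
    by (rule term_model[OF inf K(1,2) D_union_consistent[OF cons]]) blast
  have uM: "the (s v) \<in> universe M" for v using M(3) by (auto simp: total_asg_def) (metis imageE option.sel)
  then have ne: "universe M \<noteq> {}" by auto
  \<comment> \<open>\<open>c k v\<close> is the value of the variable \<open>v\<close> of the normal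
    form in round \<open>k\<close>, read off its copy.\<close>
  define c where "c k v = the (s (copy k v))" for k v
  have x: "c k (xs ! i) = val M s (e k ! i)" if i: "i < length xs" for k i
  proof -
    have "e k ! i \<in> set (e k)" using i length_e[of k] by simp
    then have "sat M s (Eq (Var (X k ! i)) (e k ! i))"
      using eK by (intro sat game_facts(1)[OF i]) auto
    then show ?thesis using i by (simp add: c_def copy_X_nth)
  qed
  have matrix: "sat M (\<lambda>v. Some (c k v)) C" for k
  proof -
    have "sat M s (subst (\<lambda>v. Var (copy k v)) C)"
    proof (rule sat[OF _ _ _ game_facts(2)])
      show "qfree (subst (\<lambda>v. Var (copy k v)) C)" by (simp add: qfree_subst C_props(2))
      show "form K (subst (\<lambda>v. Var (copy k v)) C)" using K(3) by (intro form_subst) auto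
    qed (simp add: C_props)
    then show ?thesis
      unfolding sat_subst[OF free_for_qfree[OF C_props(2)]] by (simp add: c_def)
  qed
  have coh: "c i (snd (ds ! p)) = c k (snd (ds ! p))"
    if p: "p < length ds" and ik: "i < k" and eq: "\<forall>z \<in> set (fst (ds ! p)). c i z = c k z" for i k p
  proof -
    let ?W = "eqs (map Var (w i p)) (map Var (w k p)) :: ('f, 'r) fm"
    let ?Q = "Eq (Var (Y i ! p)) (Var (Y k ! p)) :: ('f, 'r) fm"
    have G: "derives L ?G (Imp ?W ?Q)" using game_facts(3)[OF p ik] by (simp add: coherent_def)
    have "sat M s ?Q"
    \<comment> \<open>Without arguments the antecedent is the empty conjunction, which is quantified
      and thus not covered by \<open>sat\<close>; it is detached inside the derivation.\<close>
    proof (cases "fst (ds ! p) = []")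
      case True
      then have "?W = conjs []" by (simp add: w_def eqs_def)
      then have "derives L ?G ?W" using derives_top by metis
      then have "derives L ?G ?Q" by (rule imp_elim[OF G]) simp
      then show ?thesis by (intro sat) auto
    next
      case False
      have "qfree ?W" unfolding eqs_def using False by (subst qfree_conjs) (auto simp: w_def)
      then have "sat M s (Imp ?W ?Q)" using G by (intro sat) (auto intro!: form_eqs simp: list_all_iff)
      moreover have "sat M s ?W"
        by (subst sat_eqs) (use eq in \<open>auto simp: w_def c_def\<close>)
      ultimately show ?thesis by simp
    qed
    then show ?thesis using p by (simp add: c_def copy_Y_nth)
  qed
  obtain a0 where a0: "a0 \<in> universe M" using ne by auto
  \<comment> \<open>\<open>H y\<close> returns the answer of some round in which the arguments of
    \<open>y\<close> had the values \<open>as\<close>. Coherence makes the choice of the round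
    immaterial.\<close>
  define P where "P y as k \<longleftrightarrow> (\<exists>zs. (zs, y) \<in> set ds \<and> as = map (c k) zs)" for y as k
  define H where "H y as = (if \<exists>k. P y as k then c (SOME k. P y as k) y else a0)" for y as
  have HU: "H y as \<in> universe M" for y as using uM a0 by (simp add: H_def c_def)
  have ok: "dep_block_ok ds" by (rule nf_shape_ok[OF shape])
  have H: "H y (map (c k) zs) = c k y" if zy: "(zs, y) \<in> set ds" for zs y k
  proof -
    have "P y (map (c k) zs) k" using zy by (auto simp: P_def)
    moreover define j where "j = (SOME j. P y (map (c k) zs) j)"
    ultimately have "P y (map (c k) zs) j" by (metis someI)
    then obtain ws where ws: "(ws, y) \<in> set ds" "map (c k) zs = map (c j) ws" by (auto simp: P_def)
    have "inj_on snd (set ds)" using ok by (simp add: dep_block_ok_def distinct_map)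
    then have "ws = zs" using inj_onD[of snd "set ds" "(ws, y)" "(zs, y)"] ws(1) zy by simp
    then have eq: "\<forall>z \<in> set zs. c k z = c j z" using ws(2) by simp
    obtain p where p: "p < length ds" "ds ! p = (zs, y)" using zy by (auto simp: in_set_conv_nth)
    consider "k = j" | "k < j" | "j < k" by linarith
    then have "c k y = c j y"
    proof cases
      case 2
      then show ?thesis using coh[OF p(1) 2] eq p(2) by simp
    next
      case 3
      then show ?thesis using coh[OF p(1) 3] eq p(2) by simp
    qed simp
    then show ?thesis using \<open>P y (map (c k) zs) k\<close> by (auto simp: H_def j_def)
  qed
  have "sat M (skol H ds t) C" if t: "t \<in> variants M xs s" for t
  proof -
    have "\<exists>u. tm_ok K u \<and> the (t x) = val M s u" if "x \<in> set xs" for x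
    proof -
      have "t x \<in> Some ` universe M" using t that by (auto simp: variants_def)
      then show ?thesis unfolding M(2) by auto
    qed
    then obtain f where f: "\<And>x. x \<in> set xs \<Longrightarrow> tm_ok K (f x) \<and> the (t x) = val M s (f x)" by metis
    obtain k where k: "e k = map f xs" using cover[of "map f xs"] f by auto
    have tx: "the (t x') = c k x'" if "x' \<in> set xs" for x'
    proof -
      obtain i where i: "i < length xs" "x' = xs ! i" using \<open>x' \<in> set xs\<close> by (auto simp: in_set_conv_nth)
      then show ?thesis using x[OF i(1), of k] f[of x'] k by simp
    qed
    \<comment> \<open>The expected outcome: values of \<open>t\<close> outside the block and the
      answers of round \<open>k\<close> inside it. It solves the Skolem equations, so it is the
      assignment computed by \<open>skol\<close>.\<close>
    define u where "u v = (if v \<in> snd ` set ds then Some (c k v) else t v)" for v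
    have uc: "the (u v) = c k v" if "v \<in> set (b 0)" for v
      using that tx by (auto simp: u_def b_0)
    have "skol H ds t = u"
    proof (rule skol_eqI[OF ok])
      fix zs y assume zy: "(zs, y) \<in> set ds"
      then obtain p where p: "p < length ds" "ds ! p = (zs, y)" by (auto simp: in_set_conv_nth)
      have "map (\<lambda>z. the (u z)) zs = map (c k) zs"
        using w_0_subset_b[OF p(1)] p(2) uc by auto
      moreover have "y \<in> snd ` set ds" using zy by force
      then have "u y = Some (c k y)" by (simp add: u_def)
      ultimately show "u y = Some (H y (map (\<lambda>z. the (u z)) zs))" using H[OF zy, of k] by metis
    qed (simp add: u_def)
    moreover have "sat M u C \<longleftrightarrow> sat M (\<lambda>v. Some (c k v)) C"
      by (rule sat_cong) (use uc C_props(4) in auto)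
    ultimately show ?thesis using matrix by simp
  qed
  then have "tsat M {s} (alls xs (dep_block ds C))"
    using tsat_alls_dep_block[OF ok C_props(1) ne, of "{s}" xs] HU by blast
  moreover have "structure_of L M" using M(1) ne by (simp add: structure_of_def)
  ultimately show thesis using that M(3) by blast
qed

end

lemma finite_set_tm [simp]: "finite (set_tm t)"
  by (induction t) auto

lemma finite_set1_fm [simp]: "finite (set1_fm A)"
  by (induction A) auto

text \<open>Keeps only the function symbols that occur in the matrix, which makes the terms, and
  hence the moves of the game, countable.\<close>

lemma finite_subvoc:
  assumes "form L A"
  obtains K where "subvoc K L" "finite (dom (funs K))" "form K A"
proof -
  let ?K = "\<lambda>S. L\<lparr>funs := funs L |` S\<rparr>"
  have T: "tm_ok L t \<Longrightarrow> set_tm t \<subseteq> S \<Longrightarrow> tm_ok (?K S) t" for t S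
    by (induction t) (auto simp: list_all_iff)
  have "form L A \<Longrightarrow> set1_fm A \<subseteq> S \<Longrightarrow> form (?K S) A" for S
    by (induction A) (auto simp: list_all_iff intro!: T)
  then have "form (?K (set1_fm A)) A" using assms by blast
  moreover have "subvoc (?K (set1_fm A)) L" by (auto simp: subvoc_def map_le_def)
  moreover have "finite (dom (funs (?K (set1_fm A))))" by simp
  ultimately show thesis using that by blast
qed

lemma game_moves:
  assumes "finite (dom (funs K))"
  obtains e :: "nat \<Rightarrow> 'f tm list" where "e 0 = replicate m (Var 0)"
    "\<And>k. length (e k) = m" "\<And>k t. t \<in> set (e k) \<Longrightarrow> tm_ok K t"
    "\<And>ts. length ts = m \<Longrightarrow> \<forall>t \<in> set ts. tm_ok K t \<Longrightarrow> \<exists>k. e k = ts"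
proof -
  let ?T = "{ts. length ts = m \<and> (\<forall>t \<in> set ts. tm_ok K t)}"
  have "dom (funs K) \<lesssim> (UNIV :: nat set)"
    using assms by (meson finite_lepoll_infinite infinite_UNIV_nat)
  then have "{t. tm_ok K t} \<lesssim> (UNIV :: nat set)" by (intro terms_lepoll) auto
  then have "countable {t. tm_ok K t}" unfolding lepoll_def by (metis countableI')
  then have "countable (lists {t. tm_ok K t})" by (rule countable_lists)
  then have cT: "countable ?T" by (rule countable_subset[rotated]) auto
  have r: "replicate m (Var 0) \<in> ?T" by auto
  \<comment> \<open>The enumeration is delayed by one round. Block 0 consists of the variables of
    the normal form and cannot be chosen to suit the first move, so that move uses
    \<open>Var 0\<close> only.\<close>
  define e where "e k = (case k of 0 \<Rightarrow> replicate m (Var 0) | Suc j \<Rightarrow> from_nat_into ?T j)" for k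
  have ran: "e k \<in> ?T" for k
  proof (cases k)
    case (Suc j)
    have "?T \<noteq> {}" using r by blast
    from from_nat_into[OF this] show ?thesis unfolding Suc e_def nat.case .
  qed (use r in \<open>simp add: e_def\<close>)
  have "\<exists>k. e k = ts" if tsT: "ts \<in> ?T" for ts
  proof -
    have "range (from_nat_into ?T) = ?T" using range_from_nat_into[OF _ cT] r by blast
    with tsT have "ts \<in> range (from_nat_into ?T)" by simp
    then obtain j where "ts = from_nat_into ?T j" by (rule rangeE)
    then show ?thesis by (intro exI[of _ "Suc j"]) (simp add: e_def)
  qed
  then show thesis using ran by (intro that[of e]) (auto simp: e_def)
qed

lemma game_blocks:
  fixes vs :: "nat list" and e :: "nat \<Rightarrow> 'f tm list"
  assumes vs: "distinct vs" "0 \<notin> set vs" and e0: "\<And>t. t \<in> set (e 0) \<Longrightarrow> t = Var 0"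
  obtains b where "b 0 = vs" "\<And>k. length (b k) = length vs" "\<And>k. distinct (b k)"
    "\<And>i k. i < k \<Longrightarrow> set (b i) \<inter> set (b k) = {}" "\<And>k. 0 \<notin> set (b k)"
    "\<And>i k t. i \<le> k \<Longrightarrow> t \<in> set (e i) \<Longrightarrow> tvars t \<inter> set (b k) = {}"
proof -
  define U where "U k = insert 0 (set vs \<union> (\<Union>i \<le> k. \<Union> (tvars ` set (e i))))" for k
  have finU: "finite (U k)" for k by (auto simp: U_def)
  define \<mu> where "\<mu> k = Suc (Max (U k))" for k
  have lt: "v < \<mu> k" if "v \<in> U k" for v k using Max_ge[OF finU that] by (simp add: \<mu>_def)
  have mono: "\<mu> i \<le> \<mu> k" if "i \<le> k" for i k
  proof -
    have "U i \<subseteq> U k" using that by (force simp: U_def)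
    then show ?thesis unfolding \<mu>_def using finU by (intro Suc_le_mono[THEN iffD2] Max_mono) (auto simp: U_def)
  qed
  define n where "n = length vs"
  \<comment> \<open>\<open>\<mu> (Suc k)\<close> exceeds \<open>vs\<close> and all variables of the
    moves up to round \<open>Suc k\<close>; the summand \<open>n * k\<close> keeps successive blocks
    of length \<open>n\<close> apart.\<close>
  define N where "N k = \<mu> (Suc k) + n * k" for k
  define b where "b k = (case k of 0 \<Rightarrow> vs | Suc j \<Rightarrow> [N j..<N j + n])" for k
  have b0: "b 0 = vs" and bS: "b (Suc k) = [N k..<N k + n]" for k by (auto simp: b_def)
  have U_less: "v \<notin> set (b (Suc k))" if "v \<in> U (Suc k)" for v k
    using lt[OF that] by (auto simp: bS N_def)
  have vsU: "set vs \<subseteq> U k" "0 \<in> U k" for k by (auto simp: U_def)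
  show thesis
  proof (rule that[of b])
    show "b 0 = vs" by (fact b0)
    show "length (b k) = length vs" for k by (cases k) (auto simp: b0 bS n_def)
    show "distinct (b k)" for k by (cases k) (auto simp: b0 bS vs)
    show "0 \<notin> set (b k)" for k
    proof (cases k)
      case (Suc j)
      then show ?thesis using U_less[OF vsU(2)] by simp
    qed (simp add: b0 vs)
    show "tvars t \<inter> set (b k) = {}" if "i \<le> k" "t \<in> set (e i)" for i k t
    proof (cases k)
      case 0
      then have "t = Var 0" using that e0 by simp
      then show ?thesis using vs(2) 0 by (simp add: b0)
    next
      case (Suc j)
      have "tvars t \<subseteq> U k" using that by (auto simp: U_def)
      then show ?thesis using U_less[of _ j] Suc by blast
    qed
    show "set (b i) \<inter> set (b k) = {}" if "i < k" for i k
    proof -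
      from that obtain j where k: "k = Suc j" by (cases k) auto
      show ?thesis
      proof (cases i)
        case 0
        then show ?thesis using U_less[of _ j] vsU(1)[of "Suc j"] by (auto simp: b0 k)
      next
        case (Suc l)
        then have "l < j" using that k by simp
        then have "n * l + n \<le> n * j" by (metis Suc_leI add.commute mult_Suc_right mult_le_mono2)
        moreover have "\<mu> (Suc l) \<le> \<mu> (Suc j)" using \<open>l < j\<close> by (intro mono) simp
        ultimately have "N l + n \<le> N j" by (simp add: N_def)
        then show ?thesis by (auto simp: Suc k bS)
      qed
    qed
  qed
qed

theorem sentence_model:
  fixes L :: "('f, 'r) voc"
  assumes inf: "infinite (UNIV :: 'u set)" and A: "sentence L A" and cons: "\<not> derives L {A} Falsum"
  obtains M :: "('f, 'r, 'u) struct" and s where "structure_of L M" "total_asg M s" "tsat M {s} A"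
proof -
  have f: "form L A" "fv A = {}" using A by (auto simp: sentence_def)
  \<comment> \<open>The variables of the normal form become block 0 of the game and hence must avoid
    0.\<close>
  obtain xs ds C where fresh: "set (xs @ map snd ds) \<inter> {0} = {}" and nf: "nf_of TYPE('u) L A xs ds C"
    by (rule normal_form[OF f(1), of "{0}"]) auto
  have shape: "nf_shape L {} xs ds C" and d: "derives L {A} (alls xs (dep_block ds C))"
    using nf f(2) by (auto simp: nf_of_def)
  have "form L C" using shape by (simp add: nf_shape_def)
  then obtain K where K: "subvoc K L" "finite (dom (funs K))" "form K C" by (rule finite_subvoc)
  obtain e :: "nat \<Rightarrow> 'f tm list" where e: "e 0 = replicate (length xs) (Var 0)"
    "\<And>k. length (e k) = length xs" "\<And>k t. t \<in> set (e k) \<Longrightarrow> tm_ok K t"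
    "\<And>ts. length ts = length xs \<Longrightarrow> \<forall>t \<in> set ts. tm_ok K t \<Longrightarrow> \<exists>k. e k = ts"
    by (rule game_moves[OF K(2), of "length xs"]) blast
  have vs: "distinct (xs @ map snd ds)" "0 \<notin> set (xs @ map snd ds)"
    using shape fresh by (auto simp: nf_shape_def)
  obtain b where b: "b 0 = xs @ map snd ds" "\<And>k. length (b k) = length (xs @ map snd ds)" "\<And>k. distinct (b k)"
    "\<And>i k. i < k \<Longrightarrow> set (b i) \<inter> set (b k) = {}" "\<And>k. 0 \<notin> set (b k)"
    "\<And>i k t. i \<le> k \<Longrightarrow> t \<in> set (e i) \<Longrightarrow> tvars t \<inter> set (b k) = {}"
    by (rule game_blocks[OF vs, of e]) (use e(1) in \<open>auto split: if_splits\<close>)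
  interpret game L xs ds C b e
    by unfold_locales (use shape b e tm_ok_subvoc[OF K(1)] in auto)
  have "R 0 = alls xs (dep_block ds C)" by (simp add: R_def XY_0 dep_block_def)
  then have cR: "\<not> derives L {R 0} Falsum" using cons derives_trans[OF d] by metis
  have cK: "dom (funs K) \<lesssim> (UNIV :: 'u set)" using inf K(2) by (rule finite_lepoll_infinite)
  show thesis
  proof (rule game_model[OF inf cK K(1,3) _ _ cR])
    fix M :: "('f, 'r, 'u) struct" and s
    assume M: "structure_of L M" "total_asg M s" "tsat M {s} (alls xs (dep_block ds C))"
    then have "tsat M {s} A" using nf unfolding nf_of_def by blast
    then show thesis using that M by blast
  qed (fact e(3), fact e(4))
qed

section \<open>Compactness\<close>

text \<open>Formulas are coded as terms so that \<open>terms_lepoll\<close> also counts formulas.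
  Logical symbols are tagged with their number of arguments, which serves as arity.\<close>

primrec fm_tm :: "('f, 'r) fm \<Rightarrow> ('f + 'r + nat \<times> nat) tm" where
  "fm_tm (Eq t u) = Fun (Inr (Inr (0, 2))) [map_tm Inl t, map_tm Inl u]"
| "fm_tm (Rel r ts) = Fun (Inr (Inl r)) (map (map_tm Inl) ts)"
| "fm_tm (Dep ts) = Fun (Inr (Inr (1, length ts))) (map (map_tm Inl) ts)"
| "fm_tm (Neg A) = Fun (Inr (Inr (2, 1))) [fm_tm A]"
| "fm_tm (And A B) = Fun (Inr (Inr (3, 2))) [fm_tm A, fm_tm B]"
| "fm_tm (Or A B) = Fun (Inr (Inr (4, 2))) [fm_tm A, fm_tm B]"
| "fm_tm (Exists x A) = Fun (Inr (Inr (5, 2))) [Var x, fm_tm A]"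
| "fm_tm (Forall x A) = Fun (Inr (Inr (6, 2))) [Var x, fm_tm A]"

lemma inj_fm_tm: "fm_tm A = fm_tm B \<Longrightarrow> A = B"
proof (induction A arbitrary: B)
  have i: "map_tm Inl t = map_tm Inl u \<longleftrightarrow> t = u" for t u :: "'a tm"
    using tm.inj_map[of Inl] by (auto dest: injD)
  have l: "map (map_tm Inl) ts = map (map_tm Inl) us \<longleftrightarrow> ts = us" for ts us :: "'a tm list"
    by (rule inj_map_eq_map) (simp add: tm.inj_map)
  {
    case (Eq t u)
    then show ?case using i by (cases B) auto
  next
    case (Rel r ts)
    then show ?case using l by (cases B) auto
  next
    case (Dep ts)
    then show ?case using l by (cases B) auto
  next
    case (Neg A)
    then show ?case by (cases B) auto
  next
    case (And A1 A2)
    then show ?case by (cases B) auto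
  next
    case (Or A1 A2)
    then show ?case by (cases B) auto
  next
    case (Exists x A)
    then show ?case by (cases B) auto
  next
    case (Forall x A)
    then show ?case by (cases B) auto
  }
qed

lemma tm_ok_map_tm: "(\<And>f n. funs L f = Some n \<Longrightarrow> funs L' (g f) = Some n) \<Longrightarrow> tm_ok L t \<Longrightarrow> tm_ok L' (map_tm g t)"
  by (induction t) (auto simp: list_all_iff)

text \<open>Skolem symbols are named after sentences of the theory, so this bounds their number and
  the size of the final term model.\<close>

lemma formulas_lepoll:
  fixes L :: "('f, 'r) voc"
  assumes inf: "infinite (UNIV :: 'u set)" and F: "dom (funs L) \<lesssim> (UNIV :: 'u set)"
    and Re: "dom (rels L) \<lesssim> (UNIV :: 'u set)"
  shows "{A. form L A} \<lesssim> (UNIV :: 'u set)"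
proof -
  define L' :: "('f + 'r + nat \<times> nat, unit) voc" where
    "L' = \<lparr>funs = case_sum (funs L) (case_sum (rels L) (\<lambda>(i, n). Some n)), rels = (\<lambda>_. None)\<rparr>"
  have t: "tm_ok L' (map_tm Inl t)" if "tm_ok L t" for t
    using that by (rule tm_ok_map_tm[rotated]) (simp add: L'_def)
  have "form L A \<Longrightarrow> tm_ok L' (fm_tm A)" for A
    by (induction A) (auto simp: L'_def list_all_iff t[unfolded L'_def])
  then have "fm_tm ` {A. form L A} \<subseteq> {t. tm_ok L' t}" by auto
  moreover have "inj_on fm_tm {A. form L A}" by (auto intro!: inj_onI dest: inj_fm_tm)
  ultimately have "{A. form L A} \<lesssim> {t. tm_ok L' t}" unfolding lepoll_def by blast
  also have "{t. tm_ok L' t} \<lesssim> (UNIV :: 'u set)"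
  proof (rule terms_lepoll[OF inf])
    have "dom (funs L') \<subseteq> dom (funs L) <+> (dom (rels L) <+> (UNIV \<times> UNIV))"
    proof
      fix f assume "f \<in> dom (funs L')"
      then show "f \<in> dom (funs L) <+> (dom (rels L) <+> (UNIV \<times> UNIV))"
        unfolding L'_def by (cases f; cases "projr f") auto
    qed
    then have "dom (funs L') \<lesssim> dom (funs L) <+> (dom (rels L) <+> (UNIV \<times> UNIV :: (nat \<times> nat) set))"
      by (rule subset_imp_lepoll)
    also have "\<dots> \<lesssim> (UNIV :: 'u set)"
      by (intro lepoll_Plus lepoll_times lepoll_nat inf F Re)
    finally show "dom (funs L') \<lesssim> (UNIV :: 'u set)" .
  qed
  finally show ?thesis .
qed

text \<open>The syntactic counterpart of \<open>skol\<close>, with symbols \<open>q y n\<close> in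
  place of the functions \<open>H y\<close>.\<close>

fun tskol :: "(nat \<Rightarrow> nat \<Rightarrow> 'f) \<Rightarrow> (nat list \<times> nat) list \<Rightarrow> (nat \<Rightarrow> 'f tm) \<Rightarrow> nat \<Rightarrow> 'f tm" where
  "tskol q [] \<sigma> = \<sigma>"
| "tskol q ((zs, y) # ds) \<sigma> = tskol q ds (\<sigma>(y := Fun (q y (length zs)) (map \<sigma> zs)))"

lemma val_tskol:
  assumes H: "\<And>y as. H y as = fint M (q y (length as)) as"
  shows "(\<lambda>v. Some (val M s (tskol q ds \<sigma> v))) = skol H ds (\<lambda>v. Some (val M s (\<sigma> v)))"
proof (induction ds arbitrary: \<sigma>)
  case (Cons d ds)
  obtain zs y where d: "d = (zs, y)" by (cases d)
  let ?t = "Fun (q y (length zs)) (map \<sigma> zs)"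
  have "val M s ?t = H y (map (\<lambda>z. the (Some (val M s (\<sigma> z)))) zs)"
    by (simp add: H comp_def)
  then have "(\<lambda>v. Some (val M s ((\<sigma>(y := ?t)) v))) =
    (\<lambda>v. Some (val M s (\<sigma> v)))(y \<mapsto> H y (map (\<lambda>z. the (Some (val M s (\<sigma> z)))) zs))"
    by (auto simp: fun_eq_iff simp del: val.simps)
  then show ?case using Cons[of "\<sigma>(y := ?t)"] by (simp only: d tskol.simps skol.simps)
qed simp

lemma tm_ok_tskol:
  assumes "\<And>v. tm_ok L (\<sigma> v)" and "\<And>y n. funs L (q y n) = Some n"
  shows "tm_ok L (tskol q ds \<sigma> v)"
  using assms(1)
proof (induction ds arbitrary: \<sigma>)
  case (Cons d ds)
  obtain zs y where d: "d = (zs, y)" by (cases d)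
  have "tm_ok L (tskol q ds (\<sigma>(y := Fun (q y (length zs)) (map \<sigma> zs))) v)"
    by (rule Cons.IH) (use Cons.prems assms(2) in \<open>auto simp: list_all_iff\<close>)
  then show ?case by (simp add: d)
qed simp

definition reduct :: "('f + 'g, 'r, 'u) struct \<Rightarrow> ('f, 'r, 'u) struct" where
  "reduct M = \<lparr>universe = universe M, fint = (\<lambda>f. fint M (Inl f)), rint = rint M\<rparr>"

lemma universe_reduct [simp]: "universe (reduct M) = universe M"
  by (simp add: reduct_def)

lemma val_reduct: "val (reduct M) s t = val M s (map_tm Inl t)"
  by (induction t) (auto simp: reduct_def comp_def intro!: arg_cong[where f = "fint M _"])

lemma sat_reduct: "sat (reduct M) s A \<longleftrightarrow> sat M s (map_fm Inl id A)"
proof (induction A arbitrary: s)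
  case (Rel r ts)
  have "map (val (reduct M) s) ts = map (val M s) (map (map_tm Inl) ts)" by (simp add: val_reduct)
  then show ?case by (simp add: reduct_def del: map_map)
next
  case (Exists x A)
  then show ?case by (simp del: fun_upd_apply)
next
  case (Forall x A)
  then show ?case by (simp del: fun_upd_apply)
qed (auto simp: val_reduct)

lemma map_fm_props:
  "fo (map_fm g h A) \<longleftrightarrow> fo A" "qfree (map_fm g h A) \<longleftrightarrow> qfree A"
  by (induction A) auto

lemma form_map_fm:
  "(\<And>f n. funs L f = Some n \<Longrightarrow> funs L' (g f) = Some n) \<Longrightarrow> rels L' = rels L \<Longrightarrow> form L A \<Longrightarrow> form L' (map_fm g id A)"
  by (induction A) (auto simp: list_all_iff map_fm_props intro!: tm_ok_map_tm)

theorem compactness: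
  fixes L :: "('f, 'r) voc" and T :: "('f, 'r) fm set"
  assumes inf: "infinite (UNIV :: 'u set)" and F: "dom (funs L) \<lesssim> (UNIV :: 'u set)"
    and Re: "dom (rels L) \<lesssim> (UNIV :: 'u set)" and T: "\<And>A. A \<in> T \<Longrightarrow> sentence L A"
    and fin: "\<And>S. finite S \<Longrightarrow> S \<subseteq> T \<Longrightarrow>
      \<exists>(M :: ('f, 'r, 'u) struct) s. structure_of L M \<and> total_asg M s \<and> (\<forall>A \<in> S. tsat M {s} A)"
  obtains M :: "('f, 'r, 'u) struct" and s where "structure_of L M" "total_asg M s" "\<forall>A \<in> T. tsat M {s} A"
proof -
  have "\<exists>xs ds C. nf_of TYPE('u) L A xs ds C" if "A \<in> T" for A
    using normal_form[of L A "{}"] T[OF that] unfolding sentence_def by (metis finite.emptyI)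
  then obtain xs ds C where nf: "\<And>A. A \<in> T \<Longrightarrow> nf_of TYPE('u) L A (xs A) (ds A) (C A)" by metis
  have shape: "nf_shape L {} (xs A) (ds A) (C A)" and der: "derives L {A} (alls (xs A) (dep_block (ds A) (C A)))"
    if "A \<in> T" for A
    using nf[OF that] T[OF that] by (auto simp: nf_of_def sentence_def)
  have ok: "dep_block_ok (ds A)" if "A \<in> T" for A using nf_shape_ok[OF shape[OF that]] .
  have C: "fo (C A)" "qfree (C A)" "form L (C A)" if "A \<in> T" for A
    using shape[OF that] by (auto simp: nf_shape_def)
  \<comment> \<open>A Skolem symbol carries its arity in its name, so \<open>H y as\<close> can be
    read as \<open>fint M (q y (length as)) as\<close> for lists of every length.\<close>
  define L' :: "('f + ('f, 'r) fm \<times> nat \<times> nat, 'r) voc" where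
    "L' = \<lparr>funs = case_sum (funs L) (\<lambda>(A, y, n). if A \<in> T then Some n else None), rels = rels L\<rparr>"
  define q :: "('f, 'r) fm \<Rightarrow> nat \<Rightarrow> nat \<Rightarrow> 'f + ('f, 'r) fm \<times> nat \<times> nat" where "q A y n = Inr (A, y, n)" for A y n
  define C' :: "('f, 'r) fm \<Rightarrow> ('f + ('f, 'r) fm \<times> nat \<times> nat, 'r) fm" where "C' A = map_fm Inl id (C A)" for A
  define I where "I = (\<lambda>(A, \<sigma>). subst (tskol (q A) (ds A) \<sigma>) (C' A))"
  \<comment> \<open>Universal variables are replaced by arbitrary \<open>L'\<close>-terms and the
    variables of the block by the resulting Skolem terms, which leaves first-order quantifier-free
    formulas.\<close>
  define \<Sigma> where "\<Sigma> = I ` (T \<times> {\<sigma>. \<forall>v. tm_ok L' (\<sigma> v)})"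
  have I: "form L' (I (A, \<sigma>))" "fo (I (A, \<sigma>))" "qfree (I (A, \<sigma>))"
    "sat M s (I (A, \<sigma>)) \<longleftrightarrow> sat (reduct M) (skol (\<lambda>y as. fint M (q A y (length as)) as) (ds A) (\<lambda>v. Some (val M s (\<sigma> v)))) (C A)"
    if A: "A \<in> T" and \<sigma>: "\<And>v. tm_ok L' (\<sigma> v)" for A \<sigma> and M :: "('f + ('f, 'r) fm \<times> nat \<times> nat, 'r, 'u) struct" and s
  proof -
    have "form L' (C' A)" unfolding C'_def by (rule form_map_fm[OF _ _ C(3)[OF A]]) (auto simp: L'_def)
    moreover have "tm_ok L' (tskol (q A) (ds A) \<sigma> v)" for v
      by (rule tm_ok_tskol[OF \<sigma>]) (simp add: q_def L'_def A)
    ultimately show "form L' (I (A, \<sigma>))" by (simp add: I_def form_subst)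
    show "fo (I (A, \<sigma>))" using C(1)[OF A] by (simp add: I_def C'_def map_fm_props)
    show "qfree (I (A, \<sigma>))" using C(2)[OF A] by (simp add: I_def C'_def map_fm_props qfree_subst)
    have "free_for \<tau> (C' A)" for \<tau> using C(2)[OF A] by (simp add: C'_def free_for_qfree map_fm_props)
    then show "sat M s (I (A, \<sigma>)) \<longleftrightarrow> sat (reduct M) (skol (\<lambda>y as. fint M (q A y (length as)) as) (ds A) (\<lambda>v. Some (val M s (\<sigma> v)))) (C A)"
      unfolding sat_reduct C'_def[symmetric] by (simp add: I_def sat_subst val_tskol)
  qed
  have cons: "\<not> derives L' \<Sigma> Falsum"
  proof
    assume "derives L' \<Sigma> Falsum"
    then obtain D where D: "D \<subseteq> \<Sigma>" "finite D" "derives L' D Falsum" using derives_finite by blast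
    then obtain P where P: "P \<subseteq> T \<times> {\<sigma>. \<forall>v. tm_ok L' (\<sigma> v)}" "finite P" "D = I ` P"
      unfolding \<Sigma>_def by (meson finite_subset_image)
    have PT: "fst ` P \<subseteq> T" "finite (fst ` P)" using P by auto
    obtain M :: "('f, 'r, 'u) struct" and s where M0: "structure_of L M \<and> total_asg M s \<and> (\<forall>A \<in> fst ` P. tsat M {s} A)"
      using fin[OF PT(2,1)] by (elim exE)
    then have M: "structure_of L M" "total_asg M s" "\<And>A. A \<in> fst ` P \<Longrightarrow> tsat M {s} A" by blast+
    have ne: "universe M \<noteq> {}" using M(1) by (simp add: structure_of_def)
    have "\<exists>H. (\<forall>y as. H y as \<in> universe M) \<and> (A \<in> fst ` P \<longrightarrow> (\<forall>u. total_asg M u \<longrightarrow> sat M (skol H (ds A) u) (C A)))" for A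
    proof (cases "A \<in> fst ` P")
      case True
      then have A: "A \<in> T" using P(1) by auto
      \<comment> \<open>A sentence true in one nonempty team is true in the team of all total
        assignments. Hence a single family of Skolem functions serves the values of all terms at
        once.\<close>
      let ?X = "{u. total_asg M u}"
      have "tsat M ?X A" using tsat_sentence[OF T[OF A] M(3)[OF True]] by blast
      then have "tsat M ?X (alls (xs A) (dep_block (ds A) (C A)))"
        using derives_sound[OF der[OF A] M(1), of ?X] T[OF A] by (simp add: sentence_def)
      then obtain H where H: "\<forall>y as. H y as \<in> universe M"
        "\<forall>u \<in> ?X. \<forall>t \<in> variants M (xs A) u. sat M (skol H (ds A) t) (C A)"
        unfolding tsat_alls_dep_block[OF ok[OF A] C(1)[OF A] ne] by blast
      have "u \<in> variants M (xs A) u" if "total_asg M u" for u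
        using that by (simp add: variants_def total_asg_def)
      with H show ?thesis by blast
    next
      case False
      obtain a where "a \<in> universe M" using ne by blast
      then show ?thesis using False by (intro exI[of _ "\<lambda>y as. a"]) simp
    qed
    then obtain H where H: "\<And>A y as. H A y as \<in> universe M"
      "\<And>A u. A \<in> fst ` P \<Longrightarrow> total_asg M u \<Longrightarrow> sat M (skol (H A) (ds A) u) (C A)" by metis
    define M' :: "('f + ('f, 'r) fm \<times> nat \<times> nat, 'r, 'u) struct" where
      "M' = \<lparr>universe = universe M, fint = case_sum (fint M) (\<lambda>(A, y, n). H A y), rint = rint M\<rparr>"
    have red: "reduct M' = M" by (simp add: reduct_def M'_def)
    have st: "structure_of L' M'"
      unfolding structure_of_def
    proof (intro conjI allI impI)
      show "universe M' \<noteq> {}" using ne by (simp add: M'_def)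
      fix f n as assume f: "funs L' f = Some n" "length as = n" "set as \<subseteq> universe M'"
      show "fint M' f as \<in> universe M'"
      proof (cases f)
        case (Inl g)
        then show ?thesis using f M(1) by (simp add: structure_of_def L'_def M'_def)
      next
        case (Inr p)
        then show ?thesis using H(1) by (cases p) (simp add: M'_def)
      qed
    qed
    have tot: "total_asg M' s" using M(2) by (simp add: total_asg_def M'_def)
    have "form L' B \<and> tsat M' {s} B" if "B \<in> D" for B
    proof -
      from that obtain A \<sigma> where A: "(A, \<sigma>) \<in> P" "B = I (A, \<sigma>)" unfolding P(3) by auto
      then have AT: "A \<in> T" "A \<in> fst ` P" and \<sigma>: "\<And>v. tm_ok L' (\<sigma> v)" using P(1) by force+
      note IA = I[OF AT(1) \<sigma>]
      have "total_asg M (\<lambda>v. Some (val M' s (\<sigma> v)))"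
        using val_universe[OF st tot \<sigma>] by (simp add: total_asg_def M'_def)
      then have "sat M (skol (H A) (ds A) (\<lambda>v. Some (val M' s (\<sigma> v)))) (C A)" using H(2) AT(2) by blast
      moreover have "(\<lambda>y as. fint M' (q A y (length as)) as) = H A" by (simp add: M'_def q_def)
      ultimately have "sat M' s B" unfolding A(2) IA(4) red by simp
      then show ?thesis using IA(1,2) A(2) by (simp add: tsat_fo)
    qed
    then have "tsat M' {s} Falsum"
      using derives_sound[OF D(3) st, of "{s}"] tot by blast
    then show False by (simp add: Falsum_def)
  qed
  have dom: "dom (funs L') \<lesssim> (UNIV :: 'u set)"
  proof -
    have "dom (funs L') \<subseteq> dom (funs L) <+> (T \<times> (UNIV \<times> UNIV))"
    proof
      fix f assume "f \<in> dom (funs L')"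
      then show "f \<in> dom (funs L) <+> (T \<times> (UNIV \<times> UNIV))"
        unfolding L'_def by (cases f) (auto split: if_splits)
    qed
    then have "dom (funs L') \<lesssim> dom (funs L) <+> (T \<times> (UNIV \<times> UNIV :: (nat \<times> nat) set))"
      by (rule subset_imp_lepoll)
    also have "\<dots> \<lesssim> (UNIV :: 'u set)"
    proof (intro lepoll_Plus lepoll_times lepoll_nat inf F)
      have "T \<subseteq> {A. form L A}" using T by (auto simp: sentence_def)
      then show "T \<lesssim> (UNIV :: 'u set)"
        by (rule lepoll_trans[OF subset_imp_lepoll formulas_lepoll[OF inf F Re]])
    qed
    finally show ?thesis .
  qed
  have sub: "subvoc L' L'" by (simp add: subvoc_def)
  obtain M :: "('f + ('f, 'r) fm \<times> nat \<times> nat, 'r, 'u) struct" and s where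
    M: "\<And>f as. fint M f as \<in> universe M" "universe M = val M s ` {t. tm_ok L' t}" "total_asg M s"
    and sat: "\<And>A. qfree A \<Longrightarrow> fo A \<Longrightarrow> form L' A \<Longrightarrow> derives L' \<Sigma> A \<Longrightarrow> sat M s A"
    by (rule term_model[OF inf dom sub cons]) blast
  let ?M = "reduct M"
  have U: "universe ?M = universe M" by (simp add: reduct_def)
  have tot: "total_asg ?M s" using M(3) by (simp add: total_asg_def U)
  have ne: "universe ?M \<noteq> {}" using M(2) by (auto simp: U intro: exI[of _ "Var 0"])
  have st: "structure_of L ?M" using ne M(1) by (simp add: structure_of_def reduct_def)
  have "tsat ?M {s} A" if A: "A \<in> T" for A
  proof -
    have "sat ?M (skol (\<lambda>y as. fint M (q A y (length as)) as) (ds A) t) (C A)" if t: "t \<in> variants ?M (xs A) s" for t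
    proof -
      \<comment> \<open>Every element is the value of a term, so each variant of \<open>s\<close> is
        induced by a substitution \<open>\<sigma>\<close>, and the instance for
        \<open>\<sigma>\<close> belongs to the theory.\<close>
      have "\<exists>u. tm_ok L' u \<and> t v = Some (val M s u)" for v
        using total_variants[OF tot t] unfolding total_asg_def U M(2) by blast
      then obtain \<sigma> where \<sigma>: "\<And>v. tm_ok L' (\<sigma> v)" "\<And>v. t v = Some (val M s (\<sigma> v))" by metis
      note IA = I[OF A \<sigma>(1)]
      have "I (A, \<sigma>) \<in> \<Sigma>" using A \<sigma>(1) by (auto simp: \<Sigma>_def)
      then have "sat M s (I (A, \<sigma>))" using IA(1-3) by (intro sat d_assm)
      moreover have "t = (\<lambda>v. Some (val M s (\<sigma> v)))" using \<sigma>(2) by auto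
      ultimately show ?thesis unfolding IA(4) by simp
    qed
    moreover have "fint M (q A y (length as)) as \<in> universe ?M" for y as using M(1) by (simp add: U)
    ultimately have "tsat ?M {s} (alls (xs A) (dep_block (ds A) (C A)))"
      unfolding tsat_alls_dep_block[OF ok[OF A] C(1)[OF A] ne]
      by (intro exI[of _ "\<lambda>y as. fint M (q A y (length as)) as"]) blast
    then show ?thesis using nf[OF A] st tot unfolding nf_of_def by blast
  qed
  then show thesis using that st tot by blast
qed

section \<open>Completeness\<close>

text \<open>A finite set is replaced by its conjunction, so that one game suffices.\<close>

lemma finite_theory_model:
  fixes L :: "('f, 'r) voc"
  assumes inf: "infinite (UNIV :: 'u set)" and S: "finite S" "\<And>A. A \<in> S \<Longrightarrow> sentence L A"
    and cons: "\<not> derives L S Falsum"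
  shows "\<exists>(M :: ('f, 'r, 'u) struct) s. structure_of L M \<and> total_asg M s \<and> (\<forall>A \<in> S. tsat M {s} A)"
proof -
  obtain As where As: "set As = S" using S(1) finite_list by blast
  let ?A = "conjs As"
  have "sentence L ?A" using S(2) As by (auto simp: sentence_def)
  moreover have "\<not> derives L {?A} Falsum"
  proof
    assume "derives L {?A} Falsum"
    moreover have "derives L S ?A" unfolding derives_conjs As using S(2) by (auto intro: d_assm simp: sentence_def)
    ultimately show False using cons derives_trans by blast
  qed
  ultimately obtain M :: "('f, 'r, 'u) struct" and s where "structure_of L M" "total_asg M s" "tsat M {s} ?A"
    by (rule sentence_model[OF inf])
  then show ?thesis using As by (auto simp: tsat_conjs)
qed

theorem theorem18:
  fixes L :: "('f, 'r) voc" and T :: "('f, 'r) fm set" and \<phi> :: "('f, 'r) fm"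
  assumes "infinite (UNIV :: 'u set)"
    and "dom (funs L) \<lesssim> (UNIV :: 'u set)"
    and "dom (rels L) \<lesssim> (UNIV :: 'u set)"
    and "\<forall>\<psi> \<in> T. sentence L \<psi>"
    and "sentence L \<phi>" and "fo \<phi>"
  shows "entails TYPE('u) L T \<phi> \<longleftrightarrow> derives L T \<phi>"
proof
  assume d: "derives L T \<phi>"
  show "entails TYPE('u) L T \<phi>"
    unfolding entails_def
  proof (intro allI impI)
    fix M :: "('f, 'r, 'u) struct" and V X
    assume M: "structure_of L M" and X: "\<forall>B \<in> T. tsat M X B"
    obtain a where a: "a \<in> universe M" using M by (auto simp: structure_of_def)
    \<comment> \<open>Teams of the consequence relation have finite domains, while soundness speaks
      of total assignments. Sentences may be moved to the team of one constant assignment and back,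
      provided \<open>X\<close> is nonempty.\<close>
    let ?Y = "{\<lambda>_ :: nat. Some a}"
    show "tsat M X \<phi>"
    proof (cases "X = {}")
      case False
      have "\<forall>B \<in> T. form L B \<and> tsat M ?Y B"
        using X False assms(4) tsat_sentence unfolding sentence_def by blast
      then have "tsat M ?Y \<phi>" using a by (intro derives_sound[OF d M]) (auto simp: total_asg_def)
      then show ?thesis using tsat_sentence[OF assms(5)] by blast
    qed (simp add: tsat_empty)
  qed
next
  assume e: "entails TYPE('u) L T \<phi>"
  show "derives L T \<phi>"
  proof (rule ccontr)
    assume nd: "\<not> derives L T \<phi>"
    let ?T = "insert (Neg \<phi>) T"
    have \<phi>: "form L \<phi>" "fv \<phi> = {}" using assms(5) by (auto simp: sentence_def)
    \<comment> \<open>Indirect proof is available because the conclusion is first-order.\<close>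
    have cons: "\<not> derives L ?T Falsum" using nd raa[OF _ \<phi>(1) assms(6)] by blast
    have sent: "sentence L A" if "A \<in> ?T" for A
      using that assms(4,6) \<phi> by (auto simp: sentence_def)
    have fin: "\<exists>(M :: ('f, 'r, 'u) struct) s. structure_of L M \<and> total_asg M s \<and> (\<forall>A \<in> S. tsat M {s} A)"
      if "finite S" "S \<subseteq> ?T" for S
    proof (rule finite_theory_model[OF assms(1) that(1)])
      show "\<not> derives L S Falsum" using cons d_weaken that(2) by blast
    qed (use sent that(2) in blast)
    obtain M :: "('f, 'r, 'u) struct" and s where M: "structure_of L M" "total_asg M s"
      and sat: "\<forall>A \<in> ?T. tsat M {s} A"
      by (rule compactness[OF assms(1-3) sent fin])
    \<comment> \<open>The model comes with a total assignment, which is not a member of a team.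
      Being sentences, the formulas also hold in the team of the empty assignment.\<close>
    let ?E = "{Map.empty :: 'u asg}"
    have E: "tsat M ?E A" if "A \<in> ?T" for A
      using tsat_sentence[OF sent[OF that] bspec[OF sat that]] by blast
    have "team M {} ?E" by (simp add: team_def)
    moreover have "fv \<phi> \<union> \<Union> (fv ` T) \<subseteq> {}" using \<phi>(2) assms(4) by (auto simp: sentence_def)
    ultimately have "tsat M ?E \<phi>" using e M(1) E unfolding entails_def by blast
    moreover have "tsat M ?E (Neg \<phi>)" using E by blast
    ultimately show False using tsat_fo[OF assms(6), of M ?E] by simp
  qed
qed

end
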